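(* Let $H$ be a quasi-Hopf algebra, $\mathcal A$ an $H$-bimodule algebra and $\mathbb A$ an $H$-bicomodule algebra. View $\mathcal A$ as a left $H\otimes H^{op}$-module algebra with action $(h\otimes h')\cdot\varphi=h\cdot\varphi\cdot h'$ for all $h,h'\in H$, $\varphi\in\mathcal A$, and consider the two left $H\otimes H^{op}$-comodule algebras $\mathbb A_1=(\mathbb A,\lambda_1,\Phi_{\lambda_1})$ and $\mathbb A_2=(\mathbb A,\lambda_2,\Phi_{\lambda_2})$ obtained from $\mathbb A$. Then there are algebra isomorphisms $$\mathcal A\bowtie\mathbb A\equiv\mathcal A\blacktriangleright\!\!<\mathbb A_1,\qquad \mathcal A\blacktriangleright\!\blacktriangleleft\mathbb A\equiv\mathcal A\blacktriangleright\!\!<\mathbb A_2,$$ given by the trivial identifications ($\varphi\bowtie u\mapsto\varphi\blacktriangleright\!\!<u$, respectively $\varphi\blacktriangleright\!\blacktriangleleft u\mapsto\varphi\blacktriangleright\!\!<u$), where $\blacktriangleright\!\!<$ denotes the generalized smash product over $H\otimes H^{op}$.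
   Context: All algebras and spaces are over a field $k$, $\otimes=\otimes_k$; summation is understood. A quasi-bialgebra $(H,\Delta,\varepsilon,\Phi)$: a unital associative algebra $H$, algebra maps $\Delta:H\to H\otimes H$ ($\Delta(h)=h_1\otimes h_2$), $\varepsilon:H\to k$, and an invertible $\Phi=X^1\otimes X^2\otimes X^3\in H^{\otimes3}$, $\Phi^{-1}=x^1\otimes x^2\otimes x^3$, with $(id\otimes\Delta)(\Delta(h))=\Phi(\Delta\otimes id)(\Delta(h))\Phi^{-1}$, $(id\otimes\varepsilon)\Delta=id=(\varepsilon\otimes id)\Delta$, $(1\otimes\Phi)(id\otimes\Delta\otimes id)(\Phi)(\Phi\otimes1)=(id\otimes id\otimes\Delta)(\Phi)(\Delta\otimes id\otimes id)(\Phi)$, $(id\otimes\varepsilon\otimes id)(\Phi)=1\otimes1$. A quasi-Hopf algebra is a quasi-bialgebra with an algebra anti-automorphism $S$ (so $S$ is bijective) and $\alpha,\beta\in H$ such that $S(h_1)\alpha h_2=\varepsilon(h)\alpha$, $h_1\beta S(h_2)=\varepsilon(h)\beta$, $X^1\beta S(X^2)\alpha X^3=1$, $S(x^1)\alpha x^2\beta S(x^3)=1$; by rescaling one assumes $\varepsilon(\alpha)=\varepsilon(\beta)=1$ and $\varepsilon\circ S=\varepsilon$. $H^{op}$ ($H$ with opposite multiplication, same $\Delta,\varepsilon$) is a quasi-bialgebra with reassociator $\Phi^{-1}$, and $H\otimes H^{op}$ is a quasi-bialgebra with componentwise structure and reassociator $(X^1\otimes x^1)\otimes(X^2\otimes x^2)\otimes(X^3\otimes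 x^3)$. Drinfeld twist: $f=f^1\otimes f^2=(S\otimes S)(\Delta^{cop}(x^1))\,\gamma\,\Delta(x^2\beta S(x^3))\in H\otimes H$, where $\Delta^{cop}(h)=h_2\otimes h_1$, $\gamma=S(A^2)\alpha A^3\otimes S(A^1)\alpha A^4$, $A^1\otimes A^2\otimes A^3\otimes A^4=(\Phi\otimes1)(\Delta\otimes id\otimes id)(\Phi^{-1})$; it is invertible. A left $H$-module algebra: a left $H$-module $A$ with bilinear multiplication and two-sided unit $1_A$ with $(aa')a''=(X^1\cdot a)[(X^2\cdot a')(X^3\cdot a'')]$, $h\cdot(aa')=(h_1\cdot a)(h_2\cdot a')$, $h\cdot1_A=\varepsilon(h)1_A$. An $H$-bimodule algebra: an $H$-bimodule $\mathcal A$ with a bilinear multiplication and a two-sided unit $1_{\mathcal A}$ such that $(\varphi\varphi')\varphi''=(X^1\cdot\varphi\cdot x^1)[(X^2\cdot\varphi'\cdot x^2)(X^3\cdot\varphi''\cdot x^3)]$, $h\cdot(\varphi\varphi')=(h_1\cdot\varphi)(h_2\cdot\varphi')$, $(\varphi\varphi')\cdot h=(\varphi\cdot h_1)(\varphi'\cdot h_2)$, $h\cdot1_{\mathcal A}=\varepsilon(h)1_{\mathcal A}=1_{\mathcal A}\cdot h$. A right $H$-comodule algebra: a unital associative algebra $\mathfrak A$, an algebra map $\rho:\mathfrak A\to\mathfrak A\otimes H$, $\rho(a)=a_{\langle0\rangle}\otimes a_{\langle1\rangle}$, and an invertible $\Phi_\rho=\tilde X^1_\rho\otimes\tilde X^2_\rho\otimes\tilde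 X^3_\rho\in\mathfrak A\otimes H\otimes H$ with $\Phi_\rho(\rho\otimes id)(\rho(a))=(id\otimes\Delta)(\rho(a))\Phi_\rho$, $(1\otimes\Phi)(id\otimes\Delta\otimes id)(\Phi_\rho)(\Phi_\rho\otimes1)=(id\otimes id\otimes\Delta)(\Phi_\rho)(\rho\otimes id\otimes id)(\Phi_\rho)$, $(id\otimes\varepsilon)\rho=id$, $(id\otimes\varepsilon\otimes id)(\Phi_\rho)=(id\otimes id\otimes\varepsilon)(\Phi_\rho)=1\otimes1$. A left $H$-comodule algebra (over any quasi-bialgebra $H$): a unital associative algebra $\mathfrak B$, an algebra map $\lambda:\mathfrak B\to H\otimes\mathfrak B$, $\lambda(b)=b_{[-1]}\otimes b_{[0]}$, and an invertible $\Phi_\lambda\in H\otimes H\otimes\mathfrak B$, $\Phi_\lambda^{-1}=\tilde x^1_\lambda\otimes\tilde x^2_\lambda\otimes\tilde x^3_\lambda$, with $(id\otimes\lambda)(\lambda(b))\Phi_\lambda=\Phi_\lambda(\Delta\otimes id)(\lambda(b))$, $(1\otimes\Phi_\lambda)(id\otimes\Delta\otimes id)(\Phi_\lambda)(\Phi\otimes1)=(id\otimes id\otimes\lambda)(\Phi_\lambda)(\Delta\otimes id\otimes id)(\Phi_\lambda)$, $(\varepsilon\otimes id)\lambda=id$, $(id\otimes\varepsilon\otimes id)(\Phi_\lambda)=(\varepsilon\otimes id\otimes id)(\Phi_\lambda)=1\otimes1$. An $H$-bicomodule algebra $(\mathbb A,\lambda,\rho,\Phi_\lambda,\Phi_\rho,\Phi_{\lambda,\rho})$: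 $(\mathbb A,\lambda,\Phi_\lambda)$ is a left and $(\mathbb A,\rho,\Phi_\rho)$ a right $H$-comodule algebra, and $\Phi_{\lambda,\rho}=\Theta^1\otimes\Theta^2\otimes\Theta^3\in H\otimes\mathbb A\otimes H$ is invertible, $\Phi_{\lambda,\rho}^{-1}=\theta^1\otimes\theta^2\otimes\theta^3$, with $\Phi_{\lambda,\rho}(\lambda\otimes id)(\rho(u))=(id\otimes\rho)(\lambda(u))\Phi_{\lambda,\rho}$, $(1\otimes\Phi_{\lambda,\rho})(id\otimes\lambda\otimes id)(\Phi_{\lambda,\rho})(\Phi_\lambda\otimes1)=(id\otimes id\otimes\rho)(\Phi_\lambda)(\Delta\otimes id\otimes id)(\Phi_{\lambda,\rho})$, $(1\otimes\Phi_\rho)(id\otimes\rho\otimes id)(\Phi_{\lambda,\rho})(\Phi_{\lambda,\rho}\otimes1)=(id\otimes id\otimes\Delta)(\Phi_{\lambda,\rho})(\lambda\otimes id\otimes id)(\Phi_\rho)$. Iterated indices mean successive application of $\lambda,\rho,\Delta$. Elements of $H^{\otimes2}\otimes\mathbb A\otimes H^{\otimes2}$: $\Omega=\Omega^1\otimes\cdots\otimes\Omega^5=(\tilde X^1_\rho)_{[-1]_1}\tilde x^1_\lambda\theta^1\otimes(\tilde X^1_\rho)_{[-1]_2}\tilde x^2_\lambda\theta^2_{[-1]}\otimes(\tilde X^1_\rho)_{[0]}\tilde x^3_\lambda\theta^2_{[0]}\otimes S^{-1}(f^1\tilde X^2_\rho\theta^3)\otimes S^{-1}(f^2\tilde X^3_\rho)$,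 $\omega=\omega^1\otimes\cdots\otimes\omega^5=\tilde x^1_\lambda\otimes\tilde x^2_\lambda\Theta^1\otimes(\tilde x^3_\lambda)_{\langle0\rangle}\tilde X^1_\rho\Theta^2_{\langle0\rangle}\otimes S^{-1}(f^1(\tilde x^3_\lambda)_{\langle1\rangle_1}\tilde X^2_\rho\Theta^2_{\langle1\rangle})\otimes S^{-1}(f^2(\tilde x^3_\lambda)_{\langle1\rangle_2}\tilde X^3_\rho\Theta^3)$. Generalized diagonal crossed products: $\mathcal A\bowtie\mathbb A$ and $\mathcal A\blacktriangleright\!\blacktriangleleft\mathbb A$ are the space $\mathcal A\otimes\mathbb A$ with the (associative, unital) multiplications $(\varphi\bowtie u)(\varphi'\bowtie u')=(\Omega^1\cdot\varphi\cdot\Omega^5)(\Omega^2u_{\langle0\rangle_{[-1]}}\cdot\varphi'\cdot S^{-1}(u_{\langle1\rangle})\Omega^4)\bowtie\Omega^3u_{\langle0\rangle_{[0]}}u'$, $(\varphi\blacktriangleright\!\blacktriangleleft u)(\varphi'\blacktriangleright\!\blacktriangleleft u')=(\omega^1\cdot\varphi\cdot\omega^5)(\omega^2u_{[-1]}\cdot\varphi'\cdot S^{-1}(u_{[0]_{\langle1\rangle}})\omega^4)\blacktriangleright\!\blacktriangleleft\omega^3u_{[0]_{\langle0\rangle}}u'$. The left $H\otimes H^{op}$-comodule algebras $\mathbb A_1,\mathbb A_2$: the algebra $\mathbb A$ with $\lambda_1(u)=(u_{\langle0\rangle_{[-1]}}\otimes S^{-1}(u_{\langle1\rangle}))\otimes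 u_{\langle0\rangle_{[0]}}$, $\lambda_2(u)=(u_{[-1]}\otimes S^{-1}(u_{[0]_{\langle1\rangle}}))\otimes u_{[0]_{\langle0\rangle}}$, and $\Phi_{\lambda_1}$, $\Phi_{\lambda_2}$ the inverses in $(H\otimes H^{op})\otimes(H\otimes H^{op})\otimes\mathbb A$ of $(\Omega^1\otimes\Omega^5)\otimes(\Omega^2\otimes\Omega^4)\otimes\Omega^3$ and $(\omega^1\otimes\omega^5)\otimes(\omega^2\otimes\omega^4)\otimes\omega^3$ respectively. Generalized smash product: for a left $H$-module algebra $A$ and a left $H$-comodule algebra $\mathfrak B$ over a quasi-bialgebra $H$, $A\blacktriangleright\!\!<\mathfrak B$ is $A\otimes\mathfrak B$ with multiplication $(a\blacktriangleright\!\!<b)(a'\blacktriangleright\!\!<b')=(\tilde x^1_\lambda\cdot a)(\tilde x^2_\lambda b_{[-1]}\cdot a')\blacktriangleright\!\!<\tilde x^3_\lambda b_{[0]}b'$; it is an associative algebra with unit $1_A\blacktriangleright\!\!<1_{\mathfrak B}$. *)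

theory Defs
  imports "HOL-Algebra.Algebra"
begin

section \<open>Vector spaces, algebras, linear maps\<close>

text \<open>
  A vector space is a \<open>module\<close> record over a field \<open>K\<close>.  The locale \<open>algebra\<close> of HOL-Algebra
  is commutative, hence the following two locales; \<open>unital_algebra\<close> is not assumed associative.
\<close>

definition lin_maps ::
  "('k, 'c) ring_scheme \<Rightarrow> ('k, 'm, 'x) module_scheme \<Rightarrow> ('k, 'n, 'y) module_scheme \<Rightarrow> ('m \<Rightarrow> 'n) set"
  where "lin_maps K M N = {f \<in> carrier M \<rightarrow> carrier N.
    (\<forall>x\<in>carrier M. \<forall>y\<in>carrier M. f (x \<oplus>\<^bsub>M\<^esub> y) = f x \<oplus>\<^bsub>N\<^esub> f y) \<and>
    (\<forall>a\<in>carrier K. \<forall>x\<in>carrier M. f (a \<odot>\<^bsub>M\<^esub> x) = a \<odot>\<^bsub>N\<^esub> f x)}"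

definition bilinear_map ::
  "('k, 'c) ring_scheme \<Rightarrow> ('k, 'm, 'x) module_scheme \<Rightarrow> ('k, 'n, 'y) module_scheme \<Rightarrow>
    ('k, 'p, 'z) module_scheme \<Rightarrow> ('m \<Rightarrow> 'n \<Rightarrow> 'p) \<Rightarrow> bool"
  where "bilinear_map K M N P F \<longleftrightarrow>
    (\<forall>m\<in>carrier M. F m \<in> lin_maps K N P) \<and>
    (\<forall>n\<in>carrier N. (\<lambda>m. F m n) \<in> lin_maps K M P)"

locale unital_algebra = field K + module K A for K (structure) and A (structure) +
  assumes mult_bilinear: "bilinear_map K A A A (\<lambda>x y. x \<otimes>\<^bsub>A\<^esub> y)"
    and unit_closed: "\<one>\<^bsub>A\<^esub> \<in> carrier A"
    and left_unit: "x \<in> carrier A \<Longrightarrow> \<one>\<^bsub>A\<^esub> \<otimes>\<^bsub>A\<^esub> x = x"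
    and right_unit: "x \<in> carrier A \<Longrightarrow> x \<otimes>\<^bsub>A\<^esub> \<one>\<^bsub>A\<^esub> = x"

locale assoc_algebra = unital_algebra +
  assumes mult_assoc: "\<lbrakk>x \<in> carrier A; y \<in> carrier A; z \<in> carrier A\<rbrakk> \<Longrightarrow>
    (x \<otimes>\<^bsub>A\<^esub> y) \<otimes>\<^bsub>A\<^esub> z = x \<otimes>\<^bsub>A\<^esub> (y \<otimes>\<^bsub>A\<^esub> z)"

definition alg_hom ::
  "('k, 'c) ring_scheme \<Rightarrow> ('k, 'm, 'x) module_scheme \<Rightarrow> ('k, 'n, 'y) module_scheme \<Rightarrow> ('m \<Rightarrow> 'n) set"
  where "alg_hom K A B = ring_hom A B \<inter> lin_maps K A B"

definition alg_iso ::
  "('k, 'c) ring_scheme \<Rightarrow> ('k, 'm, 'x) module_scheme \<Rightarrow> ('k, 'n, 'y) module_scheme \<Rightarrow> ('m \<Rightarrow> 'n) set"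
  where "alg_iso K A B = {F \<in> alg_hom K A B. bij_betw F (carrier A) (carrier B)}"


section \<open>Tensor products\<close>

text \<open>
  A tensor is a class of finite formal sums of pairs (lists of pairs) modulo the congruence
  generated by commutativity of the formal sum and by bilinearity.  The rule \<open>zero\<close> is needed
  because lists form only a monoid: it identifies \<open>0 \<otimes> n\<close> with the empty sum; \<open>m \<otimes> 0\<close> and
  additive inverses are then covered by \<open>balance\<close>.
\<close>

type_synonym ('a, 'b) tensor = "('a \<times> 'b) list set"

inductive tensor_eq ::
  "('k, 'c) ring_scheme \<Rightarrow> ('k, 'm, 'x) module_scheme \<Rightarrow> ('k, 'n, 'y) module_scheme \<Rightarrow>
    ('m \<times> 'n) list \<Rightarrow> ('m \<times> 'n) list \<Rightarrow> bool"
  for K M N where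
  refl: "set xs \<subseteq> carrier M \<times> carrier N \<Longrightarrow> tensor_eq K M N xs xs"
| sym: "tensor_eq K M N xs ys \<Longrightarrow> tensor_eq K M N ys xs"
| trans: "\<lbrakk>tensor_eq K M N xs ys; tensor_eq K M N ys zs\<rbrakk> \<Longrightarrow> tensor_eq K M N xs zs"
| append: "\<lbrakk>tensor_eq K M N xs ys; tensor_eq K M N xs' ys'\<rbrakk> \<Longrightarrow>
    tensor_eq K M N (xs @ xs') (ys @ ys')"
| swap: "\<lbrakk>set xs \<subseteq> carrier M \<times> carrier N; set ys \<subseteq> carrier M \<times> carrier N\<rbrakk> \<Longrightarrow>
    tensor_eq K M N (xs @ ys) (ys @ xs)"
| add_left: "\<lbrakk>m \<in> carrier M; m' \<in> carrier M; n \<in> carrier N\<rbrakk> \<Longrightarrow>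
    tensor_eq K M N [(m \<oplus>\<^bsub>M\<^esub> m', n)] [(m, n), (m', n)]"
| add_right: "\<lbrakk>m \<in> carrier M; n \<in> carrier N; n' \<in> carrier N\<rbrakk> \<Longrightarrow>
    tensor_eq K M N [(m, n \<oplus>\<^bsub>N\<^esub> n')] [(m, n), (m, n')]"
| balance: "\<lbrakk>a \<in> carrier K; m \<in> carrier M; n \<in> carrier N\<rbrakk> \<Longrightarrow>
    tensor_eq K M N [(a \<odot>\<^bsub>M\<^esub> m, n)] [(m, a \<odot>\<^bsub>N\<^esub> n)]"
| zero: "n \<in> carrier N \<Longrightarrow> tensor_eq K M N [(\<zero>\<^bsub>M\<^esub>, n)] []"

definition tclass ::
  "('k, 'c) ring_scheme \<Rightarrow> ('k, 'm, 'x) module_scheme \<Rightarrow> ('k, 'n, 'y) module_scheme \<Rightarrow>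
    ('m \<times> 'n) list \<Rightarrow> ('m, 'n) tensor"
  where "tclass K M N xs = {ys. tensor_eq K M N xs ys}"

definition trep :: "('m, 'n) tensor \<Rightarrow> ('m \<times> 'n) list"
  where "trep t = (SOME xs. xs \<in> t)"

text \<open>The tensor product, with componentwise multiplication and unit.\<close>

definition tensor_prod ::
  "('k, 'm, 'x) module_scheme \<Rightarrow> ('k, 'c) ring_scheme \<Rightarrow> ('k, 'n, 'y) module_scheme \<Rightarrow>
    ('k, ('m, 'n) tensor) module"  (\<open>_ \<boxtimes>\<^bsub>_\<^esub> _\<close> [81, 0, 80] 80)
  where "M \<boxtimes>\<^bsub>K\<^esub> N =
    \<lparr>carrier = {tclass K M N xs |xs. set xs \<subseteq> carrier M \<times> carrier N},
     monoid.mult = (\<lambda>s t. tclass K M N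
       [(fst p \<otimes>\<^bsub>M\<^esub> fst q, snd p \<otimes>\<^bsub>N\<^esub> snd q). p \<leftarrow> trep s, q \<leftarrow> trep t]),
     monoid.one = tclass K M N [(\<one>\<^bsub>M\<^esub>, \<one>\<^bsub>N\<^esub>)],
     ring.zero = tclass K M N [],
     ring.add = (\<lambda>s t. tclass K M N (trep s @ trep t)),
     smult = (\<lambda>a t. tclass K M N (map (\<lambda>p. (a \<odot>\<^bsub>M\<^esub> fst p, snd p)) (trep t)))\<rparr>"

definition tens ::
  "('k, 'c) ring_scheme \<Rightarrow> ('k, 'm, 'x) module_scheme \<Rightarrow> ('k, 'n, 'y) module_scheme \<Rightarrow>
    'm \<Rightarrow> 'n \<Rightarrow> ('m, 'n) tensor"
  where "tens K M N m n = tclass K M N [(m, n)]"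

text \<open>Iterated tensor products are nested to the right.\<close>

abbreviation tens3 where
  "tens3 K M N P m n p \<equiv> tens K M (N \<boxtimes>\<^bsub>K\<^esub> P) m (tens K N P n p)"

abbreviation tens4 where
  "tens4 K M N P Q m n p q \<equiv> tens K M (N \<boxtimes>\<^bsub>K\<^esub> P \<boxtimes>\<^bsub>K\<^esub> Q) m (tens3 K N P Q n p q)"

abbreviation tens5 where
  "tens5 K M N P Q R m n p q r \<equiv>
    tens K M (N \<boxtimes>\<^bsub>K\<^esub> P \<boxtimes>\<^bsub>K\<^esub> Q \<boxtimes>\<^bsub>K\<^esub> R) m (tens4 K N P Q R n p q r)"

text \<open>
  Sweedler sums: for \<open>t = t\<^sup>1 \<otimes> t\<^sup>2\<close> (summation understood) \<open>tsum W t F\<close> is \<open>F t\<^sup>1 t\<^sup>2\<close>, a sum in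
  \<open>W\<close>.  It does not depend on the representative when \<open>F\<close> is bilinear, which is the only case
  in which it is used below.
\<close>

definition tsum :: "('x, 'z) ring_scheme \<Rightarrow> ('m, 'n) tensor \<Rightarrow> ('m \<Rightarrow> 'n \<Rightarrow> 'x) \<Rightarrow> 'x"
  where "tsum W t F = foldr (\<lambda>p s. F (fst p) (snd p) \<oplus>\<^bsub>W\<^esub> s) (trep t) \<zero>\<^bsub>W\<^esub>"

abbreviation tsum3 where
  "tsum3 W t F \<equiv> tsum W t (\<lambda>a s. tsum W s (\<lambda>b c. F a b c))"

abbreviation tsum4 where
  "tsum4 W t F \<equiv> tsum W t (\<lambda>a s. tsum3 W s (\<lambda>b c d. F a b c d))"

abbreviation tsum5 where
  "tsum5 W t F \<equiv> tsum W t (\<lambda>a s. tsum4 W s (\<lambda>b c d e. F a b c d e))"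

text \<open>
  \<open>tmap K M' N' f g\<close> is \<open>f \<otimes> g\<close> with values in \<open>M' \<boxtimes> N'\<close>; \<open>tassoc K M N P\<close> is the canonical
  identification of \<open>(M \<boxtimes> N) \<boxtimes> P\<close> with \<open>M \<boxtimes> (N \<boxtimes> P)\<close>; \<open>split1\<close>, \<open>split2\<close>, \<open>split3\<close> are
  \<open>f \<otimes> id\<close>, \<open>id \<otimes> f \<otimes> id\<close>, \<open>id \<otimes> id \<otimes> f\<close> for \<open>f\<close> with values in a tensor product (so \<open>split1\<close>
  also gives \<open>f \<otimes> id \<otimes> id\<close>), and \<open>append_unit\<close> is \<open>t \<mapsto> t \<otimes> 1\<close> on triple tensors.
\<close>

definition tmap ::
  "('k, 'c) ring_scheme \<Rightarrow> ('k, 'm2, 'x) module_scheme \<Rightarrow> ('k, 'n2, 'y) module_scheme \<Rightarrow>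
    ('m \<Rightarrow> 'm2) \<Rightarrow> ('n \<Rightarrow> 'n2) \<Rightarrow> ('m, 'n) tensor \<Rightarrow> ('m2, 'n2) tensor"
  where "tmap K M' N' f g t = tsum (M' \<boxtimes>\<^bsub>K\<^esub> N') t (\<lambda>m n. tens K M' N' (f m) (g n))"

definition tassoc ::
  "('k, 'c) ring_scheme \<Rightarrow> ('k, 'm, 'x) module_scheme \<Rightarrow> ('k, 'n, 'y) module_scheme \<Rightarrow>
    ('k, 'p, 'z) module_scheme \<Rightarrow> (('m, 'n) tensor, 'p) tensor \<Rightarrow> ('m, ('n, 'p) tensor) tensor"
  where "tassoc K M N P t = tsum (M \<boxtimes>\<^bsub>K\<^esub> N \<boxtimes>\<^bsub>K\<^esub> P) t (\<lambda>s p.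
    tsum (M \<boxtimes>\<^bsub>K\<^esub> N \<boxtimes>\<^bsub>K\<^esub> P) s (\<lambda>m n. tens3 K M N P m n p))"

definition split1 where
  "split1 K M1 M2 N f t = tassoc K M1 M2 N (tmap K (M1 \<boxtimes>\<^bsub>K\<^esub> M2) N f id t)"

definition split2 where
  "split2 K M N1 N2 P f t =
    tmap K M (N1 \<boxtimes>\<^bsub>K\<^esub> N2 \<boxtimes>\<^bsub>K\<^esub> P) id (split1 K N1 N2 P f) t"

definition split3 where
  "split3 K M N P1 P2 f t =
    tmap K M (N \<boxtimes>\<^bsub>K\<^esub> P1 \<boxtimes>\<^bsub>K\<^esub> P2) id (tmap K N (P1 \<boxtimes>\<^bsub>K\<^esub> P2) id f) t"

definition append_unit where
  "append_unit K M N P Q t = tsum3 (M \<boxtimes>\<^bsub>K\<^esub> N \<boxtimes>\<^bsub>K\<^esub> P \<boxtimes>\<^bsub>K\<^esub> Q) t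
    (\<lambda>a b c. tens4 K M N P Q a b c \<one>\<^bsub>Q\<^esub>)"

definition mutually_inverse :: "('x, 'z) monoid_scheme \<Rightarrow> 'x \<Rightarrow> 'x \<Rightarrow> bool"
  where "mutually_inverse G x y \<longleftrightarrow> x \<in> carrier G \<and> y \<in> carrier G \<and>
    x \<otimes>\<^bsub>G\<^esub> y = \<one>\<^bsub>G\<^esub> \<and> y \<otimes>\<^bsub>G\<^esub> x = \<one>\<^bsub>G\<^esub>"


section \<open>Quasi-bialgebras and quasi-Hopf algebras\<close>

text \<open>
  Throughout, an invertible element (reassociator) is stored together with its inverse, in a
  field with suffix \<open>_inv\<close>.
\<close>

record ('k, 'h) quasi_bialg = "('k, 'h) module" +
  comul :: "'h \<Rightarrow> ('h, 'h) tensor"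
  counit :: "'h \<Rightarrow> 'k"
  reass :: "('h, ('h, 'h) tensor) tensor"
  reass_inv :: "('h, ('h, 'h) tensor) tensor"

record ('k, 'h) quasi_hopf = "('k, 'h) quasi_bialg" +
  antipode :: "'h \<Rightarrow> 'h"
  qalpha :: 'h
  qbeta :: 'h

locale quasi_bialgebra = assoc_algebra K H for K (structure)
    and H :: "('k, 'h, 'z) quasi_bialg_scheme" (structure) +
  assumes comul_hom: "comul H \<in> alg_hom K H (H \<boxtimes>\<^bsub>K\<^esub> H)"
    and counit_hom: "counit H \<in> ring_hom H K"
    and counit_smult: "\<lbrakk>a \<in> carrier K; h \<in> carrier H\<rbrakk> \<Longrightarrow>
      counit H (a \<odot>\<^bsub>H\<^esub> h) = a \<otimes>\<^bsub>K\<^esub> counit H h"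
    and reass_invertible:
      "mutually_inverse (H \<boxtimes>\<^bsub>K\<^esub> H \<boxtimes>\<^bsub>K\<^esub> H) (reass H) (reass_inv H)"
    and quasi_coassoc: "h \<in> carrier H \<Longrightarrow>
      tmap K H (H \<boxtimes>\<^bsub>K\<^esub> H) id (comul H) (comul H h) =
        reass H \<otimes>\<^bsub>H \<boxtimes>\<^bsub>K\<^esub> H \<boxtimes>\<^bsub>K\<^esub> H\<^esub> split1 K H H H (comul H) (comul H h)
          \<otimes>\<^bsub>H \<boxtimes>\<^bsub>K\<^esub> H \<boxtimes>\<^bsub>K\<^esub> H\<^esub> reass_inv H"
    and counit_right: "h \<in> carrier H \<Longrightarrow>
      tsum H (comul H h) (\<lambda>h1 h2. counit H h2 \<odot>\<^bsub>H\<^esub> h1) = h"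
    and counit_left: "h \<in> carrier H \<Longrightarrow>
      tsum H (comul H h) (\<lambda>h1 h2. counit H h1 \<odot>\<^bsub>H\<^esub> h2) = h"
    and pentagon:
      "tens K H (H \<boxtimes>\<^bsub>K\<^esub> H \<boxtimes>\<^bsub>K\<^esub> H) \<one>\<^bsub>H\<^esub> (reass H)
          \<otimes>\<^bsub>H \<boxtimes>\<^bsub>K\<^esub> H \<boxtimes>\<^bsub>K\<^esub> H \<boxtimes>\<^bsub>K\<^esub> H\<^esub> split2 K H H H H (comul H) (reass H)
          \<otimes>\<^bsub>H \<boxtimes>\<^bsub>K\<^esub> H \<boxtimes>\<^bsub>K\<^esub> H \<boxtimes>\<^bsub>K\<^esub> H\<^esub> append_unit K H H H H (reass H) =
       split3 K H H H H (comul H) (reass H)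
          \<otimes>\<^bsub>H \<boxtimes>\<^bsub>K\<^esub> H \<boxtimes>\<^bsub>K\<^esub> H \<boxtimes>\<^bsub>K\<^esub> H\<^esub> split1 K H H (H \<boxtimes>\<^bsub>K\<^esub> H) (comul H) (reass H)"
    and reass_counit:
      "tsum3 (H \<boxtimes>\<^bsub>K\<^esub> H) (reass H)
         (\<lambda>a b c. counit H b \<odot>\<^bsub>H \<boxtimes>\<^bsub>K\<^esub> H\<^esub> tens K H H a c) = \<one>\<^bsub>H \<boxtimes>\<^bsub>K\<^esub> H\<^esub>"

locale quasi_hopf_algebra = quasi_bialgebra K H for K (structure)
    and H :: "('k, 'h, 'z) quasi_hopf_scheme" (structure) +
  assumes antipode_linear: "antipode H \<in> lin_maps K H H"
    and antipode_bij: "bij_betw (antipode H) (carrier H) (carrier H)"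
    and antipode_mult: "\<lbrakk>g \<in> carrier H; h \<in> carrier H\<rbrakk> \<Longrightarrow>
      antipode H (g \<otimes>\<^bsub>H\<^esub> h) = antipode H h \<otimes>\<^bsub>H\<^esub> antipode H g"
    and antipode_one: "antipode H \<one>\<^bsub>H\<^esub> = \<one>\<^bsub>H\<^esub>"
    and alpha_closed: "qalpha H \<in> carrier H"
    and beta_closed: "qbeta H \<in> carrier H"
    and antipode_alpha: "h \<in> carrier H \<Longrightarrow>
      tsum H (comul H h) (\<lambda>h1 h2. antipode H h1 \<otimes>\<^bsub>H\<^esub> qalpha H \<otimes>\<^bsub>H\<^esub> h2) =
        counit H h \<odot>\<^bsub>H\<^esub> qalpha H"
    and antipode_beta: "h \<in> carrier H \<Longrightarrow>
      tsum H (comul H h) (\<lambda>h1 h2. h1 \<otimes>\<^bsub>H\<^esub> qbeta H \<otimes>\<^bsub>H\<^esub> antipode H h2) =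
        counit H h \<odot>\<^bsub>H\<^esub> qbeta H"
    and antipode_reass:
      "tsum3 H (reass H) (\<lambda>X1 X2 X3.
         X1 \<otimes>\<^bsub>H\<^esub> qbeta H \<otimes>\<^bsub>H\<^esub> antipode H X2 \<otimes>\<^bsub>H\<^esub> qalpha H \<otimes>\<^bsub>H\<^esub> X3) = \<one>\<^bsub>H\<^esub>"
    and antipode_reass_inv:
      "tsum3 H (reass_inv H) (\<lambda>x1 x2 x3.
         antipode H x1 \<otimes>\<^bsub>H\<^esub> qalpha H \<otimes>\<^bsub>H\<^esub> x2 \<otimes>\<^bsub>H\<^esub> qbeta H \<otimes>\<^bsub>H\<^esub> antipode H x3) = \<one>\<^bsub>H\<^esub>"
    and counit_alpha: "counit H (qalpha H) = \<one>\<^bsub>K\<^esub>"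
    and counit_beta: "counit H (qbeta H) = \<one>\<^bsub>K\<^esub>"
    and counit_antipode: "h \<in> carrier H \<Longrightarrow> counit H (antipode H h) = counit H h"

definition antipode_inv :: "('k, 'h, 'z) quasi_hopf_scheme \<Rightarrow> 'h \<Rightarrow> 'h"
  where "antipode_inv H = inv_into (carrier H) (antipode H)"

definition qb_op :: "('k, 'h, 'z) quasi_bialg_scheme \<Rightarrow> ('k, 'h) quasi_bialg"
  where "qb_op H =
    \<lparr>carrier = carrier H, monoid.mult = (\<lambda>x y. y \<otimes>\<^bsub>H\<^esub> x), monoid.one = \<one>\<^bsub>H\<^esub>,
     ring.zero = \<zero>\<^bsub>H\<^esub>, ring.add = ring.add H, smult = smult H,
     comul = comul H, counit = counit H,
     reass = reass_inv H, reass_inv = reass H\<rparr>"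

text \<open>For triple tensors \<open>s\<close>, \<open>t\<close>: \<open>(s\<^sup>1 \<otimes> t\<^sup>1) \<otimes> (s\<^sup>2 \<otimes> t\<^sup>2) \<otimes> (s\<^sup>3 \<otimes> t\<^sup>3)\<close>.\<close>

definition interleave3 where
  "interleave3 K H L s t =
    (let HL = H \<boxtimes>\<^bsub>K\<^esub> L; T = HL \<boxtimes>\<^bsub>K\<^esub> HL \<boxtimes>\<^bsub>K\<^esub> HL
     in tsum3 T s (\<lambda>s1 s2 s3. tsum3 T t (\<lambda>t1 t2 t3.
          tens3 K HL HL HL (tens K H L s1 t1) (tens K H L s2 t2) (tens K H L s3 t3))))"

definition qb_tensor ::
  "('k, 'c) ring_scheme \<Rightarrow> ('k, 'h, 'x) quasi_bialg_scheme \<Rightarrow> ('k, 'l, 'y) quasi_bialg_scheme \<Rightarrow>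
    ('k, ('h, 'l) tensor) quasi_bialg"
  where "qb_tensor K H L =
    (let HL = H \<boxtimes>\<^bsub>K\<^esub> L; T2 = HL \<boxtimes>\<^bsub>K\<^esub> HL in
    \<lparr>carrier = carrier HL, monoid.mult = monoid.mult HL, monoid.one = \<one>\<^bsub>HL\<^esub>,
     ring.zero = \<zero>\<^bsub>HL\<^esub>, ring.add = ring.add HL, smult = smult HL,
     comul = (\<lambda>t. tsum T2 t (\<lambda>h l. tsum T2 (comul H h) (\<lambda>h1 h2. tsum T2 (comul L l) (\<lambda>l1 l2.
       tens K HL HL (tens K H L h1 l1) (tens K H L h2 l2))))),
     counit = (\<lambda>t. tsum K t (\<lambda>h l. counit H h \<otimes>\<^bsub>K\<^esub> counit L l)),
     reass = interleave3 K H L (reass H) (reass L),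
     reass_inv = interleave3 K H L (reass_inv H) (reass_inv L)\<rparr>)"

definition enveloping ::
  "('k, 'c) ring_scheme \<Rightarrow> ('k, 'h, 'x) quasi_bialg_scheme \<Rightarrow> ('k, ('h, 'h) tensor) quasi_bialg"
  where "enveloping K H = qb_tensor K H (qb_op H)"


section \<open>The Drinfeld twist\<close>

definition drinfeld_gamma ::
  "('k, 'c) ring_scheme \<Rightarrow> ('k, 'h, 'z) quasi_hopf_scheme \<Rightarrow> ('h, 'h) tensor"
  where "drinfeld_gamma K H =
    tsum4 (H \<boxtimes>\<^bsub>K\<^esub> H)
      (append_unit K H H H H (reass H)
        \<otimes>\<^bsub>H \<boxtimes>\<^bsub>K\<^esub> H \<boxtimes>\<^bsub>K\<^esub> H \<boxtimes>\<^bsub>K\<^esub> H\<^esub> split1 K H H (H \<boxtimes>\<^bsub>K\<^esub> H) (comul H) (reass_inv H))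
      (\<lambda>A1 A2 A3 A4. tens K H H
        (antipode H A2 \<otimes>\<^bsub>H\<^esub> qalpha H \<otimes>\<^bsub>H\<^esub> A3) (antipode H A1 \<otimes>\<^bsub>H\<^esub> qalpha H \<otimes>\<^bsub>H\<^esub> A4))"

definition drinfeld_twist ::
  "('k, 'c) ring_scheme \<Rightarrow> ('k, 'h, 'z) quasi_hopf_scheme \<Rightarrow> ('h, 'h) tensor"
  where "drinfeld_twist K H =
    tsum3 (H \<boxtimes>\<^bsub>K\<^esub> H) (reass_inv H) (\<lambda>x1 x2 x3.
      tsum (H \<boxtimes>\<^bsub>K\<^esub> H) (comul H x1) (\<lambda>h1 h2. tens K H H (antipode H h2) (antipode H h1))
        \<otimes>\<^bsub>H \<boxtimes>\<^bsub>K\<^esub> H\<^esub> drinfeld_gamma K H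
        \<otimes>\<^bsub>H \<boxtimes>\<^bsub>K\<^esub> H\<^esub> comul H (x2 \<otimes>\<^bsub>H\<^esub> qbeta H \<otimes>\<^bsub>H\<^esub> antipode H x3))"


section \<open>Module algebras and bimodule algebras\<close>

record ('k, 'h, 'a) lmod_alg = "('k, 'a) module" +
  act :: "'h \<Rightarrow> 'a \<Rightarrow> 'a"

locale left_module_algebra = unital_algebra K A for K (structure)
    and H :: "('k, 'h, 'z) quasi_bialg_scheme"
    and A :: "('k, 'h, 'a, 'y) lmod_alg_scheme" (structure) +
  assumes act_bilinear: "bilinear_map K H A A (act A)"
    and act_mult: "\<lbrakk>g \<in> carrier H; h \<in> carrier H; a \<in> carrier A\<rbrakk> \<Longrightarrow>
      act A (g \<otimes>\<^bsub>H\<^esub> h) a = act A g (act A h a)"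
    and act_one: "a \<in> carrier A \<Longrightarrow> act A \<one>\<^bsub>H\<^esub> a = a"
    and quasi_assoc: "\<lbrakk>a \<in> carrier A; b \<in> carrier A; c \<in> carrier A\<rbrakk> \<Longrightarrow>
      (a \<otimes>\<^bsub>A\<^esub> b) \<otimes>\<^bsub>A\<^esub> c = tsum3 A (reass H) (\<lambda>X1 X2 X3.
        act A X1 a \<otimes>\<^bsub>A\<^esub> (act A X2 b \<otimes>\<^bsub>A\<^esub> act A X3 c))"
    and act_prod: "\<lbrakk>h \<in> carrier H; a \<in> carrier A; b \<in> carrier A\<rbrakk> \<Longrightarrow>
      act A h (a \<otimes>\<^bsub>A\<^esub> b) = tsum A (comul H h) (\<lambda>h1 h2. act A h1 a \<otimes>\<^bsub>A\<^esub> act A h2 b)"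
    and act_unit: "h \<in> carrier H \<Longrightarrow> act A h \<one>\<^bsub>A\<^esub> = counit H h \<odot>\<^bsub>A\<^esub> \<one>\<^bsub>A\<^esub>"

record ('k, 'h, 'a) bimod_alg = "('k, 'a) module" +
  lact :: "'h \<Rightarrow> 'a \<Rightarrow> 'a"
  ract :: "'a \<Rightarrow> 'h \<Rightarrow> 'a"

locale bimodule_algebra = unital_algebra K A for K (structure)
    and H :: "('k, 'h, 'z) quasi_bialg_scheme"
    and A :: "('k, 'h, 'a, 'y) bimod_alg_scheme" (structure) +
  assumes lact_bilinear: "bilinear_map K H A A (lact A)"
    and lact_mult: "\<lbrakk>g \<in> carrier H; h \<in> carrier H; a \<in> carrier A\<rbrakk> \<Longrightarrow>
      lact A (g \<otimes>\<^bsub>H\<^esub> h) a = lact A g (lact A h a)"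
    and lact_one: "a \<in> carrier A \<Longrightarrow> lact A \<one>\<^bsub>H\<^esub> a = a"
    and ract_bilinear: "bilinear_map K A H A (ract A)"
    and ract_mult: "\<lbrakk>g \<in> carrier H; h \<in> carrier H; a \<in> carrier A\<rbrakk> \<Longrightarrow>
      ract A a (g \<otimes>\<^bsub>H\<^esub> h) = ract A (ract A a g) h"
    and ract_one: "a \<in> carrier A \<Longrightarrow> ract A a \<one>\<^bsub>H\<^esub> = a"
    and lact_ract: "\<lbrakk>g \<in> carrier H; h \<in> carrier H; a \<in> carrier A\<rbrakk> \<Longrightarrow>
      ract A (lact A g a) h = lact A g (ract A a h)"
    and quasi_assoc: "\<lbrakk>a \<in> carrier A; b \<in> carrier A; c \<in> carrier A\<rbrakk> \<Longrightarrow>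
      (a \<otimes>\<^bsub>A\<^esub> b) \<otimes>\<^bsub>A\<^esub> c =
        tsum3 A (reass H) (\<lambda>X1 X2 X3. tsum3 A (reass_inv H) (\<lambda>x1 x2 x3.
          ract A (lact A X1 a) x1 \<otimes>\<^bsub>A\<^esub>
            (ract A (lact A X2 b) x2 \<otimes>\<^bsub>A\<^esub> ract A (lact A X3 c) x3)))"
    and lact_prod: "\<lbrakk>h \<in> carrier H; a \<in> carrier A; b \<in> carrier A\<rbrakk> \<Longrightarrow>
      lact A h (a \<otimes>\<^bsub>A\<^esub> b) = tsum A (comul H h) (\<lambda>h1 h2. lact A h1 a \<otimes>\<^bsub>A\<^esub> lact A h2 b)"
    and ract_prod: "\<lbrakk>h \<in> carrier H; a \<in> carrier A; b \<in> carrier A\<rbrakk> \<Longrightarrow>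
      ract A (a \<otimes>\<^bsub>A\<^esub> b) h = tsum A (comul H h) (\<lambda>h1 h2. ract A a h1 \<otimes>\<^bsub>A\<^esub> ract A b h2)"
    and lact_unit: "h \<in> carrier H \<Longrightarrow> lact A h \<one>\<^bsub>A\<^esub> = counit H h \<odot>\<^bsub>A\<^esub> \<one>\<^bsub>A\<^esub>"
    and ract_unit: "h \<in> carrier H \<Longrightarrow> ract A \<one>\<^bsub>A\<^esub> h = counit H h \<odot>\<^bsub>A\<^esub> \<one>\<^bsub>A\<^esub>"

text \<open>The \<open>H \<otimes> H\<^sup>o\<^sup>p\<close>-action \<open>(h \<otimes> h') \<cdot> \<phi> = h \<cdot> \<phi> \<cdot> h'\<close> on a bimodule algebra.\<close>

definition bimod_as_lmod :: "('k, 'h, 'a, 'y) bimod_alg_scheme \<Rightarrow> ('k, ('h, 'h) tensor, 'a) lmod_alg"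
  where "bimod_as_lmod A =
    \<lparr>carrier = carrier A, monoid.mult = monoid.mult A, monoid.one = \<one>\<^bsub>A\<^esub>,
     ring.zero = \<zero>\<^bsub>A\<^esub>, ring.add = ring.add A, smult = smult A,
     act = (\<lambda>t \<phi>. tsum A t (\<lambda>h h'. ract A (lact A h \<phi>) h'))\<rparr>"


section \<open>Comodule algebras and bicomodule algebras\<close>

record ('k, 'h, 'b) lcomod_alg = "('k, 'b) module" +
  lcoact :: "'b \<Rightarrow> ('h, 'b) tensor"
  lreass :: "('h, ('h, 'b) tensor) tensor"
  lreass_inv :: "('h, ('h, 'b) tensor) tensor"

record ('k, 'h, 'b) rcomod_alg = "('k, 'b) module" +
  rcoact :: "'b \<Rightarrow> ('b, 'h) tensor"
  rreass :: "('b, ('h, 'h) tensor) tensor"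
  rreass_inv :: "('b, ('h, 'h) tensor) tensor"

locale left_comodule_algebra = assoc_algebra K B for K (structure)
    and H :: "('k, 'h, 'z) quasi_bialg_scheme"
    and B :: "('k, 'h, 'b, 'y) lcomod_alg_scheme" (structure) +
  assumes lcoact_hom: "lcoact B \<in> alg_hom K B (H \<boxtimes>\<^bsub>K\<^esub> B)"
    and lreass_invertible:
      "mutually_inverse (H \<boxtimes>\<^bsub>K\<^esub> H \<boxtimes>\<^bsub>K\<^esub> B) (lreass B) (lreass_inv B)"
    and lquasi_coassoc: "b \<in> carrier B \<Longrightarrow>
      tmap K H (H \<boxtimes>\<^bsub>K\<^esub> B) id (lcoact B) (lcoact B b) \<otimes>\<^bsub>H \<boxtimes>\<^bsub>K\<^esub> H \<boxtimes>\<^bsub>K\<^esub> B\<^esub> lreass B =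
        lreass B \<otimes>\<^bsub>H \<boxtimes>\<^bsub>K\<^esub> H \<boxtimes>\<^bsub>K\<^esub> B\<^esub> split1 K H H B (comul H) (lcoact B b)"
    and lpentagon:
      "tens K H (H \<boxtimes>\<^bsub>K\<^esub> H \<boxtimes>\<^bsub>K\<^esub> B) \<one>\<^bsub>H\<^esub> (lreass B)
          \<otimes>\<^bsub>H \<boxtimes>\<^bsub>K\<^esub> H \<boxtimes>\<^bsub>K\<^esub> H \<boxtimes>\<^bsub>K\<^esub> B\<^esub> split2 K H H H B (comul H) (lreass B)
          \<otimes>\<^bsub>H \<boxtimes>\<^bsub>K\<^esub> H \<boxtimes>\<^bsub>K\<^esub> H \<boxtimes>\<^bsub>K\<^esub> B\<^esub> append_unit K H H H B (reass H) =
       split3 K H H H B (lcoact B) (lreass B)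
          \<otimes>\<^bsub>H \<boxtimes>\<^bsub>K\<^esub> H \<boxtimes>\<^bsub>K\<^esub> H \<boxtimes>\<^bsub>K\<^esub> B\<^esub> split1 K H H (H \<boxtimes>\<^bsub>K\<^esub> B) (comul H) (lreass B)"
    and lcounit: "b \<in> carrier B \<Longrightarrow> tsum B (lcoact B b) (\<lambda>h c. counit H h \<odot>\<^bsub>B\<^esub> c) = b"
    and lreass_counit2:
      "tsum3 (H \<boxtimes>\<^bsub>K\<^esub> B) (lreass B)
         (\<lambda>g h c. counit H h \<odot>\<^bsub>H \<boxtimes>\<^bsub>K\<^esub> B\<^esub> tens K H B g c) = \<one>\<^bsub>H \<boxtimes>\<^bsub>K\<^esub> B\<^esub>"
    and lreass_counit1:
      "tsum3 (H \<boxtimes>\<^bsub>K\<^esub> B) (lreass B)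
         (\<lambda>g h c. counit H g \<odot>\<^bsub>H \<boxtimes>\<^bsub>K\<^esub> B\<^esub> tens K H B h c) = \<one>\<^bsub>H \<boxtimes>\<^bsub>K\<^esub> B\<^esub>"

locale right_comodule_algebra = assoc_algebra K B for K (structure)
    and H :: "('k, 'h, 'z) quasi_bialg_scheme"
    and B :: "('k, 'h, 'b, 'y) rcomod_alg_scheme" (structure) +
  assumes rcoact_hom: "rcoact B \<in> alg_hom K B (B \<boxtimes>\<^bsub>K\<^esub> H)"
    and rreass_invertible:
      "mutually_inverse (B \<boxtimes>\<^bsub>K\<^esub> H \<boxtimes>\<^bsub>K\<^esub> H) (rreass B) (rreass_inv B)"
    and rquasi_coassoc: "b \<in> carrier B \<Longrightarrow>
      rreass B \<otimes>\<^bsub>B \<boxtimes>\<^bsub>K\<^esub> H \<boxtimes>\<^bsub>K\<^esub> H\<^esub> split1 K B H H (rcoact B) (rcoact B b) =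
        tmap K B (H \<boxtimes>\<^bsub>K\<^esub> H) id (comul H) (rcoact B b) \<otimes>\<^bsub>B \<boxtimes>\<^bsub>K\<^esub> H \<boxtimes>\<^bsub>K\<^esub> H\<^esub> rreass B"
    and rpentagon:
      "tens K B (H \<boxtimes>\<^bsub>K\<^esub> H \<boxtimes>\<^bsub>K\<^esub> H) \<one>\<^bsub>B\<^esub> (reass H)
          \<otimes>\<^bsub>B \<boxtimes>\<^bsub>K\<^esub> H \<boxtimes>\<^bsub>K\<^esub> H \<boxtimes>\<^bsub>K\<^esub> H\<^esub> split2 K B H H H (comul H) (rreass B)
          \<otimes>\<^bsub>B \<boxtimes>\<^bsub>K\<^esub> H \<boxtimes>\<^bsub>K\<^esub> H \<boxtimes>\<^bsub>K\<^esub> H\<^esub> append_unit K B H H H (rreass B) =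
       split3 K B H H H (comul H) (rreass B)
          \<otimes>\<^bsub>B \<boxtimes>\<^bsub>K\<^esub> H \<boxtimes>\<^bsub>K\<^esub> H \<boxtimes>\<^bsub>K\<^esub> H\<^esub> split1 K B H (H \<boxtimes>\<^bsub>K\<^esub> H) (rcoact B) (rreass B)"
    and rcounit: "b \<in> carrier B \<Longrightarrow> tsum B (rcoact B b) (\<lambda>c h. counit H h \<odot>\<^bsub>B\<^esub> c) = b"
    and rreass_counit2:
      "tsum3 (B \<boxtimes>\<^bsub>K\<^esub> H) (rreass B)
         (\<lambda>c g h. counit H g \<odot>\<^bsub>B \<boxtimes>\<^bsub>K\<^esub> H\<^esub> tens K B H c h) = \<one>\<^bsub>B \<boxtimes>\<^bsub>K\<^esub> H\<^esub>"
    and rreass_counit3: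
      "tsum3 (B \<boxtimes>\<^bsub>K\<^esub> H) (rreass B)
         (\<lambda>c g h. counit H h \<odot>\<^bsub>B \<boxtimes>\<^bsub>K\<^esub> H\<^esub> tens K B H c g) = \<one>\<^bsub>B \<boxtimes>\<^bsub>K\<^esub> H\<^esub>"

record ('k, 'h, 'u) bicomod_alg = "('k, 'u) module" +
  left_coact :: "'u \<Rightarrow> ('h, 'u) tensor"
  right_coact :: "'u \<Rightarrow> ('u, 'h) tensor"
  phi_l :: "('h, ('h, 'u) tensor) tensor"
  phi_l_inv :: "('h, ('h, 'u) tensor) tensor"
  phi_r :: "('u, ('h, 'h) tensor) tensor"
  phi_r_inv :: "('u, ('h, 'h) tensor) tensor"
  phi_lr :: "('h, ('u, 'h) tensor) tensor"
  phi_lr_inv :: "('h, ('u, 'h) tensor) tensor"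

definition left_part :: "('k, 'h, 'u, 'y) bicomod_alg_scheme \<Rightarrow> ('k, 'h, 'u) lcomod_alg"
  where "left_part U =
    \<lparr>carrier = carrier U, monoid.mult = monoid.mult U, monoid.one = \<one>\<^bsub>U\<^esub>,
     ring.zero = \<zero>\<^bsub>U\<^esub>, ring.add = ring.add U, smult = smult U,
     lcoact = left_coact U, lreass = phi_l U, lreass_inv = phi_l_inv U\<rparr>"

definition right_part :: "('k, 'h, 'u, 'y) bicomod_alg_scheme \<Rightarrow> ('k, 'h, 'u) rcomod_alg"
  where "right_part U =
    \<lparr>carrier = carrier U, monoid.mult = monoid.mult U, monoid.one = \<one>\<^bsub>U\<^esub>,
     ring.zero = \<zero>\<^bsub>U\<^esub>, ring.add = ring.add U, smult = smult U,
     rcoact = right_coact U, rreass = phi_r U, rreass_inv = phi_r_inv U\<rparr>"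

locale bicomodule_algebra =
  fixes K :: "('k, 'c) ring_scheme" (structure)
    and H :: "('k, 'h, 'z) quasi_bialg_scheme"
    and U :: "('k, 'h, 'u, 'y) bicomod_alg_scheme" (structure)
  assumes left_comodule: "left_comodule_algebra K H (left_part U)"
    and right_comodule: "right_comodule_algebra K H (right_part U)"
    and phi_lr_invertible:
      "mutually_inverse (H \<boxtimes>\<^bsub>K\<^esub> U \<boxtimes>\<^bsub>K\<^esub> H) (phi_lr U) (phi_lr_inv U)"
    and lr_coassoc: "u \<in> carrier U \<Longrightarrow>
      phi_lr U \<otimes>\<^bsub>H \<boxtimes>\<^bsub>K\<^esub> U \<boxtimes>\<^bsub>K\<^esub> H\<^esub> split1 K H U H (left_coact U) (right_coact U u) =
        tmap K H (U \<boxtimes>\<^bsub>K\<^esub> H) id (right_coact U) (left_coact U u)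
          \<otimes>\<^bsub>H \<boxtimes>\<^bsub>K\<^esub> U \<boxtimes>\<^bsub>K\<^esub> H\<^esub> phi_lr U"
    and lr_pentagon1:
      "tens K H (H \<boxtimes>\<^bsub>K\<^esub> U \<boxtimes>\<^bsub>K\<^esub> H) \<one>\<^bsub>H\<^esub> (phi_lr U)
          \<otimes>\<^bsub>H \<boxtimes>\<^bsub>K\<^esub> H \<boxtimes>\<^bsub>K\<^esub> U \<boxtimes>\<^bsub>K\<^esub> H\<^esub> split2 K H H U H (left_coact U) (phi_lr U)
          \<otimes>\<^bsub>H \<boxtimes>\<^bsub>K\<^esub> H \<boxtimes>\<^bsub>K\<^esub> U \<boxtimes>\<^bsub>K\<^esub> H\<^esub> append_unit K H H U H (phi_l U) =
       split3 K H H U H (right_coact U) (phi_l U)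
          \<otimes>\<^bsub>H \<boxtimes>\<^bsub>K\<^esub> H \<boxtimes>\<^bsub>K\<^esub> U \<boxtimes>\<^bsub>K\<^esub> H\<^esub> split1 K H H (U \<boxtimes>\<^bsub>K\<^esub> H) (comul H) (phi_lr U)"
    and lr_pentagon2:
      "tens K H (U \<boxtimes>\<^bsub>K\<^esub> H \<boxtimes>\<^bsub>K\<^esub> H) \<one>\<^bsub>H\<^esub> (phi_r U)
          \<otimes>\<^bsub>H \<boxtimes>\<^bsub>K\<^esub> U \<boxtimes>\<^bsub>K\<^esub> H \<boxtimes>\<^bsub>K\<^esub> H\<^esub> split2 K H U H H (right_coact U) (phi_lr U)
          \<otimes>\<^bsub>H \<boxtimes>\<^bsub>K\<^esub> U \<boxtimes>\<^bsub>K\<^esub> H \<boxtimes>\<^bsub>K\<^esub> H\<^esub> append_unit K H U H H (phi_lr U) =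
       split3 K H U H H (comul H) (phi_lr U)
          \<otimes>\<^bsub>H \<boxtimes>\<^bsub>K\<^esub> U \<boxtimes>\<^bsub>K\<^esub> H \<boxtimes>\<^bsub>K\<^esub> H\<^esub> split1 K H U (H \<boxtimes>\<^bsub>K\<^esub> H) (left_coact U) (phi_r U)"


section \<open>Generalized diagonal crossed products\<close>

definition Omega_elt ::
  "('k, 'c) ring_scheme \<Rightarrow> ('k, 'h, 'z) quasi_hopf_scheme \<Rightarrow> ('k, 'h, 'u, 'y) bicomod_alg_scheme \<Rightarrow>
    ('h, ('h, ('u, ('h, 'h) tensor) tensor) tensor) tensor"
  where "Omega_elt K H U =
    (let T = H \<boxtimes>\<^bsub>K\<^esub> H \<boxtimes>\<^bsub>K\<^esub> U \<boxtimes>\<^bsub>K\<^esub> H \<boxtimes>\<^bsub>K\<^esub> H; Sinv = antipode_inv H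
     in tsum3 T (phi_r U) (\<lambda>X1 X2 X3.
        tsum3 T (phi_l_inv U) (\<lambda>x1 x2 x3.
        tsum3 T (phi_lr_inv U) (\<lambda>\<theta>1 \<theta>2 \<theta>3.
        tsum T (drinfeld_twist K H) (\<lambda>f1 f2.
        tsum T (left_coact U X1) (\<lambda>X1m X10.
        tsum T (comul H X1m) (\<lambda>X1m1 X1m2.
        tsum T (left_coact U \<theta>2) (\<lambda>\<theta>2m \<theta>20.
          tens5 K H H U H H
            (X1m1 \<otimes>\<^bsub>H\<^esub> x1 \<otimes>\<^bsub>H\<^esub> \<theta>1)
            (X1m2 \<otimes>\<^bsub>H\<^esub> x2 \<otimes>\<^bsub>H\<^esub> \<theta>2m)
            (X10 \<otimes>\<^bsub>U\<^esub> x3 \<otimes>\<^bsub>U\<^esub> \<theta>20)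
            (Sinv (f1 \<otimes>\<^bsub>H\<^esub> X2 \<otimes>\<^bsub>H\<^esub> \<theta>3))
            (Sinv (f2 \<otimes>\<^bsub>H\<^esub> X3))))))))))"

definition omega_elt ::
  "('k, 'c) ring_scheme \<Rightarrow> ('k, 'h, 'z) quasi_hopf_scheme \<Rightarrow> ('k, 'h, 'u, 'y) bicomod_alg_scheme \<Rightarrow>
    ('h, ('h, ('u, ('h, 'h) tensor) tensor) tensor) tensor"
  where "omega_elt K H U =
    (let T = H \<boxtimes>\<^bsub>K\<^esub> H \<boxtimes>\<^bsub>K\<^esub> U \<boxtimes>\<^bsub>K\<^esub> H \<boxtimes>\<^bsub>K\<^esub> H; Sinv = antipode_inv H
     in tsum3 T (phi_l_inv U) (\<lambda>x1 x2 x3.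
        tsum3 T (phi_r U) (\<lambda>X1 X2 X3.
        tsum3 T (phi_lr U) (\<lambda>\<Theta>1 \<Theta>2 \<Theta>3.
        tsum T (drinfeld_twist K H) (\<lambda>f1 f2.
        tsum T (right_coact U x3) (\<lambda>x30 x31.
        tsum T (comul H x31) (\<lambda>x311 x312.
        tsum T (right_coact U \<Theta>2) (\<lambda>\<Theta>20 \<Theta>21.
          tens5 K H H U H H
            x1
            (x2 \<otimes>\<^bsub>H\<^esub> \<Theta>1)
            (x30 \<otimes>\<^bsub>U\<^esub> X1 \<otimes>\<^bsub>U\<^esub> \<Theta>20)
            (Sinv (f1 \<otimes>\<^bsub>H\<^esub> x311 \<otimes>\<^bsub>H\<^esub> X2 \<otimes>\<^bsub>H\<^esub> \<Theta>21))
            (Sinv (f2 \<otimes>\<^bsub>H\<^esub> x312 \<otimes>\<^bsub>H\<^esub> X3 \<otimes>\<^bsub>H\<^esub> \<Theta>3))))))))))"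

definition diag_crossed_prod ::
  "('k, 'c) ring_scheme \<Rightarrow> ('k, 'h, 'z) quasi_hopf_scheme \<Rightarrow> ('k, 'h, 'a, 'x) bimod_alg_scheme \<Rightarrow>
    ('k, 'h, 'u, 'y) bicomod_alg_scheme \<Rightarrow> ('k, ('a, 'u) tensor) module"
  where "diag_crossed_prod K H A U =
    (let T = A \<boxtimes>\<^bsub>K\<^esub> U; Sinv = antipode_inv H in T\<lparr>monoid.mult := (\<lambda>s s'.
        tsum T s (\<lambda>\<phi> u.
        tsum T s' (\<lambda>\<phi>' u'.
        tsum5 T (Omega_elt K H U) (\<lambda>O1 O2 O3 O4 O5.
        tsum T (right_coact U u) (\<lambda>u0 u1.
        tsum T (left_coact U u0) (\<lambda>u0m u00.
          tens K A U
            (ract A (lact A O1 \<phi>) O5 \<otimes>\<^bsub>A\<^esub>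
              ract A (lact A (O2 \<otimes>\<^bsub>H\<^esub> u0m) \<phi>') (Sinv u1 \<otimes>\<^bsub>H\<^esub> O4))
            (O3 \<otimes>\<^bsub>U\<^esub> u00 \<otimes>\<^bsub>U\<^esub> u')))))))\<rparr>)"

definition diag_crossed_prod' ::
  "('k, 'c) ring_scheme \<Rightarrow> ('k, 'h, 'z) quasi_hopf_scheme \<Rightarrow> ('k, 'h, 'a, 'x) bimod_alg_scheme \<Rightarrow>
    ('k, 'h, 'u, 'y) bicomod_alg_scheme \<Rightarrow> ('k, ('a, 'u) tensor) module"
  where "diag_crossed_prod' K H A U =
    (let T = A \<boxtimes>\<^bsub>K\<^esub> U; Sinv = antipode_inv H in T\<lparr>monoid.mult := (\<lambda>s s'.
        tsum T s (\<lambda>\<phi> u.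
        tsum T s' (\<lambda>\<phi>' u'.
        tsum5 T (omega_elt K H U) (\<lambda>o1 o2 o3 o4 o5.
        tsum T (left_coact U u) (\<lambda>um u0.
        tsum T (right_coact U u0) (\<lambda>u00 u01.
          tens K A U
            (ract A (lact A o1 \<phi>) o5 \<otimes>\<^bsub>A\<^esub>
              ract A (lact A (o2 \<otimes>\<^bsub>H\<^esub> um) \<phi>') (Sinv u01 \<otimes>\<^bsub>H\<^esub> o4))
            (o3 \<otimes>\<^bsub>U\<^esub> u00 \<otimes>\<^bsub>U\<^esub> u')))))))\<rparr>)"


section \<open>The comodule algebras over \<open>H \<otimes> H\<^sup>o\<^sup>p\<close> and the generalized smash product\<close>

text \<open>The rearrangement \<open>(w\<^sup>1 \<otimes> w\<^sup>5) \<otimes> (w\<^sup>2 \<otimes> w\<^sup>4) \<otimes> w\<^sup>3\<close> of \<open>w\<close> in \<open>H \<otimes> H \<otimes> U \<otimes> H \<otimes> H\<close>.\<close>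

definition fold5 ::
  "('k, 'c) ring_scheme \<Rightarrow> ('k, 'h, 'z) quasi_bialg_scheme \<Rightarrow> ('k, 'u, 'y) module_scheme \<Rightarrow>
    ('h, ('h, ('u, ('h, 'h) tensor) tensor) tensor) tensor \<Rightarrow>
    (('h, 'h) tensor, (('h, 'h) tensor, 'u) tensor) tensor"
  where "fold5 K H U w =
    (let E = enveloping K H; H' = qb_op H in
      tsum5 (E \<boxtimes>\<^bsub>K\<^esub> E \<boxtimes>\<^bsub>K\<^esub> U) w (\<lambda>w1 w2 w3 w4 w5.
        tens3 K E E U (tens K H H' w1 w5) (tens K H H' w2 w4) w3))"

text \<open>
  In \<open>comod1\<close> and \<open>comod2\<close> the prescribed datum is the inverse reassociator, i.e. the rearranged
  \<open>Omega_elt\<close> resp. \<open>omega_elt\<close>; the reassociator itself is its inverse in the algebra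
  \<open>(H \<otimes> H\<^sup>o\<^sup>p) \<otimes> (H \<otimes> H\<^sup>o\<^sup>p) \<otimes> U\<close>.
\<close>

definition comod1 ::
  "('k, 'c) ring_scheme \<Rightarrow> ('k, 'h, 'z) quasi_hopf_scheme \<Rightarrow> ('k, 'h, 'u, 'y) bicomod_alg_scheme \<Rightarrow>
    ('k, ('h, 'h) tensor, 'u) lcomod_alg"
  where "comod1 K H U =
    (let E = enveloping K H; H' = qb_op H; T = E \<boxtimes>\<^bsub>K\<^esub> U; Sinv = antipode_inv H in
    \<lparr>carrier = carrier U, monoid.mult = monoid.mult U, monoid.one = \<one>\<^bsub>U\<^esub>,
     ring.zero = \<zero>\<^bsub>U\<^esub>, ring.add = ring.add U, smult = smult U,
     lcoact = (\<lambda>u. tsum T (right_coact U u) (\<lambda>u0 u1. tsum T (left_coact U u0) (\<lambda>u0m u00.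
       tens K E U (tens K H H' u0m (Sinv u1)) u00))),
     lreass = inv\<^bsub>E \<boxtimes>\<^bsub>K\<^esub> E \<boxtimes>\<^bsub>K\<^esub> U\<^esub> (fold5 K H U (Omega_elt K H U)),
     lreass_inv = fold5 K H U (Omega_elt K H U)\<rparr>)"

definition comod2 ::
  "('k, 'c) ring_scheme \<Rightarrow> ('k, 'h, 'z) quasi_hopf_scheme \<Rightarrow> ('k, 'h, 'u, 'y) bicomod_alg_scheme \<Rightarrow>
    ('k, ('h, 'h) tensor, 'u) lcomod_alg"
  where "comod2 K H U =
    (let E = enveloping K H; H' = qb_op H; T = E \<boxtimes>\<^bsub>K\<^esub> U; Sinv = antipode_inv H in
    \<lparr>carrier = carrier U, monoid.mult = monoid.mult U, monoid.one = \<one>\<^bsub>U\<^esub>,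
     ring.zero = \<zero>\<^bsub>U\<^esub>, ring.add = ring.add U, smult = smult U,
     lcoact = (\<lambda>u. tsum T (left_coact U u) (\<lambda>um u0. tsum T (right_coact U u0) (\<lambda>u00 u01.
       tens K E U (tens K H H' um (Sinv u01)) u00))),
     lreass = inv\<^bsub>E \<boxtimes>\<^bsub>K\<^esub> E \<boxtimes>\<^bsub>K\<^esub> U\<^esub> (fold5 K H U (omega_elt K H U)),
     lreass_inv = fold5 K H U (omega_elt K H U)\<rparr>)"

definition smash_prod ::
  "('k, 'c) ring_scheme \<Rightarrow> ('k, 'h, 'z) quasi_bialg_scheme \<Rightarrow> ('k, 'h, 'a, 'x) lmod_alg_scheme \<Rightarrow>
    ('k, 'h, 'b, 'y) lcomod_alg_scheme \<Rightarrow> ('k, ('a, 'b) tensor) module"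
  where "smash_prod K H A B =
    (let T = A \<boxtimes>\<^bsub>K\<^esub> B in T\<lparr>monoid.mult := (\<lambda>s s'.
        tsum T s (\<lambda>a b.
        tsum T s' (\<lambda>a' b'.
        tsum3 T (lreass_inv B) (\<lambda>x1 x2 x3.
        tsum T (lcoact B b) (\<lambda>bm b0.
          tens K A B
            (act A x1 a \<otimes>\<^bsub>A\<^esub> act A (x2 \<otimes>\<^bsub>H\<^esub> bm) a')
            (x3 \<otimes>\<^bsub>B\<^esub> b0 \<otimes>\<^bsub>B\<^esub> b'))))))\<rparr>)"

end

(*
Every Sweedler sum in the definitions is the value of a linear map on a tensor, because the
summand is multilinear.  Hence a linear map may be moved inside a sum and evaluated on pure
tensors.  On pure tensors (h \<otimes> l) acts by \<phi> \<mapsto> h \<cdot> \<phi> \<cdot> l, so the module algebra axioms over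
H \<otimes> H^op become the left and right bimodule algebra axioms, and the summands of the
generalized smash product over H \<otimes> H^op become those of the diagonal crossed products; the
identity map is the isomorphism.  Only the inverse reassociators of the two comodule algebras
enter the smash product, and these are given by definition.
*)

theory Submission
  imports Defs
begin

section \<open>Linear and bilinear maps\<close>

text \<open>\<open>tsum\<close> runs over the list \<open>trep t\<close>, a representative chosen by
  \<open>SOME\<close>, and this choice shapes the proof. Rewriting that leaves the tensor alone
  (moving a linear map into a sum, replacing the summand, linearity in a parameter of the summand)
  acts on one fixed list and asks of the summand only its behaviour on the carriers. Rewriting that
  touches the tensor (evaluation on \<open>tens\<close>, linearity in the tensor) changes the list
  and requires a bilinear summand. So bilinearity is established for the functions applied to a
  tensor that is itself given by a Sweedler sum: the coproduct and the reassociator of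
  \<open>enveloping\<close>, the folded \<open>Omega_elt\<close> and \<open>omega_elt\<close>, the
  coactions of \<open>comod1\<close> and \<open>comod2\<close>. The remaining sums, over the two
  factors of the product, over \<open>Omega_elt\<close> or \<open>omega_elt\<close> and over the
  coactions of \<open>U\<close>, run through the same lists in both products and are compared term
  by term. For these, membership in the carrier has to be shown, which is why the Drinfeld twist is
  followed through its definition.\<close>

lemma lin_mapsI:
  assumes "\<And>x. x \<in> carrier M \<Longrightarrow> f x \<in> carrier N"
    and "\<And>x y. \<lbrakk>x \<in> carrier M; y \<in> carrier M\<rbrakk> \<Longrightarrow> f (x \<oplus>\<^bsub>M\<^esub> y) = f x \<oplus>\<^bsub>N\<^esub> f y"
    and "\<And>a x. \<lbrakk>a \<in> carrier K; x \<in> carrier M\<rbrakk> \<Longrightarrow> f (a \<odot>\<^bsub>M\<^esub> x) = a \<odot>\<^bsub>N\<^esub> f x"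
  shows "f \<in> lin_maps K M N"
  using assms by (auto simp: lin_maps_def)

lemma lin_maps_closed: "\<lbrakk>f \<in> lin_maps K M N; x \<in> carrier M\<rbrakk> \<Longrightarrow> f x \<in> carrier N"
  and lin_maps_add: "\<lbrakk>f \<in> lin_maps K M N; x \<in> carrier M; y \<in> carrier M\<rbrakk> \<Longrightarrow>
    f (x \<oplus>\<^bsub>M\<^esub> y) = f x \<oplus>\<^bsub>N\<^esub> f y"
  and lin_maps_smult: "\<lbrakk>f \<in> lin_maps K M N; a \<in> carrier K; x \<in> carrier M\<rbrakk> \<Longrightarrow>
    f (a \<odot>\<^bsub>M\<^esub> x) = a \<odot>\<^bsub>N\<^esub> f x"
  by (auto simp: lin_maps_def)

text \<open>\<open>lin_maps\<close> demands additivity and homogeneity only; the value at zero comes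
  from homogeneity at the scalar zero.\<close>

lemma lin_maps_zero:
  assumes "module K M" "module K N" "f \<in> lin_maps K M N"
  shows "f \<zero>\<^bsub>M\<^esub> = \<zero>\<^bsub>N\<^esub>"
proof -
  interpret M: module K M by fact
  interpret N: module K N by fact
  show ?thesis
    using lin_maps_smult[OF assms(3), of "\<zero>\<^bsub>K\<^esub>" "\<zero>\<^bsub>M\<^esub>"] lin_maps_closed[OF assms(3), of "\<zero>\<^bsub>M\<^esub>"]
    by simp
qed

lemma lin_maps_id: "(\<lambda>x. x) \<in> lin_maps K M M"
  by (simp add: lin_maps_def)

text \<open>Functions are total, but linearity concerns the carrier only. This transfers linearity
  from the double Sweedler sum to the record multiplication of a tensor product, as the two agree on
  the carrier.\<close>

lemma lin_maps_cong:
  assumes "module K M" "g \<in> lin_maps K M N" "\<And>x. x \<in> carrier M \<Longrightarrow> f x = g x"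
  shows "f \<in> lin_maps K M N"
proof -
  interpret M: module K M by fact
  show ?thesis using assms(2,3) by (intro lin_mapsI) (auto simp: lin_maps_def)
qed

lemma lin_maps_compose:
  "\<lbrakk>f \<in> lin_maps K M N; g \<in> lin_maps K N P\<rbrakk> \<Longrightarrow> (\<lambda>x. g (f x)) \<in> lin_maps K M P"
  by (auto simp: lin_maps_def Pi_iff)

lemma lin_maps_zero_fun:
  assumes "module K N"
  shows "(\<lambda>x. \<zero>\<^bsub>N\<^esub>) \<in> lin_maps K M N"
proof -
  interpret N: module K N by fact
  show ?thesis by (rule lin_mapsI) auto
qed

lemma lin_maps_add_fun:
  assumes "module K N" "f \<in> lin_maps K M N" "g \<in> lin_maps K M N"
  shows "(\<lambda>x. f x \<oplus>\<^bsub>N\<^esub> g x) \<in> lin_maps K M N"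
proof -
  interpret N: module K N by fact
  show ?thesis
    using assms(2,3)
    by (intro lin_mapsI)
      (auto simp: lin_maps_closed lin_maps_add lin_maps_smult N.smult_r_distr N.a_ac)
qed

lemma bilinear_mapI:
  assumes "\<And>m. m \<in> carrier M \<Longrightarrow> F m \<in> lin_maps K N P"
    and "\<And>n. n \<in> carrier N \<Longrightarrow> (\<lambda>m. F m n) \<in> lin_maps K M P"
  shows "bilinear_map K M N P F"
  using assms by (auto simp: bilinear_map_def)

lemma bilinear_lin_right: "\<lbrakk>bilinear_map K M N P F; m \<in> carrier M\<rbrakk> \<Longrightarrow> F m \<in> lin_maps K N P"
  and bilinear_lin_left: "\<lbrakk>bilinear_map K M N P F; n \<in> carrier N\<rbrakk> \<Longrightarrow> (\<lambda>m. F m n) \<in> lin_maps K M P"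
  by (auto simp: bilinear_map_def)

lemma bilinear_closed:
  "\<lbrakk>bilinear_map K M N P F; m \<in> carrier M; n \<in> carrier N\<rbrakk> \<Longrightarrow> F m n \<in> carrier P"
  by (meson bilinear_lin_right lin_maps_closed)

text \<open>With its right-hand twin this serves as an introduction rule: linearity of a nested
  summand in one variable is reduced to the single operation that contains the variable, from the
  outside inwards.\<close>

lemma bilinear_compose_left:
  assumes "bilinear_map K M N P F" "f \<in> lin_maps K Q M" "n \<in> carrier N"
  shows "(\<lambda>x. F (f x) n) \<in> lin_maps K Q P"
  using lin_maps_compose[OF assms(2) bilinear_lin_left[OF assms(1,3)]] .

lemma bilinear_compose_right:
  assumes "bilinear_map K M N P F" "m \<in> carrier M" "f \<in> lin_maps K Q N"
  shows "(\<lambda>x. F m (f x)) \<in> lin_maps K Q P"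
  using lin_maps_compose[OF assms(3) bilinear_lin_right[OF assms(1,2)]] .


section \<open>The module structure of a tensor product\<close>

lemma tensor_eq_carrier:
  assumes "module K M" "module K N" "tensor_eq K M N xs ys"
  shows "set xs \<subseteq> carrier M \<times> carrier N \<and> set ys \<subseteq> carrier M \<times> carrier N"
proof -
  interpret M: module K M by fact
  interpret N: module K N by fact
  show ?thesis using assms(3) by induction auto
qed

lemma tclass_eqI: "tensor_eq K M N xs ys \<Longrightarrow> tclass K M N xs = tclass K M N ys"
  unfolding tclass_def by (blast intro: tensor_eq.sym tensor_eq.trans)

text \<open>The only fact about the choice made by \<open>trep\<close>: the chosen list is congruent
  to any list defining the class.\<close>

lemma tensor_eq_trep:
  assumes "set xs \<subseteq> carrier M \<times> carrier N"
  shows "tensor_eq K M N xs (trep (tclass K M N xs))"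
proof -
  have "xs \<in> tclass K M N xs"
    using assms by (simp add: tclass_def tensor_eq.refl)
  then have "trep (tclass K M N xs) \<in> tclass K M N xs"
    unfolding trep_def by (rule someI)
  then show ?thesis by (simp add: tclass_def)
qed

lemma tensor_carrierE:
  assumes "t \<in> carrier (M \<boxtimes>\<^bsub>K\<^esub> N)"
  obtains xs where "set xs \<subseteq> carrier M \<times> carrier N" "t = tclass K M N xs"
  using assms by (auto simp: tensor_prod_def)

lemma trep_carrier:
  assumes "module K M" "module K N" "t \<in> carrier (M \<boxtimes>\<^bsub>K\<^esub> N)"
  shows "set (trep t) \<subseteq> carrier M \<times> carrier N"
  using assms by (metis tensor_carrierE tensor_eq_trep tensor_eq_carrier)

lemma tclass_closed:
  "set xs \<subseteq> carrier M \<times> carrier N \<Longrightarrow> tclass K M N xs \<in> carrier (M \<boxtimes>\<^bsub>K\<^esub> N)"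
  by (auto simp: tensor_prod_def)

lemma tensor_zero: "\<zero>\<^bsub>M \<boxtimes>\<^bsub>K\<^esub> N\<^esub> = tclass K M N []"
  by (simp add: tensor_prod_def)

lemma tensor_one: "\<one>\<^bsub>M \<boxtimes>\<^bsub>K\<^esub> N\<^esub> = tens K M N \<one>\<^bsub>M\<^esub> \<one>\<^bsub>N\<^esub>"
  by (simp add: tensor_prod_def tens_def)

text \<open>Addition is defined through representatives; the rule \<open>append\<close> of the
  congruence makes it independent of them.\<close>

lemma tensor_add_tclass:
  assumes "set xs \<subseteq> carrier M \<times> carrier N" "set ys \<subseteq> carrier M \<times> carrier N"
  shows "tclass K M N xs \<oplus>\<^bsub>M \<boxtimes>\<^bsub>K\<^esub> N\<^esub> tclass K M N ys = tclass K M N (xs @ ys)"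
  using assms unfolding tensor_prod_def
  by (simp, intro tclass_eqI tensor_eq.append tensor_eq.sym[OF tensor_eq_trep])

text \<open>Scalar multiplication is well defined because it carries each generating relation to one
  of the same kind. In the case \<open>balance\<close> two scalars meet and must be interchanged, by
  commutativity of \<open>K\<close>.\<close>

lemma tensor_eq_smult:
  assumes "module K M" "module K N" "a \<in> carrier K" "tensor_eq K M N xs ys"
  shows "tensor_eq K M N (map (\<lambda>p. (a \<odot>\<^bsub>M\<^esub> fst p, snd p)) xs)
    (map (\<lambda>p. (a \<odot>\<^bsub>M\<^esub> fst p, snd p)) ys)"
proof -
  interpret M: module K M by fact
  interpret N: module K N by fact
  have cl: "set (map (\<lambda>p. (a \<odot>\<^bsub>M\<^esub> fst p, snd p)) zs) \<subseteq> carrier M \<times> carrier N"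
    if "set zs \<subseteq> carrier M \<times> carrier N" for zs
    using that assms(3) by auto
  show ?thesis using assms(4)
  proof induction
    case (refl xs)
    then show ?case by (intro tensor_eq.refl cl)
  next
    case (append xs ys xs' ys')
    then show ?case by (simp add: tensor_eq.append)
  next
    case (swap xs ys)
    then show ?case unfolding map_append by (intro tensor_eq.swap cl)
  next
    case (add_left m m' n)
    then show ?case using assms(3) by (simp add: M.smult_r_distr tensor_eq.add_left)
  next
    case (add_right m n n')
    then show ?case using assms(3) by (simp add: tensor_eq.add_right)
  next
    case (balance b m n)
    then have "a \<odot>\<^bsub>M\<^esub> (b \<odot>\<^bsub>M\<^esub> m) = b \<odot>\<^bsub>M\<^esub> (a \<odot>\<^bsub>M\<^esub> m)"
      using assms(3) by (metis M.smult_assoc1 M.m_comm)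
    then show ?case using balance assms(3) by (simp add: tensor_eq.balance)
  next
    case (zero n)
    then show ?case using assms(3) by (simp add: tensor_eq.zero)
  qed (blast intro: tensor_eq.sym tensor_eq.trans)+
qed

lemma tensor_smult_tclass:
  assumes "module K M" "module K N" "a \<in> carrier K" "set xs \<subseteq> carrier M \<times> carrier N"
  shows "a \<odot>\<^bsub>M \<boxtimes>\<^bsub>K\<^esub> N\<^esub> tclass K M N xs = tclass K M N (map (\<lambda>p. (a \<odot>\<^bsub>M\<^esub> fst p, snd p)) xs)"
  unfolding tensor_prod_def
  by (simp, intro tclass_eqI tensor_eq_smult[OF assms(1-3)] tensor_eq.sym[OF tensor_eq_trep] assms(4))

lemma tens_closed:
  "\<lbrakk>m \<in> carrier M; n \<in> carrier N\<rbrakk> \<Longrightarrow> tens K M N m n \<in> carrier (M \<boxtimes>\<^bsub>K\<^esub> N)"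
  by (simp add: tens_def tclass_closed)

lemma abelian_group_tensor:
  assumes "module K M" "module K N"
  shows "abelian_group (M \<boxtimes>\<^bsub>K\<^esub> N)"
proof (rule abelian_groupI)
  interpret M: module K M by fact
  interpret N: module K N by fact
  let ?T = "M \<boxtimes>\<^bsub>K\<^esub> N"
  fix x y z assume "x \<in> carrier ?T" "y \<in> carrier ?T" "z \<in> carrier ?T"
  then obtain xs ys zs where
    x: "set xs \<subseteq> carrier M \<times> carrier N" "x = tclass K M N xs" and
    y: "set ys \<subseteq> carrier M \<times> carrier N" "y = tclass K M N ys" and
    z: "set zs \<subseteq> carrier M \<times> carrier N" "z = tclass K M N zs"
    by (metis tensor_carrierE)
  show "x \<oplus>\<^bsub>?T\<^esub> y \<in> carrier ?T"
    using x y by (simp add: tensor_add_tclass tclass_closed)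
  show "x \<oplus>\<^bsub>?T\<^esub> y \<oplus>\<^bsub>?T\<^esub> z = x \<oplus>\<^bsub>?T\<^esub> (y \<oplus>\<^bsub>?T\<^esub> z)"
    using x y z by (simp add: tensor_add_tclass)
  show "x \<oplus>\<^bsub>?T\<^esub> y = y \<oplus>\<^bsub>?T\<^esub> x"
    using x y by (simp add: tensor_add_tclass tclass_eqI tensor_eq.swap)
  show "\<zero>\<^bsub>?T\<^esub> \<oplus>\<^bsub>?T\<^esub> x = x"
    using x by (simp add: tensor_zero tensor_add_tclass)
  \<comment> \<open>Lists have no negatives, so a cancelling list is built by recursion:
    \<open>(m, n)\<close> is cancelled by the pair with \<open>m\<close> negated, through
    \<open>add_left\<close> read backwards and then \<open>zero\<close>. The new pair is put at the
    end of \<open>vs\<close>, directly before the pair that it cancels, so no reordering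
    occurs.\<close>
  have inverse: "\<exists>vs. set vs \<subseteq> carrier M \<times> carrier N \<and> tensor_eq K M N (vs @ us) []"
    if "set us \<subseteq> carrier M \<times> carrier N" for us
    using that
  proof (induction us)
    case Nil
    then show ?case by (intro exI[of _ "[]"]) (simp add: tensor_eq.refl)
  next
    case (Cons p us)
    obtain m n where p: "p = (m, n)" "m \<in> carrier M" "n \<in> carrier N"
      using Cons.prems by (cases p) auto
    obtain vs where vs: "set vs \<subseteq> carrier M \<times> carrier N" "tensor_eq K M N (vs @ us) []"
      using Cons by auto
    have "tensor_eq K M N [(\<ominus>\<^bsub>M\<^esub> m, n), (m, n)] []"
      using tensor_eq.add_left[of "\<ominus>\<^bsub>M\<^esub> m" M m n N K] tensor_eq.zero[of n N K M] p
      by (metis M.a_inv_closed M.l_neg tensor_eq.sym tensor_eq.trans)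
    then have "tensor_eq K M N (vs @ [(\<ominus>\<^bsub>M\<^esub> m, n), (m, n)] @ us) (vs @ [] @ us)"
      using vs(1) Cons.prems by (intro tensor_eq.append tensor_eq.refl) auto
    then have "tensor_eq K M N ((vs @ [(\<ominus>\<^bsub>M\<^esub> m, n)]) @ p # us) []"
      using vs(2) p by (auto intro: tensor_eq.trans)
    then show ?case using vs(1) p by (intro exI[of _ "vs @ [(\<ominus>\<^bsub>M\<^esub> m, n)]"]) auto
  qed
  obtain vs where "set vs \<subseteq> carrier M \<times> carrier N" "tensor_eq K M N (vs @ xs) []"
    using inverse[OF x(1)] by blast
  then show "\<exists>y\<in>carrier ?T. y \<oplus>\<^bsub>?T\<^esub> x = \<zero>\<^bsub>?T\<^esub>"
    using x by (intro bexI[of _ "tclass K M N vs"])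
      (auto simp: tensor_add_tclass tensor_zero tclass_eqI tclass_closed)
qed (simp add: tensor_zero tclass_closed)

text \<open>The class of a list is the sum of the pure tensors of its entries, so list induction
  becomes induction on tensors.\<close>

lemma tensor_induct [consumes 3, case_names zero add]:
  assumes "module K M" "module K N" "t \<in> carrier (M \<boxtimes>\<^bsub>K\<^esub> N)"
    and zero: "P \<zero>\<^bsub>M \<boxtimes>\<^bsub>K\<^esub> N\<^esub>"
    and add: "\<And>m n s. \<lbrakk>m \<in> carrier M; n \<in> carrier N; s \<in> carrier (M \<boxtimes>\<^bsub>K\<^esub> N); P s\<rbrakk> \<Longrightarrow>
      P (tens K M N m n \<oplus>\<^bsub>M \<boxtimes>\<^bsub>K\<^esub> N\<^esub> s)"
  shows "P t"
proof -
  have "P (tclass K M N xs)" if "set xs \<subseteq> carrier M \<times> carrier N" for xs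
    using that
  proof (induction xs)
    case Nil
    then show ?case using zero by (simp add: tensor_zero)
  next
    case (Cons p xs)
    obtain m n where p: "p = (m, n)" "m \<in> carrier M" "n \<in> carrier N"
      using Cons.prems by (cases p) auto
    have "tclass K M N (p # xs) = tens K M N m n \<oplus>\<^bsub>M \<boxtimes>\<^bsub>K\<^esub> N\<^esub> tclass K M N xs"
      using Cons.prems p unfolding tens_def by (subst tensor_add_tclass) auto
    then show ?case using Cons p by (simp add: add tclass_closed)
  qed
  then show ?thesis using assms(3) by (metis tensor_carrierE)
qed

lemma module_tensor:
  assumes "module K M" "module K N"
  shows "module K (M \<boxtimes>\<^bsub>K\<^esub> N)"
proof (rule moduleI)
  interpret M: module K M by fact
  interpret N: module K N by fact
  let ?T = "M \<boxtimes>\<^bsub>K\<^esub> N"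
  interpret T: abelian_group ?T using assms by (rule abelian_group_tensor)
  show "cring K" by (rule M.is_cring)
  show "abelian_group ?T" by (rule T.abelian_group_axioms)
  have smult_tens: "a \<odot>\<^bsub>?T\<^esub> tens K M N m n = tens K M N (a \<odot>\<^bsub>M\<^esub> m) n"
    if "a \<in> carrier K" "m \<in> carrier M" "n \<in> carrier N" for a m n
    using that unfolding tens_def by (simp add: tensor_smult_tclass[OF assms])
  show cl: "a \<odot>\<^bsub>?T\<^esub> x \<in> carrier ?T" if "a \<in> carrier K" and x: "x \<in> carrier ?T" for a x
  proof -
    obtain xs where "set xs \<subseteq> carrier M \<times> carrier N" "x = tclass K M N xs"
      using x by (rule tensor_carrierE)
    then show ?thesis using that
      by (simp add: tensor_smult_tclass[OF assms]) (rule tclass_closed, auto)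
  qed
  show distr: "a \<odot>\<^bsub>?T\<^esub> (x \<oplus>\<^bsub>?T\<^esub> y) = a \<odot>\<^bsub>?T\<^esub> x \<oplus>\<^bsub>?T\<^esub> a \<odot>\<^bsub>?T\<^esub> y"
    if "a \<in> carrier K" and x: "x \<in> carrier ?T" and y: "y \<in> carrier ?T" for a x y
  proof -
    obtain xs where xs: "set xs \<subseteq> carrier M \<times> carrier N" "x = tclass K M N xs"
      using x by (rule tensor_carrierE)
    obtain ys where ys: "set ys \<subseteq> carrier M \<times> carrier N" "y = tclass K M N ys"
      using y by (rule tensor_carrierE)
    have "set (map (\<lambda>p. (a \<odot>\<^bsub>M\<^esub> fst p, snd p)) zs) \<subseteq> carrier M \<times> carrier N"
      if "set zs \<subseteq> carrier M \<times> carrier N" for zs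
      using that \<open>a \<in> carrier K\<close> by auto
    then show ?thesis using that xs ys
      by (simp add: tensor_smult_tclass[OF assms] tensor_add_tclass)
  qed
  have smult_zero: "a \<odot>\<^bsub>?T\<^esub> \<zero>\<^bsub>?T\<^esub> = \<zero>\<^bsub>?T\<^esub>" if "a \<in> carrier K" for a
    using that by (simp add: tensor_zero tensor_smult_tclass[OF assms])
  show "(a \<oplus>\<^bsub>K\<^esub> b) \<odot>\<^bsub>?T\<^esub> x = a \<odot>\<^bsub>?T\<^esub> x \<oplus>\<^bsub>?T\<^esub> b \<odot>\<^bsub>?T\<^esub> x"
    if ab: "a \<in> carrier K" "b \<in> carrier K" and "x \<in> carrier ?T" for a b x
    using assms that(3)
  proof (induction rule: tensor_induct)
    case zero
    then show ?case using ab by (simp add: smult_zero)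
  next
    case (add m n s)
    \<comment> \<open>This axiom fails on lists: the left side produces one entry where the right
      side produces two. The rule \<open>add_left\<close> identifies them on pure tensors.\<close>
    have "tens K M N ((a \<oplus>\<^bsub>K\<^esub> b) \<odot>\<^bsub>M\<^esub> m) n =
        tens K M N (a \<odot>\<^bsub>M\<^esub> m) n \<oplus>\<^bsub>?T\<^esub> tens K M N (b \<odot>\<^bsub>M\<^esub> m) n"
      using ab add(1,2) unfolding tens_def
      by (simp add: M.smult_l_distr tensor_add_tclass tclass_eqI tensor_eq.add_left)
    then show ?case using ab add
      by (simp add: distr smult_tens tens_closed cl T.a_ac)
  qed
  show "(a \<otimes>\<^bsub>K\<^esub> b) \<odot>\<^bsub>?T\<^esub> x = a \<odot>\<^bsub>?T\<^esub> (b \<odot>\<^bsub>?T\<^esub> x)"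
    if ab: "a \<in> carrier K" "b \<in> carrier K" and "x \<in> carrier ?T" for a b x
    using assms that(3)
  proof (induction rule: tensor_induct)
    case zero
    then show ?case using ab by (simp add: smult_zero)
  next
    case (add m n s)
    then show ?case using ab
      by (simp add: distr smult_tens tens_closed cl M.smult_assoc1)
  qed
  show "\<one>\<^bsub>K\<^esub> \<odot>\<^bsub>?T\<^esub> x = x" if "x \<in> carrier ?T" for x
    using assms that
  proof (induction rule: tensor_induct)
    case zero
    then show ?case by (simp add: smult_zero)
  next
    case (add m n s)
    then show ?case by (simp add: distr smult_tens tens_closed)
  qed
qed

text \<open>The generating relations read as equations between classes. Scalars act on the left
  entry by definition, so homogeneity in the right argument is the rule
  \<open>balance\<close>.\<close>

lemma bilinear_tens:
  assumes "module K M" "module K N"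
  shows "bilinear_map K M N (M \<boxtimes>\<^bsub>K\<^esub> N) (tens K M N)"
proof -
  interpret M: module K M by fact
  interpret N: module K N by fact
  show ?thesis
    by (intro bilinear_mapI lin_mapsI tens_closed)
      (simp_all add: tens_def tensor_add_tclass tensor_smult_tclass[OF assms] tclass_eqI
        tensor_eq.add_left tensor_eq.add_right tclass_eqI[OF tensor_eq.balance])
qed


section \<open>Sweedler sums\<close>

lemma tsum_closed:
  assumes "module K M" "module K N" "abelian_monoid W" "t \<in> carrier (M \<boxtimes>\<^bsub>K\<^esub> N)"
    and "\<And>m n. \<lbrakk>m \<in> carrier M; n \<in> carrier N\<rbrakk> \<Longrightarrow> F m n \<in> carrier W"
  shows "tsum W t F \<in> carrier W"
proof -
  interpret W: abelian_monoid W by fact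
  have "foldr (\<lambda>p s. F (fst p) (snd p) \<oplus>\<^bsub>W\<^esub> s) xs \<zero>\<^bsub>W\<^esub> \<in> carrier W"
    if "set xs \<subseteq> carrier M \<times> carrier N" for xs
    using that by (induction xs) (auto intro!: W.a_closed assms(5))
  then show ?thesis unfolding tsum_def using trep_carrier[OF assms(1,2,4)] by blast
qed

text \<open>Both sides run over the same list \<open>trep t\<close>, so agreement on the carriers is
  enough, whether or not the summands are bilinear.\<close>

lemma tsum_cong:
  assumes "module K M" "module K N" "t \<in> carrier (M \<boxtimes>\<^bsub>K\<^esub> N)"
    and "\<And>m n. \<lbrakk>m \<in> carrier M; n \<in> carrier N\<rbrakk> \<Longrightarrow> F m n = G m n"
  shows "tsum W t F = tsum W t G"
proof -
  have "foldr (\<lambda>p s. F (fst p) (snd p) \<oplus>\<^bsub>W\<^esub> s) xs z = foldr (\<lambda>p s. G (fst p) (snd p) \<oplus>\<^bsub>W\<^esub> s) xs z"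
    if "set xs \<subseteq> carrier M \<times> carrier N" for xs z
    using that by (induction xs) (auto simp: assms(4))
  then show ?thesis unfolding tsum_def using trep_carrier[OF assms(1-3)] by blast
qed

text \<open>Stated for additive maps out of an abelian monoid, so that it also covers sums taken in
  the ring \<open>K\<close>, as in the counit of \<open>enveloping\<close>; \<open>K\<close> is a
  ring and not a \<open>module\<close> record.\<close>

lemma additive_tsum:
  assumes "module K M" "module K N" "abelian_monoid V" "t \<in> carrier (M \<boxtimes>\<^bsub>K\<^esub> N)"
    and F: "\<And>m n. \<lbrakk>m \<in> carrier M; n \<in> carrier N\<rbrakk> \<Longrightarrow> F m n \<in> carrier V"
    and zero: "h \<zero>\<^bsub>V\<^esub> = \<zero>\<^bsub>W\<^esub>"
    and add: "\<And>x y. \<lbrakk>x \<in> carrier V; y \<in> carrier V\<rbrakk> \<Longrightarrow> h (x \<oplus>\<^bsub>V\<^esub> y) = h x \<oplus>\<^bsub>W\<^esub> h y"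
  shows "h (tsum V t F) = tsum W t (\<lambda>m n. h (F m n))"
proof -
  interpret V: abelian_monoid V by fact
  have "foldr (\<lambda>p s. F (fst p) (snd p) \<oplus>\<^bsub>V\<^esub> s) xs \<zero>\<^bsub>V\<^esub> \<in> carrier V \<and>
      h (foldr (\<lambda>p s. F (fst p) (snd p) \<oplus>\<^bsub>V\<^esub> s) xs \<zero>\<^bsub>V\<^esub>) =
      foldr (\<lambda>p s. h (F (fst p) (snd p)) \<oplus>\<^bsub>W\<^esub> s) xs \<zero>\<^bsub>W\<^esub>"
    if "set xs \<subseteq> carrier M \<times> carrier N" for xs
    using that by (induction xs) (auto simp: zero add F)
  then show ?thesis unfolding tsum_def using trep_carrier[OF assms(1,2,4)] by blast
qed

lemma lin_maps_tsum:
  assumes "module K M" "module K N" "module K V" "module K W" "t \<in> carrier (M \<boxtimes>\<^bsub>K\<^esub> N)"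
    and "\<And>m n. \<lbrakk>m \<in> carrier M; n \<in> carrier N\<rbrakk> \<Longrightarrow> F m n \<in> carrier V"
    and "h \<in> lin_maps K V W"
  shows "h (tsum V t F) = tsum W t (\<lambda>m n. h (F m n))"
proof -
  interpret V: module K V by fact
  show ?thesis
    using assms by (intro additive_tsum[OF assms(1,2) V.abelian_monoid_axioms assms(5)])
      (auto simp: lin_maps_zero lin_maps_add)
qed

text \<open>The tensor is fixed, so this is a finite sum of linear maps along one list. It
  complements \<open>tsum_linear\<close>, where the tensor is the variable.\<close>

lemma tsum_lin_param:
  assumes "module K M" "module K N" "module K W" "t \<in> carrier (M \<boxtimes>\<^bsub>K\<^esub> N)"
    and "\<And>m n. \<lbrakk>m \<in> carrier M; n \<in> carrier N\<rbrakk> \<Longrightarrow> (\<lambda>x. F x m n) \<in> lin_maps K Q W"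
  shows "(\<lambda>x. tsum W t (F x)) \<in> lin_maps K Q W"
proof -
  have "(\<lambda>x. foldr (\<lambda>p s. F x (fst p) (snd p) \<oplus>\<^bsub>W\<^esub> s) xs \<zero>\<^bsub>W\<^esub>) \<in> lin_maps K Q W"
    if "set xs \<subseteq> carrier M \<times> carrier N" for xs
    using that
    by (induction xs) (auto intro!: lin_maps_zero_fun lin_maps_add_fun assms(3,5))
  then show ?thesis unfolding tsum_def using trep_carrier[OF assms(1,2,4)] by blast
qed

section \<open>The universal property of the tensor product\<close>

lemma foldr_append_add:
  assumes "module K W" "set xs \<subseteq> C" "set ys \<subseteq> C" "\<And>p. p \<in> C \<Longrightarrow> G p \<in> carrier W"
  shows "foldr (\<lambda>p s. G p \<oplus>\<^bsub>W\<^esub> s) ys \<zero>\<^bsub>W\<^esub> \<in> carrier W \<and>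
    foldr (\<lambda>p s. G p \<oplus>\<^bsub>W\<^esub> s) (xs @ ys) \<zero>\<^bsub>W\<^esub> =
      foldr (\<lambda>p s. G p \<oplus>\<^bsub>W\<^esub> s) xs \<zero>\<^bsub>W\<^esub> \<oplus>\<^bsub>W\<^esub> foldr (\<lambda>p s. G p \<oplus>\<^bsub>W\<^esub> s) ys \<zero>\<^bsub>W\<^esub>"
proof -
  interpret W: module K W by fact
  have cl: "foldr (\<lambda>p s. G p \<oplus>\<^bsub>W\<^esub> s) zs \<zero>\<^bsub>W\<^esub> \<in> carrier W" if "set zs \<subseteq> C" for zs
    using that by (induction zs) (auto simp: assms(4))
  have "foldr (\<lambda>p s. G p \<oplus>\<^bsub>W\<^esub> s) (xs @ ys) \<zero>\<^bsub>W\<^esub> =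
      foldr (\<lambda>p s. G p \<oplus>\<^bsub>W\<^esub> s) xs \<zero>\<^bsub>W\<^esub> \<oplus>\<^bsub>W\<^esub> foldr (\<lambda>p s. G p \<oplus>\<^bsub>W\<^esub> s) ys \<zero>\<^bsub>W\<^esub>"
    using assms(2)
  proof (induction xs)
    case Nil
    then show ?case using cl[OF assms(3)] by simp
  next
    case (Cons p xs)
    then show ?case using cl[OF assms(3)] cl[of xs]
      by (simp add: W.a_assoc assms(4) del: foldr_append)
  qed
  then show ?thesis using cl[OF assms(3)] by simp
qed

text \<open>For bilinear \<open>F\<close> the sum along a list is invariant under every generator of
  the congruence, so \<open>trep\<close> may be replaced by any representative. Evaluation on pure
  tensors and linearity in the tensor both rest on this.\<close>

lemma tsum_tclass:
  assumes "module K M" "module K N" "module K W" "bilinear_map K M N W F"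
    and "set xs \<subseteq> carrier M \<times> carrier N"
  shows "tsum W (tclass K M N xs) F = foldr (\<lambda>p s. F (fst p) (snd p) \<oplus>\<^bsub>W\<^esub> s) xs \<zero>\<^bsub>W\<^esub>"
proof -
  interpret M: module K M by fact
  interpret N: module K N by fact
  interpret W: module K W by fact
  note F = bilinear_closed[OF assms(4)] bilinear_lin_left[OF assms(4)] bilinear_lin_right[OF assms(4)]
  let ?s = "\<lambda>xs. foldr (\<lambda>p s. F (fst p) (snd p) \<oplus>\<^bsub>W\<^esub> s) xs \<zero>\<^bsub>W\<^esub>"
  have cl: "?s zs \<in> carrier W" if "set zs \<subseteq> carrier M \<times> carrier N" for zs
    using that by (induction zs) (auto simp: F(1))
  have append_sum: "?s (us @ vs) = ?s us \<oplus>\<^bsub>W\<^esub> ?s vs"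
    if "set us \<subseteq> carrier M \<times> carrier N" "set vs \<subseteq> carrier M \<times> carrier N" for us vs
    using foldr_append_add[OF assms(3) that, of "\<lambda>p. F (fst p) (snd p)"] F(1) by auto
  have "?s ys = ?s zs" if "tensor_eq K M N ys zs" for ys zs
    using that
  proof induction
    case (append xs ys xs' ys')
    then show ?case
      using tensor_eq_carrier[OF assms(1,2)] by (simp add: append_sum del: foldr_append)
  next
    case (swap xs ys)
    then show ?case by (simp only: append_sum cl W.a_comm)
  next
    case (add_left m m' n)
    then show ?case by (simp add: F(1) lin_maps_add[OF F(2)])
  next
    case (add_right m n n')
    then show ?case by (simp add: F(1) lin_maps_add[OF F(3)])
  next
    case (balance a m n)
    then show ?case by (simp add: F(1) lin_maps_smult[OF F(2)] lin_maps_smult[OF F(3)])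
  next
    case (zero n)
    then show ?case by (simp add: lin_maps_zero[OF assms(1,3) F(2)])
  qed (rule HOL.refl, rule HOL.sym, assumption, rule HOL.trans, assumption)
  from this[OF tensor_eq_trep[OF assms(5)]] show ?thesis unfolding tsum_def by (rule HOL.sym)
qed

lemma tsum_tens:
  assumes "module K M" "module K N" "module K W" "bilinear_map K M N W F"
    and "m \<in> carrier M" "n \<in> carrier N"
  shows "tsum W (tens K M N m n) F = F m n"
proof -
  interpret W: module K W by fact
  show ?thesis
    unfolding tens_def using assms(5,6) bilinear_closed[OF assms(4)]
    by (subst tsum_tclass[OF assms(1-4)]) auto
qed

text \<open>The linear map on the tensor product that the bilinear \<open>F\<close> induces;
  \<open>tsum_tens\<close> says that it extends \<open>F\<close>.\<close>

lemma tsum_linear: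
  assumes "module K M" "module K N" "module K W" "bilinear_map K M N W F"
  shows "(\<lambda>t. tsum W t F) \<in> lin_maps K (M \<boxtimes>\<^bsub>K\<^esub> N) W"
proof (rule lin_mapsI)
  interpret M: module K M by fact
  interpret N: module K N by fact
  interpret W: module K W by fact
  let ?T = "M \<boxtimes>\<^bsub>K\<^esub> N"
  note F = bilinear_closed[OF assms(4)]
  show cl: "tsum W t F \<in> carrier W" if "t \<in> carrier ?T" for t
    using that F by (intro tsum_closed[OF assms(1,2) W.abelian_monoid_axioms])
  show add': "tsum W (s \<oplus>\<^bsub>?T\<^esub> t) F = tsum W s F \<oplus>\<^bsub>W\<^esub> tsum W t F"
    if st: "s \<in> carrier ?T" "t \<in> carrier ?T" for s t
  proof -
    obtain xs where xs: "set xs \<subseteq> carrier M \<times> carrier N" "s = tclass K M N xs"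
      using st(1) by (rule tensor_carrierE)
    obtain ys where ys: "set ys \<subseteq> carrier M \<times> carrier N" "t = tclass K M N ys"
      using st(2) by (rule tensor_carrierE)
    have Fp: "F (fst p) (snd p) \<in> carrier W" if "p \<in> carrier M \<times> carrier N" for p
      using that by (auto simp: F)
    note sum = foldr_append_add[OF assms(3) xs(1) ys(1), of "\<lambda>p. F (fst p) (snd p)", OF Fp]
    have xsys: "set (xs @ ys) \<subseteq> carrier M \<times> carrier N" using xs(1) ys(1) by simp
    show ?thesis
      unfolding xs(2) ys(2) tensor_add_tclass[OF xs(1) ys(1)]
        tsum_tclass[OF assms xs(1)] tsum_tclass[OF assms ys(1)] tsum_tclass[OF assms xsys]
      using sum by blast
  qed
  show "tsum W (a \<odot>\<^bsub>?T\<^esub> t) F = a \<odot>\<^bsub>W\<^esub> tsum W t F"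
    if "a \<in> carrier K" "t \<in> carrier ?T" for a t
  proof -
    interpret T: module K ?T using assms(1,2) by (rule module_tensor)
    show ?thesis using assms(1,2) that(2)
    proof (induction rule: tensor_induct)
      case zero
      have "tsum W \<zero>\<^bsub>?T\<^esub> F = \<zero>\<^bsub>W\<^esub>"
        unfolding tensor_zero by (simp add: tsum_tclass[OF assms])
      then show ?case using that by simp
    next
      case (add m n s)
      have "a \<odot>\<^bsub>?T\<^esub> tens K M N m n = tens K M N (a \<odot>\<^bsub>M\<^esub> m) n"
        using that add unfolding tens_def by (simp add: tensor_smult_tclass[OF assms(1,2)])
      then show ?case using that add
        by (simp add: lin_maps_smult[OF bilinear_lin_left[OF assms(4)]] T.smult_r_distr W.smult_r_distr add'
            tens_closed cl tsum_tens[OF assms] F)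
    qed
  qed
qed

text \<open>Iterates the universal property: for trilinear \<open>F\<close> the inner sum is
  bilinear in the first entry and the remaining tensor, so \<open>tsum_linear\<close> and
  \<open>tsum_tens\<close> apply again to the outer sum.\<close>

lemma tsum_bilinear:
  assumes "module K M" "module K N" "module K P" "module K W"
    and "\<And>m. m \<in> carrier M \<Longrightarrow> bilinear_map K N P W (F m)"
    and "\<And>n p. \<lbrakk>n \<in> carrier N; p \<in> carrier P\<rbrakk> \<Longrightarrow> (\<lambda>m. F m n p) \<in> lin_maps K M W"
  shows "bilinear_map K M (N \<boxtimes>\<^bsub>K\<^esub> P) W (\<lambda>m t. tsum W t (F m))"
  using assms by (intro bilinear_mapI[of M] tsum_linear tsum_lin_param) auto

lemma tsum3_tens3:
  assumes "module K M" "module K N" "module K P" "module K W"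
    and "\<And>m. m \<in> carrier M \<Longrightarrow> bilinear_map K N P W (F m)"
    and "\<And>n p. \<lbrakk>n \<in> carrier N; p \<in> carrier P\<rbrakk> \<Longrightarrow> (\<lambda>m. F m n p) \<in> lin_maps K M W"
    and "m \<in> carrier M" "n \<in> carrier N" "p \<in> carrier P"
  shows "tsum3 W (tens3 K M N P m n p) F = F m n p"
  using assms by (simp add: tsum_tens[OF _ _ _ tsum_bilinear] tsum_tens module_tensor tens_closed)

text \<open>Pure tensors generate additively. Unit laws and action laws are therefore tested on
  them.\<close>

lemma lin_maps_tensor_eqI:
  assumes "module K M" "module K N" "module K W"
    and "f \<in> lin_maps K (M \<boxtimes>\<^bsub>K\<^esub> N) W" "g \<in> lin_maps K (M \<boxtimes>\<^bsub>K\<^esub> N) W"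
    and "\<And>m n. \<lbrakk>m \<in> carrier M; n \<in> carrier N\<rbrakk> \<Longrightarrow> f (tens K M N m n) = g (tens K M N m n)"
    and "t \<in> carrier (M \<boxtimes>\<^bsub>K\<^esub> N)"
  shows "f t = g t"
  using assms(1,2,7)
proof (induction rule: tensor_induct)
  case zero
  show ?case
    by (simp add: lin_maps_zero[OF module_tensor[OF assms(1,2)] assms(3)] assms(4,5))
next
  case (add m n s)
  then show ?case
    by (simp add: lin_maps_add[OF assms(4)] lin_maps_add[OF assms(5)] tens_closed assms(6))
qed

section \<open>Nested Sweedler sums\<close>

lemma tsum3_closed:
  assumes "module K M" "module K N" "module K P" "module K W" "t \<in> carrier (M \<boxtimes>\<^bsub>K\<^esub> N \<boxtimes>\<^bsub>K\<^esub> P)"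
    and "\<And>m n p. \<lbrakk>m \<in> carrier M; n \<in> carrier N; p \<in> carrier P\<rbrakk> \<Longrightarrow> F m n p \<in> carrier W"
  shows "tsum3 W t F \<in> carrier W"
proof -
  interpret W: module K W by fact
  note W = W.abelian_monoid_axioms
  show ?thesis
    by (rule tsum_closed[OF assms(1) module_tensor[OF assms(2,3)] W assms(5)],
        rule tsum_closed[OF assms(2,3) W], assumption, rule assms(6))
qed

lemma tsum3_cong:
  assumes "module K M" "module K N" "module K P" "t \<in> carrier (M \<boxtimes>\<^bsub>K\<^esub> N \<boxtimes>\<^bsub>K\<^esub> P)"
    and "\<And>m n p. \<lbrakk>m \<in> carrier M; n \<in> carrier N; p \<in> carrier P\<rbrakk> \<Longrightarrow> F m n p = G m n p"
  shows "tsum3 W t F = tsum3 W t G"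
  by (rule tsum_cong[OF assms(1) module_tensor[OF assms(2,3)] assms(4)],
      rule tsum_cong[OF assms(2,3)], assumption, rule assms(5))

lemma lin_maps_tsum3:
  assumes "module K M" "module K N" "module K P" "module K V" "module K W"
    and "t \<in> carrier (M \<boxtimes>\<^bsub>K\<^esub> N \<boxtimes>\<^bsub>K\<^esub> P)"
    and F: "\<And>m n p. \<lbrakk>m \<in> carrier M; n \<in> carrier N; p \<in> carrier P\<rbrakk> \<Longrightarrow> F m n p \<in> carrier V"
    and h: "h \<in> lin_maps K V W"
  shows "h (tsum3 V t F) = tsum3 W t (\<lambda>m n p. h (F m n p))"
proof -
  interpret V: module K V by fact
  note NP = module_tensor[OF assms(2,3)]
  have "h (tsum3 V t F) = tsum W t (\<lambda>m s. h (tsum V s (F m)))"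
    by (rule lin_maps_tsum[OF assms(1) NP assms(4-6) _ h],
        rule tsum_closed[OF assms(2,3) V.abelian_monoid_axioms], assumption, rule F)
  also have "\<dots> = tsum3 W t (\<lambda>m n p. h (F m n p))"
    by (rule tsum_cong[OF assms(1) NP assms(6)],
        rule lin_maps_tsum[OF assms(2-5) _ _ h], assumption, rule F)
  finally show ?thesis .
qed

text \<open>A fivefold sum is a \<open>tsum3\<close> whose last entry is summed by another
  \<open>tsum3\<close>, so the threefold rule is used twice.\<close>

lemma lin_maps_tsum5:
  assumes "module K M" "module K N" "module K P" "module K Q" "module K R"
    and "module K V" "module K W"
    and t: "t \<in> carrier (M \<boxtimes>\<^bsub>K\<^esub> N \<boxtimes>\<^bsub>K\<^esub> P \<boxtimes>\<^bsub>K\<^esub> Q \<boxtimes>\<^bsub>K\<^esub> R)"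
    and F: "\<And>m n p q r. \<lbrakk>m \<in> carrier M; n \<in> carrier N; p \<in> carrier P; q \<in> carrier Q; r \<in> carrier R\<rbrakk> \<Longrightarrow>
      F m n p q r \<in> carrier V"
    and h: "h \<in> lin_maps K V W"
  shows "h (tsum5 V t F) = tsum5 W t (\<lambda>m n p q r. h (F m n p q r))"
proof -
  interpret V: module K V by fact
  note QR = module_tensor[OF assms(4,5)]
  note PQR = module_tensor[OF assms(3) QR]
  have "h (tsum5 V t F) = tsum3 W t (\<lambda>m n s. h (tsum3 V s (F m n)))"
    by (rule lin_maps_tsum3[OF assms(1,2) PQR assms(6,7) t _ h],
        rule tsum3_closed[OF assms(3-6)], assumption, rule F)
  also have "\<dots> = tsum5 W t (\<lambda>m n p q r. h (F m n p q r))"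
    by (rule tsum3_cong[OF assms(1,2) PQR t],
        rule lin_maps_tsum3[OF assms(3-7) _ _ h], assumption, rule F)
  finally show ?thesis .
qed

lemma tsum5_cong:
  assumes "module K M" "module K N" "module K P" "module K Q" "module K R"
    and "t \<in> carrier (M \<boxtimes>\<^bsub>K\<^esub> N \<boxtimes>\<^bsub>K\<^esub> P \<boxtimes>\<^bsub>K\<^esub> Q \<boxtimes>\<^bsub>K\<^esub> R)"
    and "\<And>m n p q r. \<lbrakk>m \<in> carrier M; n \<in> carrier N; p \<in> carrier P; q \<in> carrier Q; r \<in> carrier R\<rbrakk> \<Longrightarrow>
      F m n p q r = G m n p q r"
  shows "tsum5 W t F = tsum5 W t G"
  by (rule tsum3_cong[OF assms(1,2) module_tensor[OF assms(3) module_tensor[OF assms(4,5)]] assms(6)],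
      rule tsum3_cong[OF assms(3-5)], assumption, rule assms(7))

text \<open>This and the next three closure facts are aimed at \<open>drinfeld_gamma\<close>: the
  twist, and with it the crossed elements, must lie in the carrier before anything can be said about
  their \<open>trep\<close>.\<close>

lemma tmap_closed:
  assumes "module K M" "module K N" "module K M'" "module K N'" "t \<in> carrier (M \<boxtimes>\<^bsub>K\<^esub> N)"
    and "\<And>m. m \<in> carrier M \<Longrightarrow> f m \<in> carrier M'" "\<And>n. n \<in> carrier N \<Longrightarrow> g n \<in> carrier N'"
  shows "tmap K M' N' f g t \<in> carrier (M' \<boxtimes>\<^bsub>K\<^esub> N')"
proof -
  interpret T: module K "M' \<boxtimes>\<^bsub>K\<^esub> N'" using assms(3,4) by (rule module_tensor)
  show ?thesis
    unfolding tmap_def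
    by (rule tsum_closed[OF assms(1,2) T.abelian_monoid_axioms assms(5)])
      (simp add: tens_closed assms(6,7))
qed

lemma tassoc_closed:
  assumes "module K M" "module K N" "module K P" "t \<in> carrier ((M \<boxtimes>\<^bsub>K\<^esub> N) \<boxtimes>\<^bsub>K\<^esub> P)"
  shows "tassoc K M N P t \<in> carrier (M \<boxtimes>\<^bsub>K\<^esub> N \<boxtimes>\<^bsub>K\<^esub> P)"
proof -
  interpret T: module K "M \<boxtimes>\<^bsub>K\<^esub> N \<boxtimes>\<^bsub>K\<^esub> P" by (intro module_tensor assms)
  show ?thesis
    unfolding tassoc_def
    by (rule tsum_closed[OF module_tensor[OF assms(1,2)] assms(3) T.abelian_monoid_axioms assms(4)],
        rule tsum_closed[OF assms(1,2) T.abelian_monoid_axioms])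
      (simp_all add: tens_closed)
qed

lemma split1_closed:
  assumes "module K M1" "module K M2" "module K M" "module K N" "t \<in> carrier (M \<boxtimes>\<^bsub>K\<^esub> N)"
    and "\<And>m. m \<in> carrier M \<Longrightarrow> f m \<in> carrier (M1 \<boxtimes>\<^bsub>K\<^esub> M2)"
  shows "split1 K M1 M2 N f t \<in> carrier (M1 \<boxtimes>\<^bsub>K\<^esub> M2 \<boxtimes>\<^bsub>K\<^esub> N)"
  unfolding split1_def
  by (rule tassoc_closed[OF assms(1,2,4)],
      rule tmap_closed[OF assms(3,4) module_tensor[OF assms(1,2)] assms(4,5,6)]) simp_all

lemma append_unit_closed:
  assumes "module K M" "module K N" "module K P" "module K Q" "\<one>\<^bsub>Q\<^esub> \<in> carrier Q"
    and "t \<in> carrier (M \<boxtimes>\<^bsub>K\<^esub> N \<boxtimes>\<^bsub>K\<^esub> P)"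
  shows "append_unit K M N P Q t \<in> carrier (M \<boxtimes>\<^bsub>K\<^esub> N \<boxtimes>\<^bsub>K\<^esub> P \<boxtimes>\<^bsub>K\<^esub> Q)"
  unfolding append_unit_def
  by (rule tsum3_closed[OF assms(1-3) _ assms(6)])
    (simp_all add: module_tensor tens_closed assms)


section \<open>Independence of the record extension\<close>

text \<open>
  Tensors are sets of lists over the carriers, so algebras with the same underlying structure but
  different record types have literally equal tensor products.
\<close>

definition same_algebra ::
  "('k, 'm, 'x) module_scheme \<Rightarrow> ('k, 'm, 'y) module_scheme \<Rightarrow> bool"
  where "same_algebra M M' \<longleftrightarrow> carrier M = carrier M' \<and> monoid.mult M = monoid.mult M' \<and>
    \<one>\<^bsub>M\<^esub> = \<one>\<^bsub>M'\<^esub> \<and> \<zero>\<^bsub>M\<^esub> = \<zero>\<^bsub>M'\<^esub> \<and> ring.add M = ring.add M' \<and> smult M = smult M'"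

lemma same_algebra_refl: "same_algebra M M"
  and same_algebra_sym: "same_algebra M M' \<Longrightarrow> same_algebra M' M"
  by (simp_all add: same_algebra_def)

lemma tensor_eq_same_imp:
  assumes "tensor_eq K M N xs ys" "same_algebra M M'" "same_algebra N N'"
  shows "tensor_eq K M' N' xs ys"
  using assms(1)
proof induction
  case (trans xs ys zs)
  then show ?case by (blast intro: tensor_eq.trans)
next
  case (zero n)
  then show ?case using assms(2,3) tensor_eq.zero[of n N' K M'] by (simp add: same_algebra_def)
qed (use assms(2,3) in \<open>auto simp: same_algebra_def intro: tensor_eq.refl tensor_eq.sym
    tensor_eq.append tensor_eq.swap tensor_eq.add_left tensor_eq.add_right tensor_eq.balance\<close>)

lemma tensor_eq_same:
  assumes "same_algebra M M'" "same_algebra N N'"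
  shows "tensor_eq K M N = tensor_eq K M' N'"
  using assms by (intro ext iffI) (auto intro: tensor_eq_same_imp dest: same_algebra_sym)

lemma tclass_same:
  "\<lbrakk>same_algebra M M'; same_algebra N N'\<rbrakk> \<Longrightarrow> tclass K M N = tclass K M' N'"
  by (intro ext) (simp add: tclass_def tensor_eq_same[of M M' N N'])

lemma tens_same: "\<lbrakk>same_algebra M M'; same_algebra N N'\<rbrakk> \<Longrightarrow> tens K M N = tens K M' N'"
  by (intro ext) (simp add: tens_def tclass_same[of M M' N N'])

text \<open>The two products are equal and not merely isomorphic: \<open>tensor_prod\<close> returns
  a plain \<open>module\<close> record, in which the extension fields of the factors have
  disappeared.\<close>

lemma tensor_prod_same:
  assumes "same_algebra M M'" "same_algebra N N'"
  shows "M \<boxtimes>\<^bsub>K\<^esub> N = M' \<boxtimes>\<^bsub>K\<^esub> N'"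
  using assms by (simp add: tensor_prod_def tclass_same[OF assms]) (simp add: same_algebra_def)

lemma tsum_same: "same_algebra M M' \<Longrightarrow> tsum M t F = tsum M' t F"
  by (simp add: tsum_def same_algebra_def)

lemma lin_maps_same:
  "\<lbrakk>same_algebra M M'; same_algebra N N'\<rbrakk> \<Longrightarrow> lin_maps K M N = lin_maps K M' N'"
  by (simp add: lin_maps_def same_algebra_def)

lemma bilinear_map_same:
  assumes "same_algebra M M'" "same_algebra N N'" "same_algebra P P'"
  shows "bilinear_map K M N P F = bilinear_map K M' N' P' F"
  using assms by (simp add: bilinear_map_def lin_maps_def same_algebra_def)

text \<open>Only the additive structure and the scalars are compared, so this also covers the
  opposite algebra \<open>qb_op\<close>, whose multiplication differs.\<close>

lemma module_same:
  assumes "module K M"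
    and eq: "carrier M' = carrier M" "\<zero>\<^bsub>M'\<^esub> = \<zero>\<^bsub>M\<^esub>" "ring.add M' = ring.add M" "smult M' = smult M"
  shows "module K M'"
proof -
  interpret M: module K M by fact
  show ?thesis
  proof (rule moduleI)
    show "abelian_group M'"
      by (rule abelian_groupI)
        (auto simp: eq M.a_ac intro: bexI[of _ "\<ominus>\<^bsub>M\<^esub> _"] M.l_neg)
  qed (simp_all add: eq M.is_cring M.smult_l_distr M.smult_r_distr M.smult_assoc1)
qed

lemma unital_algebra_same:
  assumes "unital_algebra K M" "same_algebra M M'"
  shows "unital_algebra K M'"
proof -
  interpret M: unital_algebra K M by fact
  have eq: "carrier M' = carrier M" "monoid.mult M' = monoid.mult M" "\<one>\<^bsub>M'\<^esub> = \<one>\<^bsub>M\<^esub>"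
    using assms(2) by (simp_all add: same_algebra_def)
  show ?thesis
  proof (intro unital_algebra.intro unital_algebra_axioms.intro)
    show "field K" by unfold_locales
    show "module K M'"
      using assms(2) by (intro module_same[OF M.module_axioms]) (simp_all add: same_algebra_def)
    show "bilinear_map K M' M' M' (\<lambda>x y. x \<otimes>\<^bsub>M'\<^esub> y)"
      using M.mult_bilinear bilinear_map_same[OF assms(2) assms(2) assms(2)] eq(2) by metis
  qed (simp_all add: eq M.unit_closed M.left_unit M.right_unit)
qed


section \<open>The algebra structure of a tensor product\<close>

lemma foldr_tclass:
  assumes "\<And>p. p \<in> set xs \<Longrightarrow> set (g p) \<subseteq> carrier M \<times> carrier N"
  shows "foldr (\<lambda>p s. tclass K M N (g p) \<oplus>\<^bsub>M \<boxtimes>\<^bsub>K\<^esub> N\<^esub> s) xs \<zero>\<^bsub>M \<boxtimes>\<^bsub>K\<^esub> N\<^esub> =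
    tclass K M N (concat (map g xs))"
  using assms
proof (induction xs)
  case Nil
  then show ?case by (simp add: tensor_zero)
next
  case (Cons p xs)
  have "set (concat (map g xs)) \<subseteq> carrier M \<times> carrier N"
    using Cons.prems by force
  then show ?case using Cons by (simp add: tensor_add_tclass)
qed

text \<open>The product is defined by one list of products of the chosen representatives. That list
  is the double Sweedler sum written out, which brings the product under the rules for
  \<open>tsum\<close>.\<close>

lemma tensor_mult_tsum:
  assumes "unital_algebra K M" "unital_algebra K N"
    and "s \<in> carrier (M \<boxtimes>\<^bsub>K\<^esub> N)" "t \<in> carrier (M \<boxtimes>\<^bsub>K\<^esub> N)"
  shows "s \<otimes>\<^bsub>M \<boxtimes>\<^bsub>K\<^esub> N\<^esub> t = tsum (M \<boxtimes>\<^bsub>K\<^esub> N) s (\<lambda>m n. tsum (M \<boxtimes>\<^bsub>K\<^esub> N) t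
    (\<lambda>m' n'. tens K M N (m \<otimes>\<^bsub>M\<^esub> m') (n \<otimes>\<^bsub>N\<^esub> n')))"
proof -
  interpret M: unital_algebra K M by fact
  interpret N: unital_algebra K N by fact
  let ?T = "M \<boxtimes>\<^bsub>K\<^esub> N"
  define e where "e p q = (fst p \<otimes>\<^bsub>M\<^esub> fst q, snd p \<otimes>\<^bsub>N\<^esub> snd q)" for p q
  have e: "e p q \<in> carrier M \<times> carrier N"
    if "p \<in> carrier M \<times> carrier N" "q \<in> carrier M \<times> carrier N" for p q
    using that bilinear_closed[OF M.mult_bilinear] bilinear_closed[OF N.mult_bilinear]
    by (auto simp: e_def)
  have rep: "set (trep s) \<subseteq> carrier M \<times> carrier N" "set (trep t) \<subseteq> carrier M \<times> carrier N"
    using assms(3,4) trep_carrier M.module_axioms N.module_axioms by blast+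
  \<comment> \<open>The singletons \<open>[e p q]\<close> let \<open>foldr_tclass\<close> handle the
    inner sum as well as the outer one.\<close>
  have inner: "tsum ?T t (\<lambda>m' n'. tens K M N (fst p \<otimes>\<^bsub>M\<^esub> m') (snd p \<otimes>\<^bsub>N\<^esub> n')) =
      tclass K M N (concat (map (\<lambda>q. [e p q]) (trep t)))" if "p \<in> carrier M \<times> carrier N" for p
  proof -
    have "set [e p q] \<subseteq> carrier M \<times> carrier N" if "q \<in> set (trep t)" for q
      using e[OF \<open>p \<in> carrier M \<times> carrier N\<close>] that rep(2) by auto
    from foldr_tclass[of "trep t" "\<lambda>q. [e p q]", OF this]
    show ?thesis unfolding tsum_def tens_def e_def .
  qed
  have "tsum ?T s (\<lambda>m n. tsum ?T t (\<lambda>m' n'. tens K M N (m \<otimes>\<^bsub>M\<^esub> m') (n \<otimes>\<^bsub>N\<^esub> n'))) =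
      foldr (\<lambda>p x. tsum ?T t (\<lambda>m' n'. tens K M N (fst p \<otimes>\<^bsub>M\<^esub> m') (snd p \<otimes>\<^bsub>N\<^esub> n')) \<oplus>\<^bsub>?T\<^esub> x)
        (trep s) \<zero>\<^bsub>?T\<^esub>"
    by (simp add: tsum_def)
  also have "\<dots> = foldr (\<lambda>p x. tclass K M N (concat (map (\<lambda>q. [e p q]) (trep t))) \<oplus>\<^bsub>?T\<^esub> x)
        (trep s) \<zero>\<^bsub>?T\<^esub>"
    using rep(1) inner by (intro foldr_cong) auto
  also have "\<dots> = tclass K M N (concat (map (\<lambda>p. concat (map (\<lambda>q. [e p q]) (trep t))) (trep s)))"
  proof (rule foldr_tclass)
    fix p assume "p \<in> set (trep s)"
    then have "e p q \<in> carrier M \<times> carrier N" if "q \<in> set (trep t)" for q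
      using that rep e by blast
    then show "set (concat (map (\<lambda>q. [e p q]) (trep t))) \<subseteq> carrier M \<times> carrier N"
      by (simp add: image_subset_iff)
  qed
  also have "\<dots> = s \<otimes>\<^bsub>?T\<^esub> t"
    by (simp add: tensor_prod_def e_def)
  finally show ?thesis by simp
qed

lemma bilinear_tens_mult:
  assumes "unital_algebra K M" "unital_algebra K N"
    and "m \<in> carrier M" "n \<in> carrier N"
  shows "bilinear_map K M N (M \<boxtimes>\<^bsub>K\<^esub> N) (\<lambda>m' n'. tens K M N (m \<otimes>\<^bsub>M\<^esub> m') (n \<otimes>\<^bsub>N\<^esub> n'))"
    and "bilinear_map K M N (M \<boxtimes>\<^bsub>K\<^esub> N) (\<lambda>m' n'. tens K M N (m' \<otimes>\<^bsub>M\<^esub> m) (n' \<otimes>\<^bsub>N\<^esub> n))"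
proof -
  interpret M: unital_algebra K M by fact
  interpret N: unital_algebra K N by fact
  note T = bilinear_tens[OF M.module_axioms N.module_axioms]
  note cl = bilinear_closed[OF M.mult_bilinear] bilinear_closed[OF N.mult_bilinear]
  show "bilinear_map K M N (M \<boxtimes>\<^bsub>K\<^esub> N) (\<lambda>m' n'. tens K M N (m \<otimes>\<^bsub>M\<^esub> m') (n \<otimes>\<^bsub>N\<^esub> n'))"
    using assms(3,4)
    by (intro bilinear_mapI bilinear_compose_left[OF T] bilinear_compose_right[OF T]
        bilinear_lin_right[OF M.mult_bilinear] bilinear_lin_right[OF N.mult_bilinear] cl)
  show "bilinear_map K M N (M \<boxtimes>\<^bsub>K\<^esub> N) (\<lambda>m' n'. tens K M N (m' \<otimes>\<^bsub>M\<^esub> m) (n' \<otimes>\<^bsub>N\<^esub> n))"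
    using assms(3,4)
    by (intro bilinear_mapI bilinear_compose_left[OF T] bilinear_compose_right[OF T]
        bilinear_lin_left[OF M.mult_bilinear] bilinear_lin_left[OF N.mult_bilinear] cl)
qed

text \<open>With the left factor fixed, the outer sum is fixed and each inner sum is linear in its
  tensor. With the right factor fixed, the inner sum runs over a fixed tensor and is bilinear in
  \<open>m\<close> and \<open>n\<close>, so the outer sum is linear by the universal
  property.\<close>

lemma bilinear_tensor_mult:
  assumes "unital_algebra K M" "unital_algebra K N"
  shows "bilinear_map K (M \<boxtimes>\<^bsub>K\<^esub> N) (M \<boxtimes>\<^bsub>K\<^esub> N) (M \<boxtimes>\<^bsub>K\<^esub> N) (\<lambda>s t. s \<otimes>\<^bsub>M \<boxtimes>\<^bsub>K\<^esub> N\<^esub> t)"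
proof (rule bilinear_mapI)
  interpret M: unital_algebra K M by fact
  interpret N: unital_algebra K N by fact
  let ?T = "M \<boxtimes>\<^bsub>K\<^esub> N"
  note MN = M.module_axioms N.module_axioms
  note T = module_tensor[OF MN]
  note B = bilinear_tens_mult[OF assms]
  fix s assume s: "s \<in> carrier ?T"
  show "(\<lambda>t. s \<otimes>\<^bsub>?T\<^esub> t) \<in> lin_maps K ?T ?T"
    by (rule lin_maps_cong[OF T _ tensor_mult_tsum[OF assms s]],
        rule tsum_lin_param[OF MN T s], rule tsum_linear[OF MN T B(1)])
  show "(\<lambda>t. t \<otimes>\<^bsub>?T\<^esub> s) \<in> lin_maps K ?T ?T"
  proof (rule lin_maps_cong[OF T _ tensor_mult_tsum[OF assms _ s]])
    have "bilinear_map K M N ?T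
        (\<lambda>m n. tsum ?T s (\<lambda>m' n'. tens K M N (m \<otimes>\<^bsub>M\<^esub> m') (n \<otimes>\<^bsub>N\<^esub> n')))"
      using bilinear_lin_left[OF B(2)] bilinear_lin_right[OF B(2)]
      by (intro bilinear_mapI[of M] tsum_lin_param[OF MN T s]) auto
    then show "(\<lambda>t. tsum ?T t (\<lambda>m n. tsum ?T s (\<lambda>m' n'. tens K M N (m \<otimes>\<^bsub>M\<^esub> m') (n \<otimes>\<^bsub>N\<^esub> n'))))
        \<in> lin_maps K ?T ?T"
      by (rule tsum_linear[OF MN T])
  qed
qed

lemma tensor_mult_tens:
  assumes "unital_algebra K M" "unital_algebra K N"
    and "m \<in> carrier M" "n \<in> carrier N" "m' \<in> carrier M" "n' \<in> carrier N"
  shows "tens K M N m n \<otimes>\<^bsub>M \<boxtimes>\<^bsub>K\<^esub> N\<^esub> tens K M N m' n' = tens K M N (m \<otimes>\<^bsub>M\<^esub> m') (n \<otimes>\<^bsub>N\<^esub> n')"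
proof -
  interpret M: unital_algebra K M by fact
  interpret N: unital_algebra K N by fact
  let ?T = "M \<boxtimes>\<^bsub>K\<^esub> N"
  note MN = M.module_axioms N.module_axioms
  note T = module_tensor[OF MN]
  note B = bilinear_tens_mult[OF assms(1,2)]
  have "bilinear_map K M N ?T
      (\<lambda>m n. tsum ?T (tens K M N m' n') (\<lambda>m' n'. tens K M N (m \<otimes>\<^bsub>M\<^esub> m') (n \<otimes>\<^bsub>N\<^esub> n')))"
    using bilinear_lin_left[OF B(2)] bilinear_lin_right[OF B(2)] assms(5,6)
    by (intro bilinear_mapI[of M] tsum_lin_param[OF MN T] tens_closed) auto
  from tsum_tens[OF MN T this assms(3,4)] show ?thesis
    by (simp add: tensor_mult_tsum[OF assms(1,2)] tens_closed assms(3-6)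
        tsum_tens[OF MN T B(1)[OF assms(3,4)]])
qed

lemma unital_algebra_tensor:
  assumes "unital_algebra K M" "unital_algebra K N"
  shows "unital_algebra K (M \<boxtimes>\<^bsub>K\<^esub> N)"
proof -
  interpret M: unital_algebra K M by fact
  interpret N: unital_algebra K N by fact
  let ?T = "M \<boxtimes>\<^bsub>K\<^esub> N"
  note MN = M.module_axioms N.module_axioms
  note T = module_tensor[OF MN]
  note B = bilinear_tensor_mult[OF assms]
  show ?thesis
  proof (intro unital_algebra.intro unital_algebra_axioms.intro)
    show "field K" by unfold_locales
    show "module K ?T" by (rule T)
    show "bilinear_map K ?T ?T ?T (\<lambda>s t. s \<otimes>\<^bsub>?T\<^esub> t)" by (rule B)
    show one: "\<one>\<^bsub>?T\<^esub> \<in> carrier ?T"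
      by (simp add: tensor_one tens_closed M.unit_closed N.unit_closed)
    fix t assume t: "t \<in> carrier ?T"
    show "\<one>\<^bsub>?T\<^esub> \<otimes>\<^bsub>?T\<^esub> t = t"
      by (rule lin_maps_tensor_eqI[OF MN T bilinear_lin_right[OF B one] lin_maps_id _ t])
        (simp add: tensor_one tensor_mult_tens[OF assms] M.unit_closed N.unit_closed
          M.left_unit N.left_unit)
    show "t \<otimes>\<^bsub>?T\<^esub> \<one>\<^bsub>?T\<^esub> = t"
      by (rule lin_maps_tensor_eqI[OF MN T bilinear_lin_left[OF B one] lin_maps_id _ t])
        (simp add: tensor_one tensor_mult_tens[OF assms] M.unit_closed N.unit_closed
          M.right_unit N.right_unit)
  qed
qed


section \<open>The enveloping algebra and its action\<close>

lemma qb_op_simps [simp]: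
  "carrier (qb_op H) = carrier H" "x \<otimes>\<^bsub>qb_op H\<^esub> y = y \<otimes>\<^bsub>H\<^esub> x" "\<one>\<^bsub>qb_op H\<^esub> = \<one>\<^bsub>H\<^esub>"
  "\<zero>\<^bsub>qb_op H\<^esub> = \<zero>\<^bsub>H\<^esub>" "ring.add (qb_op H) = ring.add H" "smult (qb_op H) = smult H"
  "comul (qb_op H) = comul H" "counit (qb_op H) = counit H"
  "reass (qb_op H) = reass_inv H" "reass_inv (qb_op H) = reass H"
  by (simp_all add: qb_op_def)

lemma lin_maps_qb_op [simp]:
  "lin_maps K (qb_op H) W = lin_maps K H W" "lin_maps K W (qb_op H) = lin_maps K W H"
  by (simp_all add: lin_maps_def)

lemma unital_algebra_qb_op:
  assumes "unital_algebra K H"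
  shows "unital_algebra K (qb_op H)"
proof -
  interpret H: unital_algebra K H by fact
  show ?thesis
  proof (intro unital_algebra.intro unital_algebra_axioms.intro)
    show "field K" by unfold_locales
    show "module K (qb_op H)" by (rule module_same[OF H.module_axioms]) simp_all
    show "bilinear_map K (qb_op H) (qb_op H) (qb_op H) (\<lambda>x y. x \<otimes>\<^bsub>qb_op H\<^esub> y)"
      using H.mult_bilinear by (simp add: bilinear_map_def)
  qed (simp_all add: H.unit_closed H.left_unit H.right_unit)
qed

text \<open>\<open>enveloping\<close> is a larger record into which the algebra fields of the tensor
  product are copied; the facts about tensor algebras reach it through this equality of
  fields.\<close>

lemma enveloping_same: "same_algebra (enveloping K H) (H \<boxtimes>\<^bsub>K\<^esub> qb_op H)"
  by (simp add: enveloping_def qb_tensor_def same_algebra_def Let_def)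

lemma bimod_as_lmod_same: "same_algebra (bimod_as_lmod A) A"
  by (simp add: bimod_as_lmod_def same_algebra_def)

lemma bimod_as_lmod_simps [simp]:
  "carrier (bimod_as_lmod A) = carrier A" "monoid.mult (bimod_as_lmod A) = monoid.mult A"
  "\<one>\<^bsub>bimod_as_lmod A\<^esub> = \<one>\<^bsub>A\<^esub>" "smult (bimod_as_lmod A) = smult A"
  by (simp_all add: bimod_as_lmod_def)

lemma bimod_as_lmod_act: "act (bimod_as_lmod A) t a = tsum A t (\<lambda>h l. ract A (lact A h a) l)"
  by (simp add: bimod_as_lmod_def)

text \<open>The definition sums in tensor products of \<open>H \<boxtimes> qb_op H\<close>, whereas
  the axioms of a module algebra are formed over \<open>enveloping\<close>; the coproduct is
  restated over the latter.\<close>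

lemma comul_enveloping:
  "comul (enveloping K H) t =
    tsum (enveloping K H \<boxtimes>\<^bsub>K\<^esub> enveloping K H) t (\<lambda>h l.
      tsum (enveloping K H \<boxtimes>\<^bsub>K\<^esub> enveloping K H) (comul H h) (\<lambda>h1 h2.
        tsum (enveloping K H \<boxtimes>\<^bsub>K\<^esub> enveloping K H) (comul H l) (\<lambda>l1 l2.
          tens K (enveloping K H) (enveloping K H)
            (tens K H (qb_op H) h1 l1) (tens K H (qb_op H) h2 l2))))"
  unfolding tensor_prod_same[OF enveloping_same enveloping_same]
    tens_same[OF enveloping_same enveloping_same]
  by (simp add: enveloping_def qb_tensor_def Let_def)

lemma counit_enveloping:
  "counit (enveloping K H) t = tsum K t (\<lambda>h l. counit H h \<otimes>\<^bsub>K\<^esub> counit H l)"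
  by (simp add: enveloping_def qb_tensor_def Let_def)

text \<open>Restated over \<open>enveloping\<close> for the same reason, here at both levels of the
  nesting. The second factor contributes \<open>reass_inv H\<close> because that is the reassociator
  of the opposite algebra.\<close>

lemma reass_enveloping:
  fixes K :: "('k, 'c) ring_scheme" and H :: "('k, 'h, 'x) quasi_bialg_scheme"
  defines "E \<equiv> enveloping K H"
  shows "reass E = tsum3 (E \<boxtimes>\<^bsub>K\<^esub> E \<boxtimes>\<^bsub>K\<^esub> E) (reass H) (\<lambda>X1 X2 X3.
    tsum3 (E \<boxtimes>\<^bsub>K\<^esub> E \<boxtimes>\<^bsub>K\<^esub> E) (reass_inv H) (\<lambda>x1 x2 x3.
      tens3 K E E E (tens K H (qb_op H) X1 x1) (tens K H (qb_op H) X2 x2) (tens K H (qb_op H) X3 x3)))"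
proof -
  have E: "same_algebra E (H \<boxtimes>\<^bsub>K\<^esub> qb_op H)"
    unfolding E_def by (rule enveloping_same)
  note EE = tensor_prod_same[OF E E, of K]
  have E3: "E \<boxtimes>\<^bsub>K\<^esub> E \<boxtimes>\<^bsub>K\<^esub> E = (H \<boxtimes>\<^bsub>K\<^esub> qb_op H) \<boxtimes>\<^bsub>K\<^esub> (H \<boxtimes>\<^bsub>K\<^esub> qb_op H) \<boxtimes>\<^bsub>K\<^esub> (H \<boxtimes>\<^bsub>K\<^esub> qb_op H)"
    using tensor_prod_same[OF E same_algebra_refl, of K] EE by metis
  have t3: "tens K E (E \<boxtimes>\<^bsub>K\<^esub> E) =
      tens K (H \<boxtimes>\<^bsub>K\<^esub> qb_op H) ((H \<boxtimes>\<^bsub>K\<^esub> qb_op H) \<boxtimes>\<^bsub>K\<^esub> (H \<boxtimes>\<^bsub>K\<^esub> qb_op H))"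
    using tens_same[OF E same_algebra_refl, of K] EE by metis
  show ?thesis
    unfolding E3 t3 tens_same[OF E E]
    by (simp add: E_def enveloping_def qb_tensor_def interleave3_def Let_def)
qed

locale enveloping_action = H: quasi_bialgebra K H + A: bimodule_algebra K H A
  for K :: "('k, 'c) ring_scheme" (structure)
    and H :: "('k, 'h, 'z) quasi_bialg_scheme"
    and A :: "('k, 'h, 'a, 'x) bimod_alg_scheme"
begin

abbreviation "E \<equiv> enveloping K H"
abbreviation "H' \<equiv> qb_op H"
abbreviation "L \<equiv> bimod_as_lmod A"

lemma algebra_op: "unital_algebra K H'"
  using H.unital_algebra_axioms by (rule unital_algebra_qb_op)

lemma module_op: "module K H'"
  using algebra_op by (rule unital_algebra.axioms)

lemma algebra_enveloping: "unital_algebra K E"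
  using unital_algebra_same[OF unital_algebra_tensor[OF H.unital_algebra_axioms algebra_op]
      same_algebra_sym[OF enveloping_same]] .

lemma module_enveloping: "module K E"
  using algebra_enveloping by (rule unital_algebra.axioms)

lemma carrier_enveloping: "carrier E = carrier (H \<boxtimes>\<^bsub>K\<^esub> H')"
  and mult_enveloping: "monoid.mult E = monoid.mult (H \<boxtimes>\<^bsub>K\<^esub> H')"
  and one_enveloping: "\<one>\<^bsub>E\<^esub> = tens K H H' \<one>\<^bsub>H\<^esub> \<one>\<^bsub>H\<^esub>"
  using enveloping_same[of K H] by (simp_all add: same_algebra_def tensor_one)

lemma lin_maps_enveloping: "lin_maps K E W = lin_maps K (H \<boxtimes>\<^bsub>K\<^esub> H') W"
  using enveloping_same same_algebra_refl by (rule lin_maps_same)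

lemma tens_enveloping_closed:
  "\<lbrakk>h \<in> carrier H; l \<in> carrier H\<rbrakk> \<Longrightarrow> tens K H H' h l \<in> carrier E"
  by (simp add: carrier_enveloping tens_closed)

lemma enveloping_mult_tens:
  "\<lbrakk>g \<in> carrier H; h \<in> carrier H; k \<in> carrier H; l \<in> carrier H\<rbrakk> \<Longrightarrow>
    tens K H H' g k \<otimes>\<^bsub>E\<^esub> tens K H H' h l = tens K H H' (g \<otimes>\<^bsub>H\<^esub> h) (l \<otimes>\<^bsub>H\<^esub> k)"
  by (simp add: mult_enveloping tensor_mult_tens[OF H.unital_algebra_axioms algebra_op])

lemma comul_closed: "h \<in> carrier H \<Longrightarrow> comul H h \<in> carrier (H \<boxtimes>\<^bsub>K\<^esub> H)"
  using H.comul_hom by (auto simp: alg_hom_def lin_maps_def)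

lemmas lact_closed = bilinear_closed[OF A.lact_bilinear]
lemmas ract_closed = bilinear_closed[OF A.ract_bilinear]
lemmas A_mult_closed = bilinear_closed[OF A.mult_bilinear]

section \<open>The two-sided action and the module algebra axioms\<close>

lemma two_sided_bilinear:
  assumes "a \<in> carrier A"
  shows "bilinear_map K H H' A (\<lambda>h l. ract A (lact A h a) l)"
  using assms
  by (intro bilinear_mapI)
    (simp_all add: bilinear_lin_right[OF A.ract_bilinear] lact_closed
      bilinear_compose_left[OF A.ract_bilinear] bilinear_lin_left[OF A.lact_bilinear])

lemma act_tens:
  "\<lbrakk>h \<in> carrier H; l \<in> carrier H; a \<in> carrier A\<rbrakk> \<Longrightarrow>
    act L (tens K H H' h l) a = ract A (lact A h a) l"
  by (simp add: bimod_as_lmod_act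
      tsum_tens[OF H.module_axioms module_op A.module_axioms two_sided_bilinear])

text \<open>Linearity in the vector holds along a fixed list; linearity in the acting element is the
  universal property.\<close>

lemma act_bilinear: "bilinear_map K E A A (act L)"
proof (rule bilinear_mapI)
  show "act L t \<in> lin_maps K A A" if "t \<in> carrier E" for t
  proof -
    have "(\<lambda>a. tsum A t (\<lambda>h l. ract A (lact A h a) l)) \<in> lin_maps K A A"
      using that unfolding carrier_enveloping
      by (intro tsum_lin_param[OF H.module_axioms module_op A.module_axioms])
        (simp_all add: bilinear_compose_left[OF A.ract_bilinear] bilinear_lin_right[OF A.lact_bilinear])
    then show ?thesis by (simp add: bimod_as_lmod_def)
  qed
  show "(\<lambda>t. act L t a) \<in> lin_maps K E A" if "a \<in> carrier A" for a
    using tsum_linear[OF H.module_axioms module_op A.module_axioms two_sided_bilinear[OF that]]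
    by (simp add: lin_maps_enveloping bimod_as_lmod_act)
qed

lemmas act_closed = bilinear_closed[OF act_bilinear]

lemma act_eqI:
  assumes "f \<in> lin_maps K E A" "g \<in> lin_maps K E A" "t \<in> carrier E"
    and "\<And>h l. \<lbrakk>h \<in> carrier H; l \<in> carrier H\<rbrakk> \<Longrightarrow> f (tens K H H' h l) = g (tens K H H' h l)"
  shows "f t = g t"
  using assms lin_maps_tensor_eqI[OF H.module_axioms module_op A.module_axioms, of f g t]
  by (simp add: lin_maps_enveloping carrier_enveloping)

text \<open>Both sides are linear in each acting element, so \<open>t\<close> and then
  \<open>s\<close> may be taken pure.\<close>

lemma act_mult:
  assumes "s \<in> carrier E" "t \<in> carrier E" "a \<in> carrier A"
  shows "act L (s \<otimes>\<^bsub>E\<^esub> t) a = act L s (act L t a)"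
proof -
  interpret E: unital_algebra K E by (rule algebra_enveloping)
  note left = bilinear_lin_left[OF act_bilinear assms(3)]
  show ?thesis
  proof (rule act_eqI[where t = t, OF _ _ assms(2)])
    show "(\<lambda>t. act L (s \<otimes>\<^bsub>E\<^esub> t) a) \<in> lin_maps K E A"
      by (rule bilinear_compose_left[OF act_bilinear bilinear_lin_right[OF E.mult_bilinear assms(1)] assms(3)])
    show "(\<lambda>t. act L s (act L t a)) \<in> lin_maps K E A"
      by (rule bilinear_compose_right[OF act_bilinear assms(1) left])
    fix h l assume hl: "h \<in> carrier H" "l \<in> carrier H"
    note t = tens_enveloping_closed[OF hl]
    have a: "ract A (lact A h a) l \<in> carrier A"
      using hl assms(3) by (simp add: lact_closed ract_closed)
    have "act L (s \<otimes>\<^bsub>E\<^esub> tens K H H' h l) a = act L s (ract A (lact A h a) l)"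
    proof (rule act_eqI[where t = s, OF _ _ assms(1)])
      show "(\<lambda>s. act L (s \<otimes>\<^bsub>E\<^esub> tens K H H' h l) a) \<in> lin_maps K E A"
        by (rule bilinear_compose_left[OF act_bilinear bilinear_lin_left[OF E.mult_bilinear t] assms(3)])
      show "(\<lambda>s. act L s (ract A (lact A h a) l)) \<in> lin_maps K E A"
        by (rule bilinear_lin_left[OF act_bilinear a])
      fix g k assume gk: "g \<in> carrier H" "k \<in> carrier H"
      have cl: "g \<otimes>\<^bsub>H\<^esub> h \<in> carrier H" "l \<otimes>\<^bsub>H\<^esub> k \<in> carrier H"
        using gk hl bilinear_closed[OF H.mult_bilinear] by auto
      \<comment> \<open>Here the opposite multiplication is essential: acting from the right by
        \<open>l\<close> and then by \<open>k\<close> is acting by the product of \<open>l\<close>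
        and \<open>k\<close> in this order. \<open>A.lact_ract\<close> then moves the left action of
        \<open>g\<close> past \<open>l\<close>.\<close>
      have "ract A (lact A (g \<otimes>\<^bsub>H\<^esub> h) a) (l \<otimes>\<^bsub>H\<^esub> k) = ract A (lact A g (ract A (lact A h a) l)) k"
        using gk hl assms(3) by (simp add: A.lact_mult A.ract_mult A.lact_ract lact_closed ract_closed)
      then show "act L (tens K H H' g k \<otimes>\<^bsub>E\<^esub> tens K H H' h l) a =
          act L (tens K H H' g k) (ract A (lact A h a) l)"
        using gk hl assms(3) a cl
        by (simp add: enveloping_mult_tens act_tens)
    qed
    then show "act L (s \<otimes>\<^bsub>E\<^esub> tens K H H' h l) a = act L s (act L (tens K H H' h l) a)"
      using hl assms(3) by (simp add: act_tens)
  qed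
qed

lemma act_prod_bilinear:
  assumes "a \<in> carrier A" "b \<in> carrier A"
  shows "bilinear_map K E E A (\<lambda>x y. act L x a \<otimes>\<^bsub>A\<^esub> act L y b)"
  using assms
  by (intro bilinear_mapI bilinear_compose_left[OF A.mult_bilinear]
      bilinear_compose_right[OF A.mult_bilinear] bilinear_lin_left[OF act_bilinear] act_closed)

text \<open>The coproduct of a pure tensor sums over the two coproducts in \<open>H\<close>
  independently. The sum over the right factor is collapsed by \<open>A.ract_prod\<close>, applied
  to the vectors already moved by \<open>h1\<close> and \<open>h2\<close>; the right action by
  \<open>l\<close> is then taken out of the remaining sum, and \<open>A.lact_prod\<close> collapses
  it.\<close>

lemma act_prod:
  assumes t: "t \<in> carrier E" and ab: "a \<in> carrier A" "b \<in> carrier A"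
  shows "act L t (a \<otimes>\<^bsub>A\<^esub> b) = tsum A (comul E t) (\<lambda>x y. act L x a \<otimes>\<^bsub>A\<^esub> act L y b)"
proof -
  note EE = module_tensor[OF module_enveloping module_enveloping]
  interpret EE: module K "E \<boxtimes>\<^bsub>K\<^esub> E" by (rule EE)
  note H = H.module_axioms and H' = module_op and A = A.module_axioms and E = module_enveloping
  let ?B = "\<lambda>x y. act L x a \<otimes>\<^bsub>A\<^esub> act L y b"
  note B = act_prod_bilinear[OF ab]
  note lin = tsum_linear[OF E E A B]
  note sum = EE.abelian_monoid_axioms
  let ?t = "\<lambda>h1 h2 l1 l2. tens K E E (tens K H H' h1 l1) (tens K H H' h2 l2)"
  have t': "t \<in> carrier (H \<boxtimes>\<^bsub>K\<^esub> H')" using t by (simp add: carrier_enveloping)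
  have cl: "?t h1 h2 l1 l2 \<in> carrier (E \<boxtimes>\<^bsub>K\<^esub> E)"
    if "h1 \<in> carrier H" "h2 \<in> carrier H" "l1 \<in> carrier H" "l2 \<in> carrier H" for h1 h2 l1 l2
    using that by (intro tens_closed tens_enveloping_closed)
  have cl1: "tsum (E \<boxtimes>\<^bsub>K\<^esub> E) (comul H l) (\<lambda>l1 l2. ?t h1 h2 l1 l2) \<in> carrier (E \<boxtimes>\<^bsub>K\<^esub> E)"
    if "h1 \<in> carrier H" "h2 \<in> carrier H" "l \<in> carrier H" for h1 h2 l
    using that by (intro tsum_closed[OF H H sum] comul_closed cl)
  have cl2: "tsum (E \<boxtimes>\<^bsub>K\<^esub> E) (comul H h) (\<lambda>h1 h2. tsum (E \<boxtimes>\<^bsub>K\<^esub> E) (comul H l) (\<lambda>l1 l2. ?t h1 h2 l1 l2))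
      \<in> carrier (E \<boxtimes>\<^bsub>K\<^esub> E)" if "h \<in> carrier H" "l \<in> carrier H" for h l
    using that by (intro tsum_closed[OF H H sum] comul_closed cl1)
  have "tsum A (comul E t) ?B = tsum A t (\<lambda>h l.
      tsum A (tsum (E \<boxtimes>\<^bsub>K\<^esub> E) (comul H h) (\<lambda>h1 h2.
        tsum (E \<boxtimes>\<^bsub>K\<^esub> E) (comul H l) (\<lambda>l1 l2. ?t h1 h2 l1 l2))) ?B)"
    unfolding comul_enveloping by (rule lin_maps_tsum[OF H H' EE A t' _ lin]) (simp add: cl2)
  also have "\<dots> = tsum A t (\<lambda>h l. ract A (lact A h (a \<otimes>\<^bsub>A\<^esub> b)) l)"
  proof (rule tsum_cong[OF H H' t'])
    fix h l assume h: "h \<in> carrier H" and "l \<in> carrier H'"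
    then have l: "l \<in> carrier H" by simp
    have "tsum A (tsum (E \<boxtimes>\<^bsub>K\<^esub> E) (comul H h) (\<lambda>h1 h2.
        tsum (E \<boxtimes>\<^bsub>K\<^esub> E) (comul H l) (\<lambda>l1 l2. ?t h1 h2 l1 l2))) ?B =
      tsum A (comul H h) (\<lambda>h1 h2. tsum A (tsum (E \<boxtimes>\<^bsub>K\<^esub> E) (comul H l) (\<lambda>l1 l2. ?t h1 h2 l1 l2)) ?B)"
      by (rule lin_maps_tsum[OF H H EE A comul_closed[OF h] _ lin]) (simp add: cl1 l)
    also have "\<dots> = tsum A (comul H h) (\<lambda>h1 h2. ract A (lact A h1 a \<otimes>\<^bsub>A\<^esub> lact A h2 b) l)"
    proof (rule tsum_cong[OF H H comul_closed[OF h]])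
      fix h1 h2 assume h12: "h1 \<in> carrier H" "h2 \<in> carrier H"
      have "tsum A (tsum (E \<boxtimes>\<^bsub>K\<^esub> E) (comul H l) (\<lambda>l1 l2. ?t h1 h2 l1 l2)) ?B =
          tsum A (comul H l) (\<lambda>l1 l2. tsum A (?t h1 h2 l1 l2) ?B)"
        by (rule lin_maps_tsum[OF H H EE A comul_closed[OF l] _ lin]) (simp add: cl h12)
      also have "\<dots> = tsum A (comul H l) (\<lambda>l1 l2. ract A (lact A h1 a) l1 \<otimes>\<^bsub>A\<^esub> ract A (lact A h2 b) l2)"
        by (rule tsum_cong[OF H H comul_closed[OF l]])
          (simp add: tsum_tens[OF E E A B] tens_enveloping_closed h12 act_tens ab)
      also have "\<dots> = ract A (lact A h1 a \<otimes>\<^bsub>A\<^esub> lact A h2 b) l"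
        using h12 l ab by (simp add: A.ract_prod lact_closed)
      finally show "tsum A (tsum (E \<boxtimes>\<^bsub>K\<^esub> E) (comul H l) (\<lambda>l1 l2. ?t h1 h2 l1 l2)) ?B =
        ract A (lact A h1 a \<otimes>\<^bsub>A\<^esub> lact A h2 b) l" .
    qed
    also have "\<dots> = ract A (tsum A (comul H h) (\<lambda>h1 h2. lact A h1 a \<otimes>\<^bsub>A\<^esub> lact A h2 b)) l"
      by (rule lin_maps_tsum[OF H H A A comul_closed[OF h] _ bilinear_lin_left[OF A.ract_bilinear l], symmetric])
        (simp add: A_mult_closed lact_closed ab)
    also have "\<dots> = ract A (lact A h (a \<otimes>\<^bsub>A\<^esub> b)) l"
      using h ab by (simp add: A.lact_prod)
    finally show "tsum A (tsum (E \<boxtimes>\<^bsub>K\<^esub> E) (comul H h) (\<lambda>h1 h2.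
        tsum (E \<boxtimes>\<^bsub>K\<^esub> E) (comul H l) (\<lambda>l1 l2. ?t h1 h2 l1 l2))) ?B =
      ract A (lact A h (a \<otimes>\<^bsub>A\<^esub> b)) l" .
  qed
  finally show ?thesis by (simp add: bimod_as_lmod_act)
qed

lemma act_unit:
  assumes "t \<in> carrier E"
  shows "act L t \<one>\<^bsub>A\<^esub> = counit E t \<odot>\<^bsub>A\<^esub> \<one>\<^bsub>A\<^esub>"
proof -
  have t: "t \<in> carrier (H \<boxtimes>\<^bsub>K\<^esub> H')" using assms by (simp add: carrier_enveloping)
  have K: "abelian_monoid K" by unfold_locales
  have counit: "counit H h \<in> carrier K" if "h \<in> carrier H" for h
    using that H.counit_hom by (rule ring_hom_closed[rotated])
  \<comment> \<open>The counit is a sum of scalars; the additive map sending a scalar to its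
    multiple of the unit carries it into \<open>A\<close>.\<close>
  have "counit E t \<odot>\<^bsub>A\<^esub> \<one>\<^bsub>A\<^esub> = tsum A t (\<lambda>h l. (counit H h \<otimes>\<^bsub>K\<^esub> counit H l) \<odot>\<^bsub>A\<^esub> \<one>\<^bsub>A\<^esub>)"
    unfolding counit_enveloping
    by (rule additive_tsum[OF H.module_axioms module_op K t,
          where h = "\<lambda>x. x \<odot>\<^bsub>A\<^esub> \<one>\<^bsub>A\<^esub>"])
      (simp_all add: counit A.smult_l_distr A.unit_closed)
  also have "\<dots> = tsum A t (\<lambda>h l. ract A (lact A h \<one>\<^bsub>A\<^esub>) l)"
    by (rule tsum_cong[OF H.module_axioms module_op t])
      (simp add: A.lact_unit A.ract_unit A.unit_closed counit A.smult_assoc1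
        lin_maps_smult[OF bilinear_lin_left[OF A.ract_bilinear]])
  finally show ?thesis by (simp add: bimod_as_lmod_act)
qed

text \<open>The triple product is trilinear in the acting elements, hence a linear function of the
  reassociator. On the interleaved pure tensors it gives the summand of the bimodule axiom, with a
  component of \<open>reass H\<close> acting on the left and the matching one of
  \<open>reass_inv H\<close> on the right.\<close>

lemma act_quasi_assoc:
  assumes abc: "a \<in> carrier A" "b \<in> carrier A" "c \<in> carrier A"
  shows "(a \<otimes>\<^bsub>A\<^esub> b) \<otimes>\<^bsub>A\<^esub> c =
    tsum3 A (reass E) (\<lambda>x y z. act L x a \<otimes>\<^bsub>A\<^esub> (act L y b \<otimes>\<^bsub>A\<^esub> act L z c))"
proof -
  note H = H.module_axioms and A = A.module_axioms and E = module_enveloping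
  note EE = module_tensor[OF E E]
  note EEE = module_tensor[OF E EE]
  let ?G = "\<lambda>x y z. act L x a \<otimes>\<^bsub>A\<^esub> (act L y b \<otimes>\<^bsub>A\<^esub> act L z c)"
  let ?t = "\<lambda>X1 X2 X3 x1 x2 x3.
    tens3 K E E E (tens K H H' X1 x1) (tens K H H' X2 x2) (tens K H H' X3 x3)"
  have G1: "bilinear_map K E E A (?G x)" if "x \<in> carrier E" for x
    using that abc
    by (intro bilinear_mapI bilinear_compose_right[OF A.mult_bilinear]
        bilinear_compose_left[OF A.mult_bilinear] bilinear_lin_left[OF act_bilinear] act_closed)
  have G2: "(\<lambda>x. ?G x y z) \<in> lin_maps K E A" if "y \<in> carrier E" "z \<in> carrier E" for y z
    using that abc by (intro bilinear_compose_left[OF A.mult_bilinear]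
        bilinear_lin_left[OF act_bilinear] A_mult_closed act_closed)
  have lin: "(\<lambda>r. tsum3 A r ?G) \<in> lin_maps K (E \<boxtimes>\<^bsub>K\<^esub> E \<boxtimes>\<^bsub>K\<^esub> E) A"
    by (rule tsum_linear[OF E EE A tsum_bilinear[OF E E E A G1 G2]])
  have r: "reass H \<in> carrier (H \<boxtimes>\<^bsub>K\<^esub> H \<boxtimes>\<^bsub>K\<^esub> H)" "reass_inv H \<in> carrier (H \<boxtimes>\<^bsub>K\<^esub> H \<boxtimes>\<^bsub>K\<^esub> H)"
    using H.reass_invertible by (simp_all add: mutually_inverse_def)
  have cl: "?t X1 X2 X3 x1 x2 x3 \<in> carrier (E \<boxtimes>\<^bsub>K\<^esub> E \<boxtimes>\<^bsub>K\<^esub> E)"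
    if "X1 \<in> carrier H" "X2 \<in> carrier H" "X3 \<in> carrier H"
      "x1 \<in> carrier H" "x2 \<in> carrier H" "x3 \<in> carrier H" for X1 X2 X3 x1 x2 x3
    using that by (intro tens_closed tens_enveloping_closed)
  have cl': "tsum3 (E \<boxtimes>\<^bsub>K\<^esub> E \<boxtimes>\<^bsub>K\<^esub> E) (reass_inv H) (?t X1 X2 X3) \<in> carrier (E \<boxtimes>\<^bsub>K\<^esub> E \<boxtimes>\<^bsub>K\<^esub> E)"
    if "X1 \<in> carrier H" "X2 \<in> carrier H" "X3 \<in> carrier H" for X1 X2 X3
    by (rule tsum3_closed[OF H H H EEE r(2)]) (rule cl[OF that])
  have "tsum3 A (reass E) ?G = tsum3 A (reass H) (\<lambda>X1 X2 X3.
      tsum3 A (tsum3 (E \<boxtimes>\<^bsub>K\<^esub> E \<boxtimes>\<^bsub>K\<^esub> E) (reass_inv H) (?t X1 X2 X3)) ?G)"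
    unfolding reass_enveloping by (rule lin_maps_tsum3[OF H H H EEE A r(1) cl' lin])
  also have "\<dots> = tsum3 A (reass H) (\<lambda>X1 X2 X3. tsum3 A (reass_inv H) (\<lambda>x1 x2 x3.
      ract A (lact A X1 a) x1 \<otimes>\<^bsub>A\<^esub> (ract A (lact A X2 b) x2 \<otimes>\<^bsub>A\<^esub> ract A (lact A X3 c) x3)))"
  proof (rule tsum3_cong[OF H H H r(1)])
    fix X1 X2 X3 assume X: "X1 \<in> carrier H" "X2 \<in> carrier H" "X3 \<in> carrier H"
    have "tsum3 A (tsum3 (E \<boxtimes>\<^bsub>K\<^esub> E \<boxtimes>\<^bsub>K\<^esub> E) (reass_inv H) (?t X1 X2 X3)) ?G =
        tsum3 A (reass_inv H) (\<lambda>x1 x2 x3. tsum3 A (?t X1 X2 X3 x1 x2 x3) ?G)"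
      by (rule lin_maps_tsum3[OF H H H EEE A r(2) cl[OF X] lin])
    also have "\<dots> = tsum3 A (reass_inv H) (\<lambda>x1 x2 x3.
      ract A (lact A X1 a) x1 \<otimes>\<^bsub>A\<^esub> (ract A (lact A X2 b) x2 \<otimes>\<^bsub>A\<^esub> ract A (lact A X3 c) x3))"
    proof (rule tsum3_cong[OF H H H r(2)])
      fix x1 x2 x3 assume x: "x1 \<in> carrier H" "x2 \<in> carrier H" "x3 \<in> carrier H"
      have "tsum3 A (?t X1 X2 X3 x1 x2 x3) ?G =
          ?G (tens K H H' X1 x1) (tens K H H' X2 x2) (tens K H H' X3 x3)"
        using X x by (intro tsum3_tens3[OF E E E A G1 G2] tens_enveloping_closed)
      then show "tsum3 A (?t X1 X2 X3 x1 x2 x3) ?G =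
          ract A (lact A X1 a) x1 \<otimes>\<^bsub>A\<^esub> (ract A (lact A X2 b) x2 \<otimes>\<^bsub>A\<^esub> ract A (lact A X3 c) x3)"
        using X x abc by (simp add: act_tens)
    qed
    finally show "tsum3 A (tsum3 (E \<boxtimes>\<^bsub>K\<^esub> E \<boxtimes>\<^bsub>K\<^esub> E) (reass_inv H) (?t X1 X2 X3)) ?G =
        tsum3 A (reass_inv H) (\<lambda>x1 x2 x3. ract A (lact A X1 a) x1 \<otimes>\<^bsub>A\<^esub>
          (ract A (lact A X2 b) x2 \<otimes>\<^bsub>A\<^esub> ract A (lact A X3 c) x3))" .
  qed
  finally show ?thesis using A.quasi_assoc[OF abc] by simp
qed

lemma left_module_algebra_bimod: "left_module_algebra K E L"
proof (intro left_module_algebra.intro left_module_algebra_axioms.intro)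
  show "unital_algebra K L"
    using A.unital_algebra_axioms same_algebra_sym[OF bimod_as_lmod_same] by (rule unital_algebra_same)
  show "bilinear_map K E L L (act L)"
    using act_bilinear bilinear_map_same[OF same_algebra_refl bimod_as_lmod_same bimod_as_lmod_same]
    by metis
  show "act L \<one>\<^bsub>E\<^esub> a = a" if "a \<in> carrier L" for a
    using that
    by (simp add: one_enveloping act_tens H.unit_closed A.lact_one A.ract_one)
qed (simp_all add: act_mult act_prod act_unit act_quasi_assoc tsum_same[OF bimod_as_lmod_same]
   )

end


section \<open>Generalized diagonal crossed products as smash products\<close>

locale diagonal_action = enveloping_action K H A + Q: quasi_hopf_algebra K H +
    U: bicomodule_algebra K H U
  for K :: "('k, 'c) ring_scheme" (structure)
    and H :: "('k, 'h, 'z) quasi_hopf_scheme"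
    and A :: "('k, 'h, 'a, 'x) bimod_alg_scheme"
    and U :: "('k, 'h, 'u, 'y) bicomod_alg_scheme"
begin

section \<open>Carrier membership of the bicomodule data, the twist and the crossed elements\<close>

lemma left_part_same: "same_algebra (left_part U) U"
  and right_part_same: "same_algebra (right_part U) U"
  by (simp_all add: left_part_def right_part_def same_algebra_def)

lemma algebra_U: "unital_algebra K U"
proof -
  interpret left_comodule_algebra K H "left_part U" by (rule U.left_comodule)
  show ?thesis using unital_algebra_axioms left_part_same by (rule unital_algebra_same)
qed

lemma module_U: "module K U"
  using algebra_U by (rule unital_algebra.axioms)

lemmas U_mult = unital_algebra.mult_bilinear[OF algebra_U]

text \<open>The comodule axioms speak about \<open>left_part U\<close>;
  \<open>tensor_prod_same\<close> exchanges it for \<open>U\<close> inside the tensor product. The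
  closure facts for \<open>right_coact\<close>, \<open>phi_l_inv\<close> and \<open>phi_r\<close>
  are obtained in the same way.\<close>

lemma left_coact_closed: "u \<in> carrier U \<Longrightarrow> left_coact U u \<in> carrier (H \<boxtimes>\<^bsub>K\<^esub> U)"
  using left_comodule_algebra.lcoact_hom[OF U.left_comodule]
    tensor_prod_same[OF same_algebra_refl left_part_same, of H K]
  by (auto simp: alg_hom_def lin_maps_def left_part_def)

lemma right_coact_closed: "u \<in> carrier U \<Longrightarrow> right_coact U u \<in> carrier (U \<boxtimes>\<^bsub>K\<^esub> H)"
  using right_comodule_algebra.rcoact_hom[OF U.right_comodule]
    tensor_prod_same[OF right_part_same same_algebra_refl, of K H]
  by (auto simp: alg_hom_def lin_maps_def right_part_def)

lemma phi_l_inv_closed: "phi_l_inv U \<in> carrier (H \<boxtimes>\<^bsub>K\<^esub> H \<boxtimes>\<^bsub>K\<^esub> U)"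
  using left_comodule_algebra.lreass_invertible[OF U.left_comodule]
    tensor_prod_same[OF same_algebra_refl left_part_same, of H K]
  by (auto simp: mutually_inverse_def left_part_def)

lemma phi_r_closed: "phi_r U \<in> carrier (U \<boxtimes>\<^bsub>K\<^esub> H \<boxtimes>\<^bsub>K\<^esub> H)"
  using right_comodule_algebra.rreass_invertible[OF U.right_comodule]
    tensor_prod_same[OF right_part_same same_algebra_refl, of K "H \<boxtimes>\<^bsub>K\<^esub> H"]
  by (auto simp: mutually_inverse_def right_part_def)

lemma phi_lr_closed: "phi_lr U \<in> carrier (H \<boxtimes>\<^bsub>K\<^esub> U \<boxtimes>\<^bsub>K\<^esub> H)"
  and phi_lr_inv_closed: "phi_lr_inv U \<in> carrier (H \<boxtimes>\<^bsub>K\<^esub> U \<boxtimes>\<^bsub>K\<^esub> H)"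
  using U.phi_lr_invertible by (simp_all add: mutually_inverse_def)

lemma antipode_closed: "h \<in> carrier H \<Longrightarrow> antipode H h \<in> carrier H"
  using Q.antipode_linear by (rule lin_maps_closed)

lemma antipode_inv_closed: "h \<in> carrier H \<Longrightarrow> antipode_inv H h \<in> carrier H"
  unfolding antipode_inv_def using Q.antipode_bij
  by (intro inv_into_into) (simp add: bij_betw_def)

lemmas H_mult_closed = bilinear_closed[OF H.mult_bilinear]
lemmas U_mult_closed = bilinear_closed[OF U_mult]

lemma reass_inv_closed: "reass_inv H \<in> carrier (H \<boxtimes>\<^bsub>K\<^esub> H \<boxtimes>\<^bsub>K\<^esub> H)"
  and reass_closed: "reass H \<in> carrier (H \<boxtimes>\<^bsub>K\<^esub> H \<boxtimes>\<^bsub>K\<^esub> H)"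
  using H.reass_invertible by (simp_all add: mutually_inverse_def)

lemma drinfeld_gamma_closed: "drinfeld_gamma K H \<in> carrier (H \<boxtimes>\<^bsub>K\<^esub> H)"
proof -
  note H = H.module_axioms
  note HH = module_tensor[OF H H]
  interpret HH: module K "H \<boxtimes>\<^bsub>K\<^esub> H" by (rule HH)
  note HA = H.unital_algebra_axioms
  have "unital_algebra K (H \<boxtimes>\<^bsub>K\<^esub> H \<boxtimes>\<^bsub>K\<^esub> H \<boxtimes>\<^bsub>K\<^esub> H)"
    by (intro unital_algebra_tensor HA)
  note mult = bilinear_closed[OF unital_algebra.mult_bilinear[OF this]]
  have "append_unit K H H H H (reass H)
        \<otimes>\<^bsub>H \<boxtimes>\<^bsub>K\<^esub> H \<boxtimes>\<^bsub>K\<^esub> H \<boxtimes>\<^bsub>K\<^esub> H\<^esub> split1 K H H (H \<boxtimes>\<^bsub>K\<^esub> H) (comul H) (reass_inv H)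
      \<in> carrier (H \<boxtimes>\<^bsub>K\<^esub> H \<boxtimes>\<^bsub>K\<^esub> H \<boxtimes>\<^bsub>K\<^esub> H)"
    by (intro mult append_unit_closed[OF H H H H] split1_closed[OF H H H HH] H.unit_closed
        reass_closed reass_inv_closed comul_closed)
  then show ?thesis
    unfolding drinfeld_gamma_def
    by (rule tsum_closed[OF H module_tensor[OF H HH] HH.abelian_monoid_axioms])
      (rule tsum3_closed[OF H H H HH], assumption,
        intro tens_closed H_mult_closed antipode_closed Q.alpha_closed)
qed

lemma drinfeld_twist_closed: "drinfeld_twist K H \<in> carrier (H \<boxtimes>\<^bsub>K\<^esub> H)"
proof -
  note H = H.module_axioms
  note HH = module_tensor[OF H H]
  interpret HH: module K "H \<boxtimes>\<^bsub>K\<^esub> H" by (rule HH)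
  note mult = bilinear_closed[OF bilinear_tensor_mult[OF H.unital_algebra_axioms H.unital_algebra_axioms]]
  show ?thesis
    unfolding drinfeld_twist_def
    by (rule tsum3_closed[OF H H H HH reass_inv_closed])
      (intro mult tsum_closed[OF H H HH.abelian_monoid_axioms] comul_closed drinfeld_gamma_closed
        tens_closed antipode_closed H_mult_closed Q.beta_closed)
qed

text \<open>The nested sums are peeled off in the order of the definitions, each by the closure of
  the tensor it runs over. Membership allows term-by-term comparison over these elements.\<close>

lemma crossed_elements_closed:
  shows Omega_elt_closed: "Omega_elt K H U \<in> carrier (H \<boxtimes>\<^bsub>K\<^esub> H \<boxtimes>\<^bsub>K\<^esub> U \<boxtimes>\<^bsub>K\<^esub> H \<boxtimes>\<^bsub>K\<^esub> H)"
    and omega_elt_closed: "omega_elt K H U \<in> carrier (H \<boxtimes>\<^bsub>K\<^esub> H \<boxtimes>\<^bsub>K\<^esub> U \<boxtimes>\<^bsub>K\<^esub> H \<boxtimes>\<^bsub>K\<^esub> H)"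
proof -
  note H = H.module_axioms and U = module_U
  have T: "module K (H \<boxtimes>\<^bsub>K\<^esub> H \<boxtimes>\<^bsub>K\<^esub> U \<boxtimes>\<^bsub>K\<^esub> H \<boxtimes>\<^bsub>K\<^esub> H)"
    by (intro module_tensor H U)
  interpret T: module K "H \<boxtimes>\<^bsub>K\<^esub> H \<boxtimes>\<^bsub>K\<^esub> U \<boxtimes>\<^bsub>K\<^esub> H \<boxtimes>\<^bsub>K\<^esub> H" by (rule T)
  note sum = T.abelian_monoid_axioms
  note cl = tens_closed H_mult_closed U_mult_closed antipode_inv_closed
  show "Omega_elt K H U \<in> carrier (H \<boxtimes>\<^bsub>K\<^esub> H \<boxtimes>\<^bsub>K\<^esub> U \<boxtimes>\<^bsub>K\<^esub> H \<boxtimes>\<^bsub>K\<^esub> H)"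
    unfolding Omega_elt_def Let_def
    by (rule tsum3_closed[OF U H H T phi_r_closed], rule tsum3_closed[OF H H U T phi_l_inv_closed],
        rule tsum3_closed[OF H U H T phi_lr_inv_closed],
        rule tsum_closed[OF H H sum drinfeld_twist_closed],
        rule tsum_closed[OF H U sum left_coact_closed], assumption,
        rule tsum_closed[OF H H sum comul_closed], assumption,
        rule tsum_closed[OF H U sum left_coact_closed], assumption, intro cl)
  show "omega_elt K H U \<in> carrier (H \<boxtimes>\<^bsub>K\<^esub> H \<boxtimes>\<^bsub>K\<^esub> U \<boxtimes>\<^bsub>K\<^esub> H \<boxtimes>\<^bsub>K\<^esub> H)"
    unfolding omega_elt_def Let_def
    by (rule tsum3_closed[OF H H U T phi_l_inv_closed], rule tsum3_closed[OF U H H T phi_r_closed],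
        rule tsum3_closed[OF H U H T phi_lr_closed],
        rule tsum_closed[OF H H sum drinfeld_twist_closed],
        rule tsum_closed[OF U H sum right_coact_closed], assumption,
        rule tsum_closed[OF H H sum comul_closed], assumption,
        rule tsum_closed[OF U H sum right_coact_closed], assumption, intro cl)
qed

section \<open>Comparison of the multiplications\<close>

lemma smash_summand_bilinear:
  assumes "k \<in> carrier A" "y \<in> carrier E" "a \<in> carrier A" "c \<in> carrier U" "v \<in> carrier U"
  shows "bilinear_map K E U (A \<boxtimes>\<^bsub>K\<^esub> U)
    (\<lambda>x b. tens K A U (k \<otimes>\<^bsub>A\<^esub> act L (y \<otimes>\<^bsub>E\<^esub> x) a) (c \<otimes>\<^bsub>U\<^esub> b \<otimes>\<^bsub>U\<^esub> v))"
proof -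
  note T = bilinear_tens[OF A.module_axioms module_U]
  note E_mult = unital_algebra.mult_bilinear[OF algebra_enveloping]
  show ?thesis
    using assms
    by (intro bilinear_mapI bilinear_compose_left[OF T] bilinear_compose_right[OF T]
        bilinear_compose_right[OF A.mult_bilinear] bilinear_compose_left[OF act_bilinear]
        bilinear_lin_right[OF E_mult] bilinear_compose_left[OF U_mult] bilinear_lin_right[OF U_mult]
        A_mult_closed U_mult_closed act_closed bilinear_closed[OF E_mult])
qed

text \<open>Turns the sum over the inverse reassociator of the smash product into one over the five
  components of \<open>w\<close>. The sum over \<open>D\<close> stays unevaluated as a parameter, so
  the summand is trilinear and the universal property applies. With \<open>w\<close> and
  \<open>D\<close> arbitrary, both comodule algebras are covered.\<close>

lemma fold5_tsum3:
  assumes w: "w \<in> carrier (H \<boxtimes>\<^bsub>K\<^esub> H \<boxtimes>\<^bsub>K\<^esub> U \<boxtimes>\<^bsub>K\<^esub> H \<boxtimes>\<^bsub>K\<^esub> H)"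
    and D: "D \<in> carrier (E \<boxtimes>\<^bsub>K\<^esub> U)"
    and ab: "a \<in> carrier A" "b \<in> carrier A" and v: "v \<in> carrier U"
  shows "tsum3 (A \<boxtimes>\<^bsub>K\<^esub> U) (fold5 K H U w) (\<lambda>x1 x2 x3. tsum (A \<boxtimes>\<^bsub>K\<^esub> U) D (\<lambda>d u.
      tens K A U (act L x1 a \<otimes>\<^bsub>A\<^esub> act L (x2 \<otimes>\<^bsub>E\<^esub> d) b) (x3 \<otimes>\<^bsub>U\<^esub> u \<otimes>\<^bsub>U\<^esub> v))) =
    tsum5 (A \<boxtimes>\<^bsub>K\<^esub> U) w (\<lambda>w1 w2 w3 w4 w5. tsum (A \<boxtimes>\<^bsub>K\<^esub> U) D (\<lambda>d u.
      tens K A U (ract A (lact A w1 a) w5 \<otimes>\<^bsub>A\<^esub> act L (tens K H H' w2 w4 \<otimes>\<^bsub>E\<^esub> d) b)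
        (w3 \<otimes>\<^bsub>U\<^esub> u \<otimes>\<^bsub>U\<^esub> v)))"
    (is "tsum3 ?T _ ?G = _")
proof -
  note H = H.module_axioms and U = module_U and A = A.module_axioms and E = module_enveloping
  note T = module_tensor[OF A U] and EU = module_tensor[OF E U]
  note EEU = module_tensor[OF E EU]
  note tens = bilinear_tens[OF A U]
  note E_mult = unital_algebra.mult_bilinear[OF algebra_enveloping]
  note cl = A_mult_closed U_mult_closed act_closed bilinear_closed[OF E_mult]
  have G1: "bilinear_map K E U ?T (?G x)" if "x \<in> carrier E" for x
    using that ab v
    by (intro bilinear_mapI tsum_lin_param[OF E U T D]
        bilinear_compose_left[OF tens] bilinear_compose_right[OF tens]
        bilinear_compose_right[OF A.mult_bilinear] bilinear_compose_left[OF act_bilinear]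
        bilinear_lin_left[OF E_mult] bilinear_compose_left[OF U_mult] bilinear_lin_left[OF U_mult] cl)
  have G2: "(\<lambda>x. ?G x y z) \<in> lin_maps K E ?T" if "y \<in> carrier E" "z \<in> carrier U" for y z
    using that ab v
    by (intro tsum_lin_param[OF E U T D] bilinear_compose_left[OF tens]
        bilinear_compose_left[OF A.mult_bilinear] bilinear_lin_left[OF act_bilinear] cl)
  have lin: "(\<lambda>r. tsum3 ?T r ?G) \<in> lin_maps K (E \<boxtimes>\<^bsub>K\<^esub> E \<boxtimes>\<^bsub>K\<^esub> U) ?T"
    by (rule tsum_linear[OF E EU T tsum_bilinear[OF E E U T G1 G2]])
  let ?t = "\<lambda>w1 w2 w3 w4 w5. tens3 K E E U (tens K H H' w1 w5) (tens K H H' w2 w4) w3"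
  have "tsum3 ?T (fold5 K H U w) ?G = tsum5 ?T w (\<lambda>w1 w2 w3 w4 w5. tsum3 ?T (?t w1 w2 w3 w4 w5) ?G)"
    unfolding fold5_def Let_def
    by (rule lin_maps_tsum5[OF H H U H H EEU T w _ lin])
      (intro tens_closed tens_enveloping_closed)
  also have "\<dots> = tsum5 ?T w (\<lambda>w1 w2 w3 w4 w5. ?G (tens K H H' w1 w5) (tens K H H' w2 w4) w3)"
    by (rule tsum5_cong[OF H H U H H w], rule tsum3_tens3[OF E E U T G1 G2])
      (simp_all add: tens_enveloping_closed)
  also have "\<dots> = tsum5 ?T w (\<lambda>w1 w2 w3 w4 w5. tsum ?T D (\<lambda>d u.
      tens K A U (ract A (lact A w1 a) w5 \<otimes>\<^bsub>A\<^esub> act L (tens K H H' w2 w4 \<otimes>\<^bsub>E\<^esub> d) b)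
        (w3 \<otimes>\<^bsub>U\<^esub> u \<otimes>\<^bsub>U\<^esub> v)))"
    by (rule tsum5_cong[OF H H U H H w]) (simp add: act_tens ab)
  finally show ?thesis .
qed

text \<open>Explains the order of the right-hand factors in the crossed products: the coaction
  supplies \<open>l\<close> and the crossed element supplies \<open>k\<close>, and the opposite
  multiplication puts \<open>l\<close> first.\<close>

lemma act_mult_tens:
  assumes "g \<in> carrier H" "h \<in> carrier H" "k \<in> carrier H" "l \<in> carrier H" "a \<in> carrier A"
  shows "act L (tens K H H' g k \<otimes>\<^bsub>E\<^esub> tens K H H' h l) a = ract A (lact A (g \<otimes>\<^bsub>H\<^esub> h) a) (l \<otimes>\<^bsub>H\<^esub> k)"
  using assms by (simp add: enveloping_mult_tens act_tens H_mult_closed)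

lemma comod1_same: "same_algebra (comod1 K H U) U"
  and comod2_same: "same_algebra (comod2 K H U) U"
  by (simp_all add: comod1_def comod2_def same_algebra_def Let_def)

lemma lcoact_comod1: "lcoact (comod1 K H U) u =
    tsum (E \<boxtimes>\<^bsub>K\<^esub> U) (right_coact U u) (\<lambda>u0 u1. tsum (E \<boxtimes>\<^bsub>K\<^esub> U) (left_coact U u0) (\<lambda>u0m u00.
      tens K E U (tens K H H' u0m (antipode_inv H u1)) u00))"
  and lcoact_comod2: "lcoact (comod2 K H U) u =
    tsum (E \<boxtimes>\<^bsub>K\<^esub> U) (left_coact U u) (\<lambda>um u0. tsum (E \<boxtimes>\<^bsub>K\<^esub> U) (right_coact U u0) (\<lambda>u00 u01.
      tens K E U (tens K H H' um (antipode_inv H u01)) u00))"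
  by (simp_all add: comod1_def comod2_def Let_def)

text \<open>The coaction is itself a nested Sweedler sum, so a bilinear function of it is moved
  under both coactions of \<open>U\<close> and evaluated on the pure tensors there.\<close>

lemma lcoact_comod1_sum:
  assumes u: "u \<in> carrier U"
  shows "lcoact (comod1 K H U) u \<in> carrier (E \<boxtimes>\<^bsub>K\<^esub> U)"
    and "\<lbrakk>module K W; bilinear_map K E U W F\<rbrakk> \<Longrightarrow>
      tsum W (lcoact (comod1 K H U) u) F =
        tsum W (right_coact U u) (\<lambda>u0 u1. tsum W (left_coact U u0) (\<lambda>u0m u00.
          F (tens K H H' u0m (antipode_inv H u1)) u00))"
proof -
  note H = H.module_axioms and U = module_U and E = module_enveloping
  note EU = module_tensor[OF E U]
  interpret EU: module K "E \<boxtimes>\<^bsub>K\<^esub> U" by (rule EU)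
  let ?t = "\<lambda>u0m u1 u00. tens K E U (tens K H H' u0m (antipode_inv H u1)) u00"
  have cl: "?t h l v \<in> carrier (E \<boxtimes>\<^bsub>K\<^esub> U)"
    if "h \<in> carrier H" "l \<in> carrier H" "v \<in> carrier U" for h l v
    using that by (intro tens_closed tens_enveloping_closed antipode_inv_closed)
  have cl': "tsum (E \<boxtimes>\<^bsub>K\<^esub> U) (left_coact U v) (\<lambda>h v. ?t h l v) \<in> carrier (E \<boxtimes>\<^bsub>K\<^esub> U)"
    if "v \<in> carrier U" "l \<in> carrier H" for v l
    using that by (intro tsum_closed[OF H U EU.abelian_monoid_axioms] left_coact_closed cl)
  show "lcoact (comod1 K H U) u \<in> carrier (E \<boxtimes>\<^bsub>K\<^esub> U)"
    unfolding lcoact_comod1 using u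
    by (intro tsum_closed[OF U H EU.abelian_monoid_axioms] right_coact_closed cl')
  assume W: "module K W" and F: "bilinear_map K E U W F"
  note lin = tsum_linear[OF E U W F]
  have "tsum W (lcoact (comod1 K H U) u) F = tsum W (right_coact U u)
      (\<lambda>u0 u1. tsum W (tsum (E \<boxtimes>\<^bsub>K\<^esub> U) (left_coact U u0) (\<lambda>u0m u00. ?t u0m u1 u00)) F)"
    unfolding lcoact_comod1 by (rule lin_maps_tsum[OF U H EU W right_coact_closed[OF u] cl' lin])
  also have "\<dots> = tsum W (right_coact U u) (\<lambda>u0 u1. tsum W (left_coact U u0)
      (\<lambda>u0m u00. tsum W (?t u0m u1 u00) F))"
    by (rule tsum_cong[OF U H right_coact_closed[OF u]],
        rule lin_maps_tsum[OF H U EU W left_coact_closed cl lin])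
  also have "\<dots> = tsum W (right_coact U u) (\<lambda>u0 u1. tsum W (left_coact U u0)
      (\<lambda>u0m u00. F (tens K H H' u0m (antipode_inv H u1)) u00))"
    by (rule tsum_cong[OF U H right_coact_closed[OF u]], rule tsum_cong[OF H U left_coact_closed],
        assumption, rule tsum_tens[OF E U W F tens_enveloping_closed])
      (simp_all add: antipode_inv_closed)
  finally show "tsum W (lcoact (comod1 K H U) u) F =
      tsum W (right_coact U u) (\<lambda>u0 u1. tsum W (left_coact U u0)
        (\<lambda>u0m u00. F (tens K H H' u0m (antipode_inv H u1)) u00))" .
qed

text \<open>The same argument with the left coaction applied before the right one.\<close>

lemma lcoact_comod2_sum:
  assumes u: "u \<in> carrier U"
  shows "lcoact (comod2 K H U) u \<in> carrier (E \<boxtimes>\<^bsub>K\<^esub> U)"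
    and "\<lbrakk>module K W; bilinear_map K E U W F\<rbrakk> \<Longrightarrow>
      tsum W (lcoact (comod2 K H U) u) F =
        tsum W (left_coact U u) (\<lambda>um u0. tsum W (right_coact U u0) (\<lambda>u00 u01.
          F (tens K H H' um (antipode_inv H u01)) u00))"
proof -
  note H = H.module_axioms and U = module_U and E = module_enveloping
  note EU = module_tensor[OF E U]
  interpret EU: module K "E \<boxtimes>\<^bsub>K\<^esub> U" by (rule EU)
  let ?t = "\<lambda>um u01 u00. tens K E U (tens K H H' um (antipode_inv H u01)) u00"
  have cl: "?t h l v \<in> carrier (E \<boxtimes>\<^bsub>K\<^esub> U)"
    if "h \<in> carrier H" "l \<in> carrier H" "v \<in> carrier U" for h l v
    using that by (intro tens_closed tens_enveloping_closed antipode_inv_closed)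
  have cl': "tsum (E \<boxtimes>\<^bsub>K\<^esub> U) (right_coact U v) (\<lambda>v l. ?t h l v) \<in> carrier (E \<boxtimes>\<^bsub>K\<^esub> U)"
    if "h \<in> carrier H" "v \<in> carrier U" for h v
    using that by (intro tsum_closed[OF U H EU.abelian_monoid_axioms] right_coact_closed cl)
  show "lcoact (comod2 K H U) u \<in> carrier (E \<boxtimes>\<^bsub>K\<^esub> U)"
    unfolding lcoact_comod2 using u
    by (intro tsum_closed[OF H U EU.abelian_monoid_axioms] left_coact_closed cl')
  assume W: "module K W" and F: "bilinear_map K E U W F"
  note lin = tsum_linear[OF E U W F]
  have "tsum W (lcoact (comod2 K H U) u) F = tsum W (left_coact U u)
      (\<lambda>um u0. tsum W (tsum (E \<boxtimes>\<^bsub>K\<^esub> U) (right_coact U u0) (\<lambda>u00 u01. ?t um u01 u00)) F)"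
    unfolding lcoact_comod2 by (rule lin_maps_tsum[OF H U EU W left_coact_closed[OF u] cl' lin])
  also have "\<dots> = tsum W (left_coact U u) (\<lambda>um u0. tsum W (right_coact U u0)
      (\<lambda>u00 u01. tsum W (?t um u01 u00) F))"
    by (rule tsum_cong[OF H U left_coact_closed[OF u]],
        rule lin_maps_tsum[OF U H EU W right_coact_closed cl lin])
  also have "\<dots> = tsum W (left_coact U u) (\<lambda>um u0. tsum W (right_coact U u0)
      (\<lambda>u00 u01. F (tens K H H' um (antipode_inv H u01)) u00))"
    by (rule tsum_cong[OF H U left_coact_closed[OF u]], rule tsum_cong[OF U H right_coact_closed],
        assumption, rule tsum_tens[OF E U W F tens_enveloping_closed])
      (simp_all add: antipode_inv_closed)
  finally show "tsum W (lcoact (comod2 K H U) u) F =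
      tsum W (left_coact U u) (\<lambda>um u0. tsum W (right_coact U u0)
        (\<lambda>u00 u01. F (tens K H H' um (antipode_inv H u01)) u00))" .
qed

text \<open>The part common to both cases: the inverse reassociator is unfolded and the coaction
  kept as it is, since the two comodule algebras differ in their coactions.\<close>

lemma smash_prod_mult:
  assumes B: "same_algebra B U"
    and w: "w \<in> carrier (H \<boxtimes>\<^bsub>K\<^esub> H \<boxtimes>\<^bsub>K\<^esub> U \<boxtimes>\<^bsub>K\<^esub> H \<boxtimes>\<^bsub>K\<^esub> H)" "lreass_inv B = fold5 K H U w"
    and coact: "\<And>u. u \<in> carrier U \<Longrightarrow> lcoact B u \<in> carrier (E \<boxtimes>\<^bsub>K\<^esub> U)"
    and s: "s \<in> carrier (A \<boxtimes>\<^bsub>K\<^esub> U)" "s' \<in> carrier (A \<boxtimes>\<^bsub>K\<^esub> U)"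
  shows "s \<otimes>\<^bsub>smash_prod K E L B\<^esub> s' =
    tsum (A \<boxtimes>\<^bsub>K\<^esub> U) s (\<lambda>a u. tsum (A \<boxtimes>\<^bsub>K\<^esub> U) s' (\<lambda>b v. tsum5 (A \<boxtimes>\<^bsub>K\<^esub> U) w (\<lambda>w1 w2 w3 w4 w5.
      tsum (A \<boxtimes>\<^bsub>K\<^esub> U) (lcoact B u) (\<lambda>d c.
        tens K A U (ract A (lact A w1 a) w5 \<otimes>\<^bsub>A\<^esub> act L (tens K H H' w2 w4 \<otimes>\<^bsub>E\<^esub> d) b)
          (w3 \<otimes>\<^bsub>U\<^esub> c \<otimes>\<^bsub>U\<^esub> v)))))"
proof -
  have mult: "monoid.mult B = monoid.mult U"
    using B by (simp add: same_algebra_def)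
  have "s \<otimes>\<^bsub>smash_prod K E L B\<^esub> s' =
    tsum (A \<boxtimes>\<^bsub>K\<^esub> U) s (\<lambda>a u. tsum (A \<boxtimes>\<^bsub>K\<^esub> U) s' (\<lambda>b v.
      tsum3 (A \<boxtimes>\<^bsub>K\<^esub> U) (fold5 K H U w) (\<lambda>x1 x2 x3. tsum (A \<boxtimes>\<^bsub>K\<^esub> U) (lcoact B u) (\<lambda>d c.
        tens K A U (act L x1 a \<otimes>\<^bsub>A\<^esub> act L (x2 \<otimes>\<^bsub>E\<^esub> d) b) (x3 \<otimes>\<^bsub>U\<^esub> c \<otimes>\<^bsub>U\<^esub> v)))))"
    unfolding smash_prod_def Let_def tensor_prod_same[OF bimod_as_lmod_same B]
      tens_same[OF bimod_as_lmod_same B]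
    by (simp add: mult w(2))
  also have "\<dots> = tsum (A \<boxtimes>\<^bsub>K\<^esub> U) s (\<lambda>a u. tsum (A \<boxtimes>\<^bsub>K\<^esub> U) s' (\<lambda>b v.
      tsum5 (A \<boxtimes>\<^bsub>K\<^esub> U) w (\<lambda>w1 w2 w3 w4 w5. tsum (A \<boxtimes>\<^bsub>K\<^esub> U) (lcoact B u) (\<lambda>d c.
        tens K A U (ract A (lact A w1 a) w5 \<otimes>\<^bsub>A\<^esub> act L (tens K H H' w2 w4 \<otimes>\<^bsub>E\<^esub> d) b)
          (w3 \<otimes>\<^bsub>U\<^esub> c \<otimes>\<^bsub>U\<^esub> v)))))"
    by (rule tsum_cong[OF A.module_axioms module_U s(1)],
        rule tsum_cong[OF A.module_axioms module_U s(2)],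
        rule fold5_tsum3[OF w(1) coact])
  finally show ?thesis .
qed

lemma diag_crossed_prod_mult:
  assumes s: "s \<in> carrier (A \<boxtimes>\<^bsub>K\<^esub> U)" "s' \<in> carrier (A \<boxtimes>\<^bsub>K\<^esub> U)"
  shows "s \<otimes>\<^bsub>diag_crossed_prod K H A U\<^esub> s' = s \<otimes>\<^bsub>smash_prod K E L (comod1 K H U)\<^esub> s'"
proof -
  note H = H.module_axioms and U = module_U and A = A.module_axioms and E = module_enveloping
  note T = module_tensor[OF A U]
  have w: "lreass_inv (comod1 K H U) = fold5 K H U (Omega_elt K H U)"
    by (simp add: comod1_def Let_def)
  have inner: "tsum (A \<boxtimes>\<^bsub>K\<^esub> U) (lcoact (comod1 K H U) u) (\<lambda>d c.
        tens K A U (ract A (lact A w1 a) w5 \<otimes>\<^bsub>A\<^esub> act L (tens K H H' w2 w4 \<otimes>\<^bsub>E\<^esub> d) b)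
          (w3 \<otimes>\<^bsub>U\<^esub> c \<otimes>\<^bsub>U\<^esub> v)) =
      tsum (A \<boxtimes>\<^bsub>K\<^esub> U) (right_coact U u) (\<lambda>u0 u1. tsum (A \<boxtimes>\<^bsub>K\<^esub> U) (left_coact U u0) (\<lambda>u0m u00.
        tens K A U (ract A (lact A w1 a) w5 \<otimes>\<^bsub>A\<^esub>
            ract A (lact A (w2 \<otimes>\<^bsub>H\<^esub> u0m) b) (antipode_inv H u1 \<otimes>\<^bsub>H\<^esub> w4))
          (w3 \<otimes>\<^bsub>U\<^esub> u00 \<otimes>\<^bsub>U\<^esub> v)))"
    if w: "w1 \<in> carrier H" "w2 \<in> carrier H" "w3 \<in> carrier U" "w4 \<in> carrier H" "w5 \<in> carrier H"
      and ab: "a \<in> carrier A" "u \<in> carrier U" "b \<in> carrier A" "v \<in> carrier U" for w1 w2 w3 w4 w5 a u b v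
    \<comment> \<open>In \<open>smash_summand_bilinear\<close>, \<open>k\<close> is \<open>a\<close>
      acted on by \<open>w1\<close> and \<open>w5\<close>, and \<open>y\<close> is the pure tensor
      of \<open>w2\<close> and \<open>w4\<close>.\<close>
    unfolding lcoact_comod1_sum(2)[OF ab(2) T smash_summand_bilinear[OF
        ract_closed[OF lact_closed[OF w(1) ab(1)] w(5)] tens_enveloping_closed[OF w(2,4)] ab(3) w(3) ab(4)]]
    by (rule tsum_cong[OF U H right_coact_closed[OF ab(2)]], rule tsum_cong[OF H U left_coact_closed])
      (simp_all add: act_mult_tens w ab antipode_inv_closed)
  show ?thesis
    \<comment> \<open>Once the smash product is expanded, both sides sum over the same
      \<open>s\<close>, \<open>s'\<close> and \<open>Omega_elt\<close>, hence over the same chosen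
      lists; what remains is the equality of the innermost terms.\<close>
    by (rule HOL.trans[OF _ smash_prod_mult[OF comod1_same Omega_elt_closed w lcoact_comod1_sum(1) s,
          symmetric]],
        simp add: diag_crossed_prod_def Let_def,
        rule tsum_cong[OF A U s(1)], rule tsum_cong[OF A U s(2)],
        rule tsum5_cong[OF H H U H H Omega_elt_closed], rule inner[symmetric])
qed

lemma diag_crossed_prod'_mult:
  assumes s: "s \<in> carrier (A \<boxtimes>\<^bsub>K\<^esub> U)" "s' \<in> carrier (A \<boxtimes>\<^bsub>K\<^esub> U)"
  shows "s \<otimes>\<^bsub>diag_crossed_prod' K H A U\<^esub> s' = s \<otimes>\<^bsub>smash_prod K E L (comod2 K H U)\<^esub> s'"
proof -
  note H = H.module_axioms and U = module_U and A = A.module_axioms and E = module_enveloping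
  note T = module_tensor[OF A U]
  have w: "lreass_inv (comod2 K H U) = fold5 K H U (omega_elt K H U)"
    by (simp add: comod2_def Let_def)
  have inner: "tsum (A \<boxtimes>\<^bsub>K\<^esub> U) (lcoact (comod2 K H U) u) (\<lambda>d c.
        tens K A U (ract A (lact A w1 a) w5 \<otimes>\<^bsub>A\<^esub> act L (tens K H H' w2 w4 \<otimes>\<^bsub>E\<^esub> d) b)
          (w3 \<otimes>\<^bsub>U\<^esub> c \<otimes>\<^bsub>U\<^esub> v)) =
      tsum (A \<boxtimes>\<^bsub>K\<^esub> U) (left_coact U u) (\<lambda>um u0. tsum (A \<boxtimes>\<^bsub>K\<^esub> U) (right_coact U u0) (\<lambda>u00 u01.
        tens K A U (ract A (lact A w1 a) w5 \<otimes>\<^bsub>A\<^esub>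
            ract A (lact A (w2 \<otimes>\<^bsub>H\<^esub> um) b) (antipode_inv H u01 \<otimes>\<^bsub>H\<^esub> w4))
          (w3 \<otimes>\<^bsub>U\<^esub> u00 \<otimes>\<^bsub>U\<^esub> v)))"
    if w: "w1 \<in> carrier H" "w2 \<in> carrier H" "w3 \<in> carrier U" "w4 \<in> carrier H" "w5 \<in> carrier H"
      and ab: "a \<in> carrier A" "u \<in> carrier U" "b \<in> carrier A" "v \<in> carrier U" for w1 w2 w3 w4 w5 a u b v
    unfolding lcoact_comod2_sum(2)[OF ab(2) T smash_summand_bilinear[OF
        ract_closed[OF lact_closed[OF w(1) ab(1)] w(5)] tens_enveloping_closed[OF w(2,4)] ab(3) w(3) ab(4)]]
    by (rule tsum_cong[OF H U left_coact_closed[OF ab(2)]], rule tsum_cong[OF U H right_coact_closed])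
      (simp_all add: act_mult_tens w ab antipode_inv_closed)
  show ?thesis
    by (rule HOL.trans[OF _ smash_prod_mult[OF comod2_same omega_elt_closed w lcoact_comod2_sum(1) s,
          symmetric]],
        simp add: diag_crossed_prod'_def Let_def,
        rule tsum_cong[OF A U s(1)], rule tsum_cong[OF A U s(2)],
        rule tsum5_cong[OF H H U H H omega_elt_closed], rule inner[symmetric])
qed

text \<open>Both algebras are updates of one record in the field of the multiplication. They share
  carrier, unit and linear structure, so agreement of the products on the carrier is all that is
  left.\<close>

lemma identity_alg_iso:
  assumes "\<And>s s'. \<lbrakk>s \<in> carrier (A \<boxtimes>\<^bsub>K\<^esub> U); s' \<in> carrier (A \<boxtimes>\<^bsub>K\<^esub> U)\<rbrakk> \<Longrightarrow> f s s' = g s s'"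
  shows "(\<lambda>x. x) \<in> alg_iso K ((A \<boxtimes>\<^bsub>K\<^esub> U)\<lparr>monoid.mult := f\<rparr>) ((A \<boxtimes>\<^bsub>K\<^esub> U)\<lparr>monoid.mult := g\<rparr>)"
  using assms by (simp add: alg_iso_def alg_hom_def ring_hom_def lin_maps_def bij_betw_def)

text \<open>Exhibits the smash product as an update of the tensor product of \<open>A\<close> and
  \<open>U\<close> themselves, the form that \<open>identity_alg_iso\<close> expects.\<close>

lemma smash_prod_update:
  assumes "same_algebra B U"
  shows "smash_prod K E L B = (A \<boxtimes>\<^bsub>K\<^esub> U)\<lparr>monoid.mult := monoid.mult (smash_prod K E L B)\<rparr>"
  unfolding smash_prod_def Let_def tensor_prod_same[OF bimod_as_lmod_same assms] by simp

lemma diag_crossed_prod_update: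
  "diag_crossed_prod K H A U = (A \<boxtimes>\<^bsub>K\<^esub> U)\<lparr>monoid.mult := monoid.mult (diag_crossed_prod K H A U)\<rparr>"
  "diag_crossed_prod' K H A U = (A \<boxtimes>\<^bsub>K\<^esub> U)\<lparr>monoid.mult := monoid.mult (diag_crossed_prod' K H A U)\<rparr>"
  by (simp_all add: diag_crossed_prod_def diag_crossed_prod'_def Let_def)

lemma diag_crossed_prod_iso:
  "(\<lambda>x. x) \<in> alg_iso K (diag_crossed_prod K H A U) (smash_prod K E L (comod1 K H U))"
  by (subst diag_crossed_prod_update, subst smash_prod_update[OF comod1_same],
      rule identity_alg_iso, rule diag_crossed_prod_mult)

lemma diag_crossed_prod'_iso:
  "(\<lambda>x. x) \<in> alg_iso K (diag_crossed_prod' K H A U) (smash_prod K E L (comod2 K H U))"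
  by (subst diag_crossed_prod_update, subst smash_prod_update[OF comod2_same],
      rule identity_alg_iso, rule diag_crossed_prod'_mult)

end

theorem proposition4p2:
  fixes K :: "('k, 'c) ring_scheme"
    and H :: "('k, 'h, 'z) quasi_hopf_scheme"
    and A :: "('k, 'h, 'a, 'x) bimod_alg_scheme"
    and U :: "('k, 'h, 'u, 'y) bicomod_alg_scheme"
  assumes "quasi_hopf_algebra K H"
    and "bimodule_algebra K H A"
    and "bicomodule_algebra K H U"
  shows "left_module_algebra K (enveloping K H) (bimod_as_lmod A) \<and>
    (\<exists>F \<in> alg_iso K (diag_crossed_prod K H A U)
            (smash_prod K (enveloping K H) (bimod_as_lmod A) (comod1 K H U)).
      \<forall>\<phi>\<in>carrier A. \<forall>u\<in>carrier U.
        F (tens K A U \<phi> u) = tens K (bimod_as_lmod A) (comod1 K H U) \<phi> u) \<and>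
    (\<exists>F \<in> alg_iso K (diag_crossed_prod' K H A U)
            (smash_prod K (enveloping K H) (bimod_as_lmod A) (comod2 K H U)).
      \<forall>\<phi>\<in>carrier A. \<forall>u\<in>carrier U.
        F (tens K A U \<phi> u) = tens K (bimod_as_lmod A) (comod2 K H U) \<phi> u)"
proof -
  interpret H: quasi_hopf_algebra K H by fact
  interpret A: bimodule_algebra K H A by fact
  interpret U: bicomodule_algebra K H U by fact
  interpret diagonal_action K H A U by unfold_locales
  \<comment> \<open>The identity is the witness in both cases. It respects pure tensors because
    \<open>tens\<close> formed with \<open>bimod_as_lmod A\<close> and \<open>comod1\<close> or
    \<open>comod2\<close> is the same function as \<open>tens\<close> formed with \<open>A\<close>
    and \<open>U\<close>.\<close>
  show ?thesis
    using left_module_algebra_bimod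
      bexI[OF _ diag_crossed_prod_iso] bexI[OF _ diag_crossed_prod'_iso]
    by (simp add: tens_same[OF bimod_as_lmod_same comod1_same] tens_same[OF bimod_as_lmod_same comod2_same])
qed

end
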